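(* A non-empty subset $\Gamma$ of $\mathbb{C}$ is a hypercyclic scalar set if and only if $\Gamma\setminus\{0\}$ is non-empty, bounded and bounded away from $0$.
   Context: For a complex Banach space $X$, $L(X)$ denotes the space of bounded linear operators on $X$. For $T\in L(X)$, $x\in X$ and a non-empty set $\Gamma\subset\mathbb{C}$, put $\mathrm{Orb}(\Gamma x,T)=\{\gamma T^n x:\ \gamma\in\Gamma,\ n\ge 0\}$, and $\overline{\mathrm{Orb}}(\Gamma x,T)$ is its norm closure. A vector $x\in X$ is hypercyclic for $T$ if $\{T^n x: n\ge 0\}$ is dense in $X$. A set $\Gamma\subset\mathbb{C}$ is called a hypercyclic scalar set if the following holds: for every infinite-dimensional complex Banach space $X$, every $T\in L(X)$ and every $x\in X$, one has $\overline{\mathrm{Orb}}(\Gamma x,T)=X$ if and only if $x$ is hypercyclic for $T$. A set $A\subset\mathbb{C}$ is bounded away from $0$ if there is $\delta>0$ such that $|z|\ge\delta$ for all $z\in A$. *)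

theory Defs
  imports "HOL-Analysis.Analysis" "HOL-Algebra.Algebraic_Closure_Type"
begin

text \<open>
  A complex Banach space is given by an explicit carrier inside a type, so that the quantifier
  "for every Banach space" can be written inside a formula. The vector space structure is that
  of a HOL-Algebra module over the field of complex numbers (the fields \<open>mult\<close> and \<open>one\<close>
  of the module record play no role).
\<close>

abbreviation complex_field :: "complex ring"
  where "complex_field \<equiv> ring_of_type_algebra"

text \<open>
  The value 0 off the carrier is a dummy: the locale \<open>Metric_space\<close> asks for
  nonnegativity and symmetry of the distance on the whole type.
\<close>

definition norm_dist :: "(complex, 'a) module \<Rightarrow> ('a \<Rightarrow> real) \<Rightarrow> 'a \<Rightarrow> 'a \<Rightarrow> real"
  where "norm_dist V N x y =
    (if x \<in> carrier V \<and> y \<in> carrier V then N (x \<ominus>\<^bsub>V\<^esub> y) else 0)"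

definition norm_closure :: "(complex, 'a) module \<Rightarrow> ('a \<Rightarrow> real) \<Rightarrow> 'a set \<Rightarrow> 'a set"
  where "norm_closure V N S =
    Abstract_Topology.closure_of (Metric_space.mtopology (carrier V) (norm_dist V N)) S"

locale complex_normed_space = Module.module complex_field V
  for V :: "(complex, 'a) module" (structure) +
  fixes N :: "'a \<Rightarrow> real"
  assumes norm_nonneg: "x \<in> carrier V \<Longrightarrow> 0 \<le> N x"
    and norm_eq_zero: "x \<in> carrier V \<Longrightarrow> N x = 0 \<longleftrightarrow> x = \<zero>\<^bsub>V\<^esub>"
    and norm_triangle: "\<lbrakk>x \<in> carrier V; y \<in> carrier V\<rbrakk> \<Longrightarrow> N (x \<oplus>\<^bsub>V\<^esub> y) \<le> N x + N y"
    and norm_smult: "x \<in> carrier V \<Longrightarrow> N (c \<odot>\<^bsub>V\<^esub> x) = cmod c * N x"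

locale complex_banach_space = complex_normed_space +
  assumes complete: "Metric_space.mcomplete (carrier V) (norm_dist V N)"

definition infinite_dimensional :: "(complex, 'a) module \<Rightarrow> bool"
  where "infinite_dimensional V \<longleftrightarrow>
    (\<nexists>B. finite B \<and> B \<subseteq> carrier V \<and>
      (\<forall>x\<in>carrier V. \<exists>c :: 'a \<Rightarrow> complex. x = (\<Oplus>\<^bsub>V\<^esub>b\<in>B. c b \<odot>\<^bsub>V\<^esub> b)))"

definition bounded_operator :: "(complex, 'a) module \<Rightarrow> ('a \<Rightarrow> real) \<Rightarrow> ('a \<Rightarrow> 'a) \<Rightarrow> bool"
  where "bounded_operator V N T \<longleftrightarrow>
    T \<in> carrier V \<rightarrow> carrier V \<and>
    (\<forall>x\<in>carrier V. \<forall>y\<in>carrier V. T (x \<oplus>\<^bsub>V\<^esub> y) = T x \<oplus>\<^bsub>V\<^esub> T y) \<and>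
    (\<forall>c. \<forall>x\<in>carrier V. T (c \<odot>\<^bsub>V\<^esub> x) = c \<odot>\<^bsub>V\<^esub> T x) \<and>
    (\<exists>K. \<forall>x\<in>carrier V. N (T x) \<le> K * N x)"

definition scaled_orbit ::
    "(complex, 'a) module \<Rightarrow> complex set \<Rightarrow> 'a \<Rightarrow> ('a \<Rightarrow> 'a) \<Rightarrow> 'a set"
  where "scaled_orbit V \<Gamma> x T = {\<gamma> \<odot>\<^bsub>V\<^esub> (T ^^ n) x | \<gamma> n. \<gamma> \<in> \<Gamma>}"

definition hypercyclic_vector ::
    "(complex, 'a) module \<Rightarrow> ('a \<Rightarrow> real) \<Rightarrow> ('a \<Rightarrow> 'a) \<Rightarrow> 'a \<Rightarrow> bool"
  where "hypercyclic_vector V N T x \<longleftrightarrow>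
    norm_closure V N {(T ^^ n) x | n. True} = carrier V"

text \<open>
  The argument \<open>TYPE('a)\<close> is the universe from which the underlying sets of the Banach
  spaces are taken; it is arbitrary.
\<close>

definition hypercyclic_scalar_set :: "'a itself \<Rightarrow> complex set \<Rightarrow> bool"
  where "hypercyclic_scalar_set _ \<Gamma> \<longleftrightarrow>
    (\<forall>(V :: (complex, 'a) module) N T x.
      complex_banach_space V N \<longrightarrow> infinite_dimensional V \<longrightarrow>
      bounded_operator V N T \<longrightarrow> x \<in> carrier V \<longrightarrow>
      (norm_closure V N (scaled_orbit V \<Gamma> x T) = carrier V
        \<longleftrightarrow> hypercyclic_vector V N T x))"

definition bounded_away_from_0 :: "complex set \<Rightarrow> bool"
  where "bounded_away_from_0 A \<longleftrightarrow> (\<exists>\<delta>>0. \<forall>z\<in>A. \<delta> \<le> cmod z)"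

lemma (in complex_normed_space) smult_closed_complex:
  "x \<in> carrier V \<Longrightarrow> c \<odot>\<^bsub>V\<^esub> x \<in> carrier V"
  by (rule smult_closed) (simp add: ring_of_type_algebra_def)

lemma (in complex_normed_space) smult_add_complex:
  "x \<in> carrier V \<Longrightarrow> (a + b) \<odot>\<^bsub>V\<^esub> x = a \<odot>\<^bsub>V\<^esub> x \<oplus>\<^bsub>V\<^esub> b \<odot>\<^bsub>V\<^esub> x"
  using smult_l_distr[of a b x] by (simp only: ring_of_type_algebra_def ring.simps partial_object.simps UNIV_I)

lemma (in complex_normed_space) smult_one_complex:
  "x \<in> carrier V \<Longrightarrow> 1 \<odot>\<^bsub>V\<^esub> x = x"
  using smult_one[of x] by (simp only: ring_of_type_algebra_def monoid.simps)

lemma (in complex_normed_space) norm_zero: "N \<zero>\<^bsub>V\<^esub> = 0"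
  using norm_eq_zero[OF M.zero_closed] by blast

lemma (in complex_normed_space) smult_zero_complex:
  assumes "x \<in> carrier V"
  shows "0 \<odot>\<^bsub>V\<^esub> x = \<zero>\<^bsub>V\<^esub>"
proof -
  have "N (0 \<odot>\<^bsub>V\<^esub> x) = 0"
    using norm_smult[OF assms, of 0] by (metis Real_Vector_Spaces.norm_zero mult_zero_left)
  then show ?thesis
    using norm_eq_zero[OF smult_closed_complex[OF assms]] by blast
qed

lemma (in complex_normed_space) norm_minus_commute:
  assumes x: "x \<in> carrier V" and y: "y \<in> carrier V"
  shows "N (x \<ominus>\<^bsub>V\<^esub> y) = N (y \<ominus>\<^bsub>V\<^esub> x)"
proof -
  let ?z = "x \<ominus>\<^bsub>V\<^esub> y"
  have z: "?z \<in> carrier V"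
    by (rule M.minus_closed[OF x y])
  have "(-1) \<odot>\<^bsub>V\<^esub> ?z \<oplus>\<^bsub>V\<^esub> ?z = \<zero>\<^bsub>V\<^esub>"
    using smult_add_complex[OF z, of "-1" 1] smult_one_complex[OF z] smult_zero_complex[OF z]
    by (metis add.left_inverse)
  then have 1: "\<ominus>\<^bsub>V\<^esub> ?z = (-1) \<odot>\<^bsub>V\<^esub> ?z"
    by (rule M.minus_equality[OF _ z smult_closed_complex[OF z]])
  have "\<ominus>\<^bsub>V\<^esub> ?z = \<ominus>\<^bsub>V\<^esub> x \<oplus>\<^bsub>V\<^esub> y"
    by (metis M.minus_eq M.minus_add M.minus_minus M.a_inv_closed x y)
  also have "\<dots> = y \<ominus>\<^bsub>V\<^esub> x"
    by (metis M.minus_eq M.a_comm M.a_inv_closed x y)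
  finally have "y \<ominus>\<^bsub>V\<^esub> x = (-1) \<odot>\<^bsub>V\<^esub> ?z"
    by (rule trans[OF sym 1])
  then show ?thesis
    using norm_smult[OF z, of "-1"] by (metis norm_minus_cancel norm_one mult_1)
qed

lemma (in complex_normed_space) Metric_space_norm_dist:
  "Metric_space (carrier V) (norm_dist V N)"
proof
  fix x y
  show "0 \<le> norm_dist V N x y"
    by (simp add: norm_dist_def norm_nonneg)
  show "norm_dist V N x y = norm_dist V N y x"
    by (auto simp: norm_dist_def norm_minus_commute)
next
  fix x y assume x: "x \<in> carrier V" and y: "y \<in> carrier V"
  have "x \<ominus>\<^bsub>V\<^esub> y = \<zero>\<^bsub>V\<^esub> \<longleftrightarrow> x = y"
    by (metis M.minus_eq M.r_neg M.minus_equality M.minus_minus M.a_inv_closed x y)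
  then show "norm_dist V N x y = 0 \<longleftrightarrow> x = y"
    using x y by (simp add: norm_dist_def norm_eq_zero)
next
  fix x y z assume xyz: "x \<in> carrier V" "y \<in> carrier V" "z \<in> carrier V"
  have "x \<ominus>\<^bsub>V\<^esub> z = (x \<ominus>\<^bsub>V\<^esub> y) \<oplus>\<^bsub>V\<^esub> (y \<ominus>\<^bsub>V\<^esub> z)"
    by (metis M.minus_eq M.a_assoc M.r_neg1 M.a_inv_closed M.a_closed xyz)
  then show "norm_dist V N x z \<le> norm_dist V N x y + norm_dist V N y z"
    using xyz norm_triangle[of "x \<ominus>\<^bsub>V\<^esub> y" "y \<ominus>\<^bsub>V\<^esub> z"] by (simp add: norm_dist_def)
qed

text \<open>
  A type contains the carrier of an infinite-dimensional complex normed space only if it has at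
  least the cardinality of the complex numbers. On a smaller type
  \<open>hypercyclic_scalar_set\<close> holds vacuously.
\<close>

lemma (in complex_normed_space) infinite_dimensional_imp_inj:
  assumes "infinite_dimensional V"
  shows "\<exists>f :: complex \<Rightarrow> 'a. inj f"
proof -
  obtain v where v: "v \<in> carrier V" "v \<noteq> \<zero>\<^bsub>V\<^esub>"
  proof (rule ccontr)
    assume "\<not> thesis"
    then have "\<forall>x\<in>carrier V. x = \<zero>\<^bsub>V\<^esub>"
      using that by blast
    then have "\<not> infinite_dimensional V"
      unfolding infinite_dimensional_def by (auto intro!: exI[of _ "{}"])
    then show False
      using assms by simp
  qed
  have cl: "c \<odot>\<^bsub>V\<^esub> v \<in> carrier V" for c
    by (rule smult_closed_complex[OF v(1)])
  have "a = b" if eq: "a \<odot>\<^bsub>V\<^esub> v = b \<odot>\<^bsub>V\<^esub> v" for a b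
  proof -
    have "b \<odot>\<^bsub>V\<^esub> v \<oplus>\<^bsub>V\<^esub> (a - b) \<odot>\<^bsub>V\<^esub> v = a \<odot>\<^bsub>V\<^esub> v"
      using smult_add_complex[OF v(1), of b "a - b"] by (metis add.commute diff_add_cancel)
    then have "(a - b) \<odot>\<^bsub>V\<^esub> v = \<zero>\<^bsub>V\<^esub>"
      using eq cl by (metis M.add.l_cancel_one)
    then have "cmod (a - b) * N v = 0"
      using norm_smult[OF v(1), of "a - b"] norm_zero by metis
    then show "a = b"
      using norm_eq_zero[OF v(1)] v(2) by simp
  qed
  then show ?thesis
    by (intro exI[of _ "\<lambda>c. c \<odot>\<^bsub>V\<^esub> v"] injI)
qed

end

theory Submission
  imports Defs "HOL-Computational_Algebra.Fundamental_Theorem_Algebra"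
begin

text \<open>
  Sufficiency extends the argument of Leon-Saavedra and Mueller from the circle to an annulus.
  Everything happens in the polynomial vectors \<open>p(T)x\<close>, that is, in \<open>complex poly\<close> with the
  seminorm \<open>p \<mapsto> \<parallel>p(T)x\<parallel>\<close>, where \<open>T\<close> is multiplication by the variable. The logarithms of those
  \<open>c\<close> with \<open>c x\<close> in the closure of the orbit form a closed subgroup \<open>L\<close> of the plane. If \<open>L\<close> is the
  whole plane, then \<open>x\<close> is hypercyclic. Otherwise some nonzero real-linear \<open>\<phi>\<close> is integral on \<open>L\<close>, and
  \<open>p \<mapsto> cis (2 \<pi> \<phi> z)\<close>, for any \<open>z\<close> with \<open>exp z * p(T)x\<close> in the closure of the orbit, is a well-defined
  continuous phase of nonzero polynomials that is invariant under \<open>T\<close>. Its lifts along segments add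
  up around triangles avoiding \<open>0\<close>. Rotating \<open>p\<close> four times by \<open>\<i>\<close> gives \<open>\<phi> \<i> = 0\<close>. The lift from \<open>x\<close> to
  \<open>T\<^sup>n x\<close> is \<open>n\<close> times the lift from \<open>x\<close> to \<open>T x\<close>, so if \<open>\<gamma> T\<^sup>n x\<close> is close to \<open>r x\<close>, then
  \<open>n \<delta> + 2 \<pi> \<phi> 1 (ln r - ln \<bar>\<gamma>\<bar>)\<close> is bounded, which fails for either very large or very small \<open>r\<close>.

  Necessity uses weighted bilateral backward shifts on \<open>c\<^sub>0(\<int>)\<close> with weight \<open>\<alpha>\<close> far to the right and \<open>\<beta>\<close> far
  to the left: a hypercyclic one for \<open>\<Gamma> = {0}\<close>, a contraction for unbounded \<open>\<Gamma>\<close>, and an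
  expansion if \<open>\<Gamma>\<close> accumulates at \<open>0\<close>.
\<close>

section \<open>Closed subgroups of the plane\<close>

text \<open>Alternately adding \<open>l\<close> and elements of \<open>L\<close> keeps the partial sums bounded. Two of them
  nearly coincide, and their difference approximates \<open>0\<close> by \<open>l\<close> plus an element of \<open>L\<close>.\<close>

lemma syndetic_closed_semigroup_uminus:
  fixes L :: "'a::{real_normed_vector, heine_borel} set"
  assumes cl: "closed L" and add: "\<And>x y. x \<in> L \<Longrightarrow> y \<in> L \<Longrightarrow> x + y \<in> L"
    and synd: "\<And>w. \<exists>k\<in>L. norm (w - k) \<le> R" and l: "l \<in> L"
  shows "- l \<in> L"
proof -
  obtain k where k: "\<And>w. k w \<in> L" "\<And>w. norm (w - k w) \<le> R"
    using synd by metis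
  define p where "p = rec_nat 0 (\<lambda>_ q. q + l + k (- (q + l)))"
  have p_Suc: "p (Suc n) = p n + l + k (- (p n + l))" for n
    by (simp add: p_def)
  have bnd: "norm (p (Suc n)) \<le> R" for n
    using k(2)[of "- (p n + l)"] norm_minus_cancel[of "p (Suc n)"]
    by (simp add: p_Suc algebra_simps)
  then have "bounded (range (\<lambda>n. p (Suc n)))"
    by (auto simp: bounded_iff)
  then obtain r z where r: "strict_mono r" "((\<lambda>n. p (Suc n)) \<circ> r) \<longlonglongrightarrow> z"
    using bounded_imp_convergent_subsequence by blast
  have diff: "p j - p i - l \<in> L" if "i < j" for i j
    using that
  proof (induction j)
    case (Suc j)
    have kL: "k (- (p j + l)) \<in> L"
      using k by blast
    show ?case
    proof (cases "i = j")
      case True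
      then show ?thesis using kL by (simp add: p_Suc)
    next
      case False
      then have "p j - p i - l \<in> L" using Suc by simp
      then have "(p j - p i - l) + (l + k (- (p j + l))) \<in> L"
        using kL l add by blast
      then show ?thesis by (simp add: p_Suc algebra_simps)
    qed
  qed simp
  have "(\<lambda>n. p (Suc (r (Suc n))) - p (Suc (r n)) - l) \<longlonglongrightarrow> z - z - l"
    using r(2) LIMSEQ_Suc[OF r(2)] by (intro tendsto_intros) (auto simp: o_def)
  moreover have "p (Suc (r (Suc n))) - p (Suc (r n)) - l \<in> L" for n
    using r(1) by (intro diff) (auto simp: strict_mono_Suc_iff)
  ultimately show ?thesis
    using closed_sequentially[OF cl] by fastforce
qed

section \<open>Subgroups of the line and of the plane\<close>

lemma int_multiple_mem:
  fixes L :: "'a::real_vector set"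
  assumes "0 \<in> L" "\<And>x y. x \<in> L \<Longrightarrow> y \<in> L \<Longrightarrow> x - y \<in> L" "x \<in> L"
  shows "of_int k *\<^sub>R x \<in> L"
proof (induction k rule: int_induct[where k = 0])
  case (step1 i)
  have "0 - x \<in> L" using assms by blast
  then have "of_int i *\<^sub>R x - (0 - x) \<in> L" using step1 assms by blast
  then show ?case by (simp add: algebra_simps)
next
  case (step2 i)
  then have "of_int i *\<^sub>R x - x \<in> L" using assms by blast
  then show ?case by (simp add: algebra_simps)
qed (use assms in simp)

text \<open>The infimum \<open>d\<close> of the positive elements is attained, since two elements of
  \<open>P\<close> closer than \<open>e\<close> coincide; division with remainder by
  \<open>d\<close> then leaves remainder 0. The trivial group gets \<open>d = 1\<close>.\<close>

lemma real_subgroup_with_gap: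
  fixes P :: "real set"
  assumes P: "0 \<in> P" "\<And>x y. x \<in> P \<Longrightarrow> y \<in> P \<Longrightarrow> x - y \<in> P"
    and gap: "e > 0" "P \<inter> {0<..<e} = {}"
  shows "\<exists>d>0. \<forall>x\<in>P. x / d \<in> \<int>"
proof (cases "P \<inter> {0<..} = {}")
  case True
  have "x = 0" if "x \<in> P" for x
  proof -
    have "0 - x \<in> P" using that P by blast
    with True that have "\<not> 0 < x" "\<not> 0 < - x" by auto
    then show ?thesis by simp
  qed
  then have "\<forall>x\<in>P. x / 1 \<in> \<int>" by fastforce
  then show ?thesis using zero_less_one by blast
next
  case False
  let ?Q = "P \<inter> {0<..}"
  define d where "d = Inf ?Q"
  have e_le: "e \<le> x" if "x \<in> ?Q" for x
    using gap that by force
  then have bdd: "bdd_below ?Q"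
    by (meson bdd_below.I)
  have d_le: "d \<le> x" if "x \<in> ?Q" for x
    unfolding d_def using that bdd by (rule cInf_lower)
  have d_pos: "d > 0"
    using gap(1) cInf_greatest[OF False e_le] by (simp add: d_def)
  have "Inf ?Q < d + e" using gap(1) d_def by simp
  then obtain x where x: "x \<in> ?Q" "x < d + e"
    using cInf_lessD[OF False] by blast
  have "x = d"
  proof (rule ccontr)
    assume "x \<noteq> d"
    then have "Inf ?Q < x" using d_le x d_def by force
    then obtain y where y: "y \<in> ?Q" "y < x"
      using cInf_lessD[OF False] by blast
    then have "x - y \<in> P" "0 < x - y" "x - y < e"
      using P x d_le[OF y(1)] by auto
    then show False using gap by auto
  qed
  then have dP: "d \<in> P" using x by simp
  have "y / d \<in> \<int>" if y: "y \<in> P" for y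
  proof -
    define z where "z = y - of_int \<lfloor>y / d\<rfloor> *\<^sub>R d"
    have "z \<in> P"
      unfolding z_def using P dP y int_multiple_mem[of P d] by blast
    moreover have "0 \<le> z" "z < d"
      using d_pos floor_divide_lower[of d y] floor_divide_upper[of d y]
      by (auto simp: z_def algebra_simps)
    ultimately have "z = 0" using d_le[of z] by force
    then have "y / d = of_int \<lfloor>y / d\<rfloor>"
      using d_pos by (simp add: z_def field_simps)
    then show ?thesis by (metis Ints_of_int)
  qed
  then show ?thesis using d_pos by blast
qed

lemma floor_multiple_dist:
  fixes q t :: real
  assumes "q > 0"
  shows "\<bar>of_int \<lfloor>t / q\<rfloor> * q - t\<bar> \<le> q"
  using floor_divide_lower[OF assms, of t] floor_divide_upper[OF assms, of t]
  by (simp add: algebra_simps abs_if)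

text \<open>Without a gap above 0, the multiples of ever smaller elements are dense, and a closed
  dense group is everything.\<close>

lemma proper_closed_real_subgroup:
  fixes P :: "real set"
  assumes P: "0 \<in> P" "\<And>x y. x \<in> P \<Longrightarrow> y \<in> P \<Longrightarrow> x - y \<in> P"
    and "closed P" "P \<noteq> UNIV"
  shows "\<exists>d>0. \<forall>x\<in>P. x / d \<in> \<int>"
proof (cases "\<exists>e>0. P \<inter> {0<..<e} = {}")
  case True
  then show ?thesis using real_subgroup_with_gap[OF P] by blast
next
  case False
  have "t \<in> closure P" for t
  proof (rule closure_approachable[THEN iffD2, rule_format])
    fix e :: real assume "e > 0"
    with False obtain q where q: "q \<in> P" "0 < q" "q < e" by fastforce
    have "of_int \<lfloor>t / q\<rfloor> *\<^sub>R q \<in> P"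
      using int_multiple_mem[OF P q(1)] by blast
    moreover have "dist (of_int \<lfloor>t / q\<rfloor> *\<^sub>R q) t < e"
      using floor_multiple_dist[OF q(2), of t] q by (simp add: dist_real_def)
    ultimately show "\<exists>y\<in>P. dist y t < e" by blast
  qed
  then show ?thesis using assms by auto
qed

text \<open>The directions of ever shorter elements accumulate at some \<open>v\<close>. Suitable
  integer multiples of these elements converge to any prescribed multiple of
  \<open>v\<close>.\<close>

lemma nondiscrete_closed_subgroup_contains_line:
  fixes L :: "'a::{real_normed_vector, heine_borel} set"
  assumes L: "0 \<in> L" "\<And>x y. x \<in> L \<Longrightarrow> y \<in> L \<Longrightarrow> x - y \<in> L"
    and cl: "closed L" and small: "\<And>e::real. e > 0 \<Longrightarrow> \<exists>l\<in>L. 0 < norm l \<and> norm l < e"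
  shows "\<exists>v. norm v = 1 \<and> (\<forall>t. t *\<^sub>R v \<in> L)"
proof -
  have "\<forall>n. \<exists>l\<in>L. 0 < norm l \<and> norm l < inverse (real (Suc n))"
    using small by simp
  then obtain l where l: "\<And>n. l n \<in> L" "\<And>n. 0 < norm (l n)"
      "\<And>n. norm (l n) < inverse (real (Suc n))"
    by metis
  have l0: "(\<lambda>n. norm (l n)) \<longlonglongrightarrow> 0"
    by (rule tendsto_sandwich[OF _ _ tendsto_const LIMSEQ_inverse_real_of_nat])
       (auto intro!: always_eventually less_imp_le l simp del: of_nat_Suc)
  have "bounded (range (\<lambda>n. sgn (l n)))"
    unfolding bounded_iff by (intro exI[of _ 1]) (auto simp: norm_sgn)
  then obtain r v where r: "strict_mono r" "((\<lambda>n. sgn (l n)) \<circ> r) \<longlonglongrightarrow> v"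
    using bounded_imp_convergent_subsequence by blast
  have "(\<lambda>n. norm (sgn (l (r n)))) \<longlonglongrightarrow> norm v"
    using r(2) by (intro tendsto_norm) (simp add: o_def)
  moreover have "norm (sgn (l (r n))) = 1" for n
    using l(2)[of "r n"] by (simp add: norm_sgn)
  ultimately have "norm v = 1"
    by (simp add: LIMSEQ_const_iff)
  moreover have "t *\<^sub>R v \<in> L" for t
  proof -
    \<comment> \<open>\<open>c n\<close> is \<open>t\<close> rounded down to a multiple of the
      length of \<open>l (r n)\<close>, so its error is at most that length, which tends to
      0.\<close>
    define c where "c n = of_int \<lfloor>t / norm (l (r n))\<rfloor> * norm (l (r n))" for n
    have "(\<lambda>n. c n - t) \<longlonglongrightarrow> 0"
    proof (rule Lim_null_comparison)
      show "(\<lambda>n. norm (l (r n))) \<longlonglongrightarrow> 0"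
        using LIMSEQ_subseq_LIMSEQ[OF l0 r(1)] by (simp add: o_def)
      show "\<forall>\<^sub>F n in sequentially. norm (c n - t) \<le> norm (l (r n))"
        using floor_multiple_dist[OF l(2)] by (intro always_eventually) (simp add: c_def)
    qed
    then have "c \<longlonglongrightarrow> t" by (simp add: LIM_zero_iff)
    then have "(\<lambda>n. c n *\<^sub>R sgn (l (r n))) \<longlonglongrightarrow> t *\<^sub>R v"
      using r(2) by (intro tendsto_intros) (auto simp: o_def)
    moreover have "c n *\<^sub>R sgn (l (r n)) = of_int \<lfloor>t / norm (l (r n))\<rfloor> *\<^sub>R l (r n)" for n
      using l(2)[of "r n"] by (simp add: c_def sgn_div_norm)
    then have "c n *\<^sub>R sgn (l (r n)) \<in> L" for n
      using int_multiple_mem[OF L l(1)] by simp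
    ultimately show ?thesis
      using closed_sequentially[OF cl, of "\<lambda>n. c n *\<^sub>R sgn (l (r n))"] by blast
  qed
  ultimately show ?thesis by blast
qed

text \<open>If \<open>L\<close> has arbitrarily short nonzero elements, it contains a line, and a
  multiple of the coordinate transverse to this line works. Otherwise the period
  \<open>\<i> * of_real s\<close> makes the real parts of \<open>L\<close> discrete, and a multiple
  of \<open>Re\<close> works.\<close>

lemma complex_subgroup_functional:
  fixes L :: "complex set"
  assumes L: "0 \<in> L" "\<And>x y. x \<in> L \<Longrightarrow> y \<in> L \<Longrightarrow> x - y \<in> L"
    and cl: "closed L" and proper: "L \<noteq> UNIV"
    and s: "\<i> * of_real s \<in> L" "s > 0"
  shows "\<exists>\<phi> :: complex \<Rightarrow> real. bounded_linear \<phi> \<and> (\<exists>z. \<phi> z \<noteq> 0) \<and> (\<forall>z\<in>L. \<phi> z \<in> \<int>)"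
proof (cases "\<forall>e>0. \<exists>l\<in>L. 0 < norm l \<and> norm l < e")
  case True
  then obtain v where v: "norm v = 1" "\<And>t. t *\<^sub>R v \<in> L"
    using nondiscrete_closed_subgroup_contains_line[OF L cl] by metis
  \<comment> \<open>In the orthonormal real basis \<open>v\<close>, \<open>\<i> * v\<close> this is
    the second coordinate, and \<open>Q\<close> is the trace of \<open>L\<close> on the second
    axis.\<close>
  define \<psi> where "\<psi> z = Im (z * cnj v)" for z
  define Q where "Q = {t. t *\<^sub>R (\<i> * v) \<in> L}"
  have vv: "cnj v * v = 1"
    using v(1) by (metis complex_norm_square mult.commute of_real_1 power_one)
  have dec: "z = Re (z * cnj v) *\<^sub>R v + \<psi> z *\<^sub>R (\<i> * v)" for z
  proof -
    have "z = z * cnj v * v" using vv by (simp add: mult.assoc)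
    also have "\<dots> = (of_real (Re (z * cnj v)) + \<i> * of_real (\<psi> z)) * v"
      unfolding \<psi>_def by (metis complex_eq)
    finally show ?thesis by (simp add: algebra_simps scaleR_conv_of_real)
  qed
  \<comment> \<open>\<open>L\<close> absorbs the multiples of \<open>v\<close>, so only the second
    coordinate decides membership.\<close>
  have mem: "z \<in> L \<longleftrightarrow> \<psi> z \<in> Q" for z
  proof -
    let ?a = "Re (z * cnj v) *\<^sub>R v" and ?b = "\<psi> z *\<^sub>R (\<i> * v)"
    have a: "?a \<in> L" "0 - ?a \<in> L" using v L by blast+
    have "?b = z - ?a" "z = ?b - (0 - ?a)" using dec[of z] by (simp_all add: algebra_simps)
    then show ?thesis using a L unfolding Q_def by (metis mem_Collect_eq)
  qed
  have "Q \<noteq> UNIV" using proper mem by blast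
  moreover have "closed Q"
    unfolding Q_def using continuous_closed_vimage[OF cl, of "\<lambda>t. t *\<^sub>R (\<i> * v)"]
    by (simp add: vimage_def)
  moreover have "0 \<in> Q" using L by (simp add: Q_def)
  moreover have "x - y \<in> Q" if "x \<in> Q" "y \<in> Q" for x y
    using that L unfolding Q_def by (metis mem_Collect_eq scaleR_diff_left)
  ultimately obtain d where d: "d > 0" "\<forall>x\<in>Q. x / d \<in> \<int>"
    using proper_closed_real_subgroup[of Q] by blast
  have "bounded_linear (\<lambda>z. Im (z * cnj v) / d)"
    by (intro bounded_linear_compose[OF bounded_linear_divide]
        bounded_linear_compose[OF bounded_linear_Im] bounded_linear_mult_left)
  moreover have "\<i> * v * cnj v = \<i>"
    using vv by (simp add: mult.assoc mult.commute)
  then have "Im (\<i> * v * cnj v) / d \<noteq> 0"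
    using d by (metis divide_eq_0_iff imaginary_unit.sel(2) less_irrefl zero_neq_one)
  ultimately show ?thesis
    using d mem unfolding \<psi>_def by (intro exI[of _ "\<lambda>z. Im (z * cnj v) / d"]) blast
next
  case False
  then obtain e where e: "e > 0" "\<And>l. l \<in> L \<Longrightarrow> norm l < e \<Longrightarrow> l = 0"
    by (metis zero_less_norm_iff)
  \<comment> \<open>Otherwise elements of \<open>L\<close> with positive real parts tending to 0 and
    imaginary parts reduced modulo \<open>s\<close> accumulate at some \<open>z\<close> in
    \<open>L\<close> with \<open>Re z = 0\<close>. By discreteness one of them equals
    \<open>z\<close>, against its positive real part.\<close>
  have "\<exists>e'>0. Re ` L \<inter> {0<..<e'} = {}"
  proof (rule ccontr)
    assume neg: "\<not> ?thesis"
    have "\<exists>l\<in>L. 0 < Re l \<and> Re l < inverse (real (Suc n)) \<and> \<bar>Im l\<bar> \<le> s" for n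
    proof -
      have "0 < inverse (real (Suc n))" by simp
      with neg have "Re ` L \<inter> {0<..<inverse (real (Suc n))} \<noteq> {}" by blast
      then obtain l where l: "l \<in> L" "0 < Re l" "Re l < inverse (real (Suc n))"
        by (auto simp del: of_nat_Suc)
      define m where "m = l - of_int \<lfloor>Im l / s\<rfloor> *\<^sub>R (\<i> * of_real s)"
      have "m \<in> L"
        unfolding m_def using L l int_multiple_mem[OF L s(1)] by blast
      moreover have "Re m = Re l" by (simp add: m_def)
      moreover have "\<bar>Im m\<bar> \<le> s"
        using floor_multiple_dist[OF s(2), of "Im l"] by (simp add: m_def abs_minus_commute)
      ultimately show ?thesis using l by metis
    qed
    then obtain l where l: "\<And>n. l n \<in> L" "\<And>n. 0 < Re (l n)"
        "\<And>n. Re (l n) < inverse (real (Suc n))" "\<And>n. \<bar>Im (l n)\<bar> \<le> s"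
      by metis
    have Re0: "(\<lambda>n. Re (l n)) \<longlonglongrightarrow> 0"
      by (rule tendsto_sandwich[OF _ _ tendsto_const LIMSEQ_inverse_real_of_nat])
         (auto intro!: always_eventually less_imp_le l simp del: of_nat_Suc)
    have "norm (l n) \<le> 1 + s" for n
    proof -
      have "inverse (real (Suc n)) \<le> 1" by (simp add: field_simps)
      then have "\<bar>Re (l n)\<bar> \<le> 1" using l(2,3)[of n] by linarith
      then show ?thesis using cmod_le[of "l n"] l(4)[of n] by linarith
    qed
    then have "bounded (range l)" by (auto simp: bounded_iff)
    then obtain r z where r: "strict_mono r" "(l \<circ> r) \<longlonglongrightarrow> z"
      using bounded_imp_convergent_subsequence by blast
    have zL: "z \<in> L"
      using closed_sequentially[OF cl, of "l \<circ> r" z] r l by auto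
    have "(\<lambda>n. Re (l (r n))) \<longlonglongrightarrow> Re z"
      using tendsto_Re[OF r(2)] by (simp add: o_def)
    moreover have "(\<lambda>n. Re (l (r n))) \<longlonglongrightarrow> 0"
      using LIMSEQ_subseq_LIMSEQ[OF Re0 r(1)] by (simp add: o_def)
    ultimately have Rez: "Re z = 0" using LIMSEQ_unique by blast
    have "\<forall>\<^sub>F n in sequentially. dist ((l \<circ> r) n) z < e"
      using r(2) e(1) by (rule tendstoD)
    then obtain n where "norm (l (r n) - z) < e"
      by (auto simp: eventually_sequentially dist_norm)
    then have "l (r n) - z = 0" using e(2) L l zL by blast
    then show False using Rez l(2)[of "r n"] by simp
  qed
  then obtain e' where e': "e' > 0" "Re ` L \<inter> {0<..<e'} = {}" by blast
  moreover have "0 \<in> Re ` L" using L(1) by (metis imageI zero_complex.sel(1))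
  moreover have "x - y \<in> Re ` L" if "x \<in> Re ` L" "y \<in> Re ` L" for x y
    using that L by (auto simp: image_iff) (metis minus_complex.sel(1))
  ultimately obtain d where d: "d > 0" "\<forall>x\<in>Re ` L. x / d \<in> \<int>"
    using real_subgroup_with_gap[of "Re ` L"] by blast
  have "bounded_linear (\<lambda>z. Re z / d)"
    by (rule bounded_linear_compose[OF bounded_linear_divide bounded_linear_Re])
  moreover have "Re 1 / d \<noteq> 0" using d by simp
  ultimately show ?thesis using d by blast
qed

section \<open>Orbits of scalar multiples in a seminormed space of polynomials\<close>

hide_const (open) Module.smult up_ring.monom up_ring.coeff Polynomials.degree

text \<open>The polynomial \<open>1\<close> stands for \<open>x\<close>, \<open>pCons 0\<close> for
  \<open>T\<close> and \<open>monom \<gamma> n\<close> for \<open>\<gamma> T^n x\<close>;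
  \<open>approx\<close> is density of the scaled orbit among the polynomial vectors.
  \<open>nu\<close> is only a seminorm because \<open>p(T) x\<close> may vanish for nonzero
  \<open>p\<close>.\<close>

locale scaled_orbit_seminorm =
  fixes nu :: "complex poly \<Rightarrow> real" and K a b :: real and \<Gamma> :: "complex set"
  assumes triangle: "nu (p + q) \<le> nu p + nu q"
    and hom: "nu (smult c p) = cmod c * nu p"
    and shift: "nu (pCons 0 p) \<le> K * nu p"
    and a_pos: "0 < a"
    and annulus: "\<And>\<gamma>. \<gamma> \<in> \<Gamma> - {0} \<Longrightarrow> a \<le> cmod \<gamma> \<and> cmod \<gamma> \<le> b"
    and nontrivial: "\<Gamma> - {0} \<noteq> {}"
    and approx: "0 < e \<Longrightarrow> \<exists>\<gamma>\<in>\<Gamma>. \<exists>n. nu (p - monom \<gamma> n) < e"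
begin

section \<open>Seminorm estimates and density of polynomial multiples\<close>

lemma b_pos: "0 < b"
  using nontrivial annulus a_pos by (metis all_not_in_conv less_le_trans)

lemma nu_0 [simp]: "nu 0 = 0"
  using hom[of 0 0] by simp

lemma nu_minus [simp]: "nu (- p) = nu p"
  using hom[of "-1" p] by simp

lemma nu_nonneg [simp]: "0 \<le> nu p"
  using triangle[of p "- p"] by simp

lemma nu_diff_commute: "nu (p - q) = nu (q - p)"
  using nu_minus[of "p - q"] by simp

lemma nu_diff_triangle: "nu (p - r) \<le> nu (p - q) + nu (q - r)"
  using triangle[of "p - q" "q - r"] by simp

lemma nu_diff_le: "nu (p - q) \<le> nu p + nu q"
  using triangle[of p "- q"] by simp

lemma nu_le_diff: "nu p \<le> nu (p - q) + nu q"
  using triangle[of "p - q" q] by simp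

text \<open>Horner's scheme: multiplication by \<open>q\<close> is composed of scalar
  multiplications and the bounded shift.\<close>

lemma nu_mult_bounded: "\<exists>C>0. \<forall>p. nu (q * p) \<le> C * nu p"
proof (induction q)
  case 0
  show ?case by (intro exI[of _ 1]) simp
next
  case (pCons c q)
  then obtain C where C: "C > 0" "\<And>p. nu (q * p) \<le> C * nu p" by blast
  have "nu (pCons c q * p) \<le> (cmod c + \<bar>K\<bar> * C + 1) * nu p" for p
  proof -
    have "nu (pCons c q * p) \<le> nu (smult c p) + nu (pCons 0 (q * p))"
      using triangle by (simp add: mult_pCons_left)
    also have "\<dots> \<le> cmod c * nu p + \<bar>K\<bar> * nu (q * p)"
      using shift[of "q * p"] mult_right_mono[OF abs_ge_self[of K] nu_nonneg[of "q * p"]]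
      by (simp add: hom)
    also have "\<dots> \<le> cmod c * nu p + \<bar>K\<bar> * (C * nu p)"
      using mult_left_mono[OF C(2)[of p], of "\<bar>K\<bar>"] by simp
    also have "\<dots> \<le> (cmod c + \<bar>K\<bar> * C + 1) * nu p"
      by (simp add: algebra_simps)
    finally show ?thesis .
  qed
  moreover have "cmod c + \<bar>K\<bar> * C + 1 > 0" using C(1)
    by (intro add_nonneg_pos add_nonneg_nonneg) auto
  ultimately show ?case by blast
qed

text \<open>The scalar 0 cannot approximate a vector better than its own seminorm, so vectors of
  positive seminorm force a nonzero scalar. A vector of seminorm 0 is first moved slightly. If
  \<open>nu\<close> vanishes identically, any scalar will do.\<close>

lemma approx_nonzero:
  assumes "0 < e"
  shows "\<exists>\<gamma>\<in>\<Gamma> - {0}. \<exists>n. nu (p - monom \<gamma> n) < e"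
proof -
  have main: "\<exists>\<gamma>\<in>\<Gamma> - {0}. \<exists>n. nu (q - monom \<gamma> n) < e" if q: "nu q > 0" and e: "0 < e" for q e
  proof -
    obtain \<gamma> n where \<gamma>: "\<gamma> \<in> \<Gamma>" "nu (q - monom \<gamma> n) < min e (nu q)"
      using approx[of "min e (nu q)" q] q e by auto
    then have "\<gamma> \<noteq> 0" by auto
    with \<gamma> show ?thesis by auto
  qed
  show ?thesis
  proof (cases "\<exists>q. nu q > 0")
    case False
    then have "nu q < e" for q using assms by (meson not_le le_less_trans)
    then show ?thesis using nontrivial by blast
  next
    case True
    then obtain q where q: "nu q > 0" by blast
    show ?thesis
    proof (cases "nu p = 0")
      case True
      \<comment> \<open>A vector of seminorm exactly \<open>e / 2\<close> that is approximated in
        place of \<open>p\<close>.\<close>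
      define r where "r = smult (of_real (e / 2 / nu q)) q"
      have r: "nu r = e / 2"
        using q assms by (simp add: r_def hom norm_divide)
      obtain \<gamma> n where \<gamma>: "\<gamma> \<in> \<Gamma> - {0}" "nu (r - monom \<gamma> n) < e / 2"
        using main[of r "e / 2"] r assms by auto
      have "nu (p - monom \<gamma> n) \<le> nu p + nu (monom \<gamma> n)" by (rule nu_diff_le)
      then have "nu (p - monom \<gamma> n) < e"
        using True nu_diff_triangle[of p "monom \<gamma> n" r] nu_diff_le[of p r] r \<gamma>(2) by simp
      then show ?thesis using \<gamma> by blast
    next
      case False
      then show ?thesis using main[of p e] assms nu_nonneg[of p] by auto
    qed
  qed
qed

text \<open>If \<open>z - \<mu>\<close> did not have dense range, then evaluation at \<open>\<mu>\<close> would be continuous and the set of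
  all \<open>\<gamma> * \<mu>^n\<close> would be dense in the plane. It is bounded or bounded away from 0.\<close>

lemma linear_factor_dense_range:
  assumes "0 < e"
  shows "\<exists>s. nu (1 - [:- \<mu>, 1:] * s) < e"
proof (rule ccontr)
  assume "\<not> ?thesis"
  then have far: "e \<le> nu (1 - [:- \<mu>, 1:] * s)" for s
    by (meson not_le)
  \<comment> \<open>Division by the value at \<open>\<mu>\<close> turns \<open>p\<close> into 1
    minus a multiple of the linear factor, and this has seminorm at least \<open>e\<close>.\<close>
  have eval: "cmod (poly p \<mu>) * e \<le> nu p" for p
  proof (cases "poly p \<mu> = 0")
    case False
    define c where "c = poly p \<mu>"
    have "poly (1 - smult (1 / c) p) \<mu> = 0"
      using False by (simp add: c_def)
    then obtain s where "1 - smult (1 / c) p = [:- \<mu>, 1:] * s"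
      using poly_eq_0_iff_dvd dvd_def by blast
    then have "smult (1 / c) p = 1 - [:- \<mu>, 1:] * s" by (simp add: algebra_simps)
    then have "e \<le> nu (smult (1 / c) p)" using far by metis
    then show ?thesis using False by (simp add: hom c_def norm_divide field_simps)
  qed simp
  \<comment> \<open>Continuity of the evaluation carries the approximation of constants by scaled
    monomials over to the plane.\<close>
  have near: "\<exists>\<gamma>\<in>\<Gamma> - {0}. \<exists>n. cmod (c - \<gamma> * \<mu> ^ n) < d" if d: "0 < d" for c d
  proof -
    obtain \<gamma> n where \<gamma>: "\<gamma> \<in> \<Gamma> - {0}" "nu ([:c:] - monom \<gamma> n) < d * e"
      using approx_nonzero[of "d * e"] mult_pos_pos[OF d assms] by blast
    have "cmod (poly ([:c:] - monom \<gamma> n) \<mu>) * e < d * e"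
      using eval[of "[:c:] - monom \<gamma> n"] \<gamma>(2) by linarith
    then show ?thesis using \<gamma>(1) assms by (auto simp: poly_monom)
  qed
  show False
  proof (cases "cmod \<mu> \<le> 1")
    case True
    obtain \<gamma> n where \<gamma>: "\<gamma> \<in> \<Gamma> - {0}" "cmod (of_real (b + 1) - \<gamma> * \<mu> ^ n) < 1"
      using near[of 1 "of_real (b + 1)"] zero_less_one by blast
    have "cmod (\<gamma> * \<mu> ^ n) \<le> b * 1"
      unfolding norm_mult norm_power
      using annulus[OF \<gamma>(1)] True b_pos by (intro mult_mono power_le_one) auto
    moreover have "cmod (of_real (b + 1)) \<le> cmod (of_real (b + 1) - \<gamma> * \<mu> ^ n) + cmod (\<gamma> * \<mu> ^ n)"
      using norm_triangle_ineq[of "of_real (b + 1) - \<gamma> * \<mu> ^ n" "\<gamma> * \<mu> ^ n"] by simp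
    moreover have "cmod (of_real (b + 1)) = b + 1"
      using b_pos by (simp del: of_real_add)
    ultimately show False using \<gamma>(2) by linarith
  next
    case False
    obtain \<gamma> n where \<gamma>: "\<gamma> \<in> \<Gamma> - {0}" "cmod (0 - \<gamma> * \<mu> ^ n) < a"
      using near[of a 0] a_pos by blast
    have "a * 1 \<le> cmod (\<gamma> * \<mu> ^ n)"
      unfolding norm_mult norm_power
      using annulus[OF \<gamma>(1)] False a_pos by (intro mult_mono one_le_power) auto
    then show False using \<gamma>(2) by simp
  qed
qed

text \<open>Induction on the degree: the fundamental theorem of algebra splits off a linear factor,
  and bounded operators of dense range compose. Approximating \<open>1\<close> suffices because it
  is cyclic.\<close>

lemma dense_range:
  assumes "p \<noteq> 0" "0 < e"
  shows "\<exists>s. nu (1 - p * s) < e"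
  using assms
proof (induction "degree p" arbitrary: p e)
  case 0
  then obtain c where "p = [:c:]" "c \<noteq> 0"
    by (metis degree_0_id pCons_0_0 pCons_eq_0_iff)
  then have "1 - p * [:1 / c:] = 0" by (simp add: one_pCons)
  then show ?case using 0 by (metis nu_0)
next
  case (Suc n)
  then obtain \<mu> where "poly p \<mu> = 0"
    using fundamental_theorem_of_algebra[of p] by (metis constant_degree nat.distinct(1))
  then obtain q where q: "p = [:- \<mu>, 1:] * q"
    using poly_eq_0_iff_dvd dvd_def by blast
  with Suc.prems have "q \<noteq> 0" by auto
  then have "degree p = Suc (degree q)" unfolding q
    by (subst degree_mult_eq) auto
  then obtain s where s: "nu (1 - q * s) < e / 2"
    using Suc.hyps Suc.prems(2) \<open>q \<noteq> 0\<close> by (metis half_gt_zero nat.inject)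
  obtain C where C: "C > 0" "\<And>p. nu (q * s * p) \<le> C * nu p"
    using nu_mult_bounded by blast
  \<comment> \<open>This error gets multiplied by \<open>q * s\<close>, hence the division by
    \<open>C\<close>.\<close>
  obtain t where t: "nu (1 - [:- \<mu>, 1:] * t) < e / 2 / C"
    using linear_factor_dense_range[of "e / 2 / C" \<mu>] C Suc.prems(2) by auto
  have "nu (1 - p * (s * t)) \<le> nu (1 - q * s) + nu (q * s - p * (s * t))"
    by (rule nu_diff_triangle)
  also have "q * s - p * (s * t) = q * s * (1 - [:- \<mu>, 1:] * t)"
    by (simp add: q right_diff_distrib mult_ac del: mult_pCons_left mult_pCons_right)
  also have "nu \<dots> \<le> C * nu (1 - [:- \<mu>, 1:] * t)" by (rule C(2))
  also have "\<dots> < e / 2" using t C(1) by (simp add: field_simps)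
  finally have "nu (1 - p * (s * t)) < e" using s by simp
  then show ?case by blast
qed

section \<open>The closure of the orbit and compactness of the annulus\<close>

definition orbit_closure :: "complex poly set"
  where "orbit_closure = {p. \<forall>e>0. \<exists>n. nu (p - monom 1 n) < e}"

lemma orbit_closure_closed:
  assumes "\<And>e. 0 < e \<Longrightarrow> \<exists>q\<in>orbit_closure. nu (p - q) < e"
  shows "p \<in> orbit_closure"
  unfolding orbit_closure_def
proof (intro CollectI allI impI)
  fix e :: real assume "e > 0"
  then obtain q where q: "q \<in> orbit_closure" "nu (p - q) < e / 2"
    using assms half_gt_zero by blast
  then obtain n where n: "nu (q - monom 1 n) < e / 2"
    using \<open>e > 0\<close> half_gt_zero unfolding orbit_closure_def by blast
  show "\<exists>n. nu (p - monom 1 n) < e"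
    using nu_diff_triangle[of p "monom 1 n" q] q n by (intro exI[of _ n]) simp
qed

lemma orbit_closure_limit:
  assumes "\<And>n. q n \<in> orbit_closure" "(\<lambda>n. nu (p - q n)) \<longlonglongrightarrow> 0"
  shows "p \<in> orbit_closure"
proof (rule orbit_closure_closed)
  fix e :: real assume "e > 0"
  then have "\<forall>\<^sub>F n in sequentially. nu (p - q n) < e"
    using assms(2) by (rule order_tendstoD(2)[rotated])
  then show "\<exists>q\<in>orbit_closure. nu (p - q) < e"
    using assms(1) by (meson eventually_sequentially le_refl)
qed

lemma orbit_closure_mult_monom:
  assumes "p \<in> orbit_closure"
  shows "monom 1 k * p \<in> orbit_closure"
  unfolding orbit_closure_def
proof (intro CollectI allI impI)
  fix e :: real assume e: "e > 0"
  obtain C where C: "C > 0" "\<And>p. nu (monom 1 k * p) \<le> C * nu p"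
    using nu_mult_bounded by blast
  obtain n where n: "nu (p - monom 1 n) < e / C"
    using assms divide_pos_pos[OF e C(1)] unfolding orbit_closure_def by blast
  have "monom 1 k * p - monom 1 (k + n) = monom 1 k * (p - monom 1 n)"
    by (simp add: algebra_simps mult_monom)
  then have "nu (monom 1 k * p - monom 1 (k + n)) \<le> C * nu (p - monom 1 n)"
    using C(2) by metis
  also have "\<dots> < e" using n C(1) by (simp add: field_simps)
  finally show "\<exists>n. nu (monom 1 k * p - monom 1 n) < e" by blast
qed

text \<open>Shifting \<open>[:s:]\<close> by \<open>n\<close> gives
  \<open>smult s (monom 1 n)\<close>, which is therefore in the closure; such vectors approximate
  \<open>smult s q\<close>.\<close>

lemma orbit_closure_smult:
  assumes "[:s:] \<in> orbit_closure" "q \<in> orbit_closure"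
  shows "smult s q \<in> orbit_closure"
proof (rule orbit_closure_closed)
  fix e :: real assume e: "e > 0"
  then have "0 < e / (cmod s + 1)"
    by (intro divide_pos_pos add_nonneg_pos) auto
  then obtain n where n: "nu (q - monom 1 n) < e / (cmod s + 1)"
    using assms(2) unfolding orbit_closure_def by blast
  have "nu (smult s q - smult s (monom 1 n)) = cmod s * nu (q - monom 1 n)"
    by (simp add: hom flip: smult_diff_right)
  also have "\<dots> \<le> (cmod s + 1) * nu (q - monom 1 n)"
    by (intro mult_right_mono) auto
  also have "\<dots> < e"
    using n by (subst mult.commute, subst (asm) pos_less_divide_eq) (auto intro: add_nonneg_pos)
  finally have "nu (smult s q - smult s (monom 1 n)) < e" .
  moreover have "smult s (monom 1 n) \<in> orbit_closure"
    using orbit_closure_mult_monom[OF assms(1), of n] by (simp add: mult.commute)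
  ultimately show "\<exists>q'\<in>orbit_closure. nu (smult s q - q') < e" by blast
qed

text \<open>The scalars have a subsequence converging to some \<open>\<gamma>\<close> in the closed
  annulus. The family \<open>f\<close> is left general because the orbits of \<open>1\<close> and of
  any \<open>p\<close> are both needed.\<close>

lemma annulus_limit:
  assumes "\<And>e. 0 < e \<Longrightarrow> \<exists>\<gamma>\<in>\<Gamma> - {0}. \<exists>n. nu (q - smult \<gamma> (f n)) < e"
  obtains \<gamma> where "a \<le> cmod \<gamma>" "cmod \<gamma> \<le> b"
    "\<And>e. 0 < e \<Longrightarrow> \<exists>n :: nat. nu (smult (1 / \<gamma>) q - f n) < e"
proof -
  have "\<forall>k. \<exists>\<gamma>\<in>\<Gamma> - {0}. \<exists>n. nu (q - smult \<gamma> (f n)) < inverse (real (Suc k))"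
    by (intro allI assms) simp
  then obtain g m where g: "\<And>k. g k \<in> \<Gamma> - {0}"
      "\<And>k. nu (q - smult (g k) (f (m k))) < inverse (real (Suc k))"
    by metis
  have "bounded (range g)" "range g \<subseteq> {z. a \<le> cmod z \<and> cmod z \<le> b}"
    using annulus[OF g(1)] by (auto simp: bounded_iff)
  then obtain r \<gamma> where r: "strict_mono r" "(g \<circ> r) \<longlonglongrightarrow> \<gamma>"
    using bounded_imp_convergent_subsequence by blast
  have lim: "(\<lambda>k. cmod (g (r k))) \<longlonglongrightarrow> cmod \<gamma>"
    using tendsto_norm[OF r(2)] by (simp add: o_def)
  have \<gamma>: "a \<le> cmod \<gamma>" "cmod \<gamma> \<le> b"
    using LIMSEQ_le_const[OF lim] LIMSEQ_le_const2[OF lim] annulus[OF g(1)] by blast+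
  \<comment> \<open>Replacing \<open>g k\<close> by \<open>\<gamma>\<close> costs their distance
    times \<open>nu (f (m k))\<close>, which is bounded because the scalars have modulus at least
    \<open>a\<close>.\<close>
  have bound: "nu (q - smult \<gamma> (f (m k))) \<le> inverse (real (Suc k)) + cmod (\<gamma> - g k) * ((nu q + 1) / a)" for k
  proof -
    have "inverse (real (Suc k)) \<le> 1" by (simp add: field_simps)
    then have "nu (smult (g k) (f (m k))) \<le> nu q + 1"
      using nu_le_diff[of "smult (g k) (f (m k))" q] nu_diff_commute g(2)[of k] by (smt (verit))
    moreover have "a * nu (f (m k)) \<le> cmod (g k) * nu (f (m k))"
      using annulus[OF g(1)] by (intro mult_right_mono) auto
    ultimately have "nu (f (m k)) \<le> (nu q + 1) / a"
      using a_pos by (simp add: hom field_simps)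
    then have "nu (smult (\<gamma> - g k) (f (m k))) \<le> cmod (\<gamma> - g k) * ((nu q + 1) / a)"
      unfolding hom by (rule mult_left_mono) simp
    moreover have "q - smult \<gamma> (f (m k)) = (q - smult (g k) (f (m k))) - smult (\<gamma> - g k) (f (m k))"
      by (simp add: smult_diff_left)
    ultimately show ?thesis using nu_diff_le g(2)[of k] by (smt (verit))
  qed
  have "(\<lambda>k. inverse (real (Suc (r k))) + cmod (\<gamma> - g (r k)) * ((nu q + 1) / a))
          \<longlonglongrightarrow> 0 + cmod (\<gamma> - \<gamma>) * ((nu q + 1) / a)"
    using LIMSEQ_subseq_LIMSEQ[OF LIMSEQ_inverse_real_of_nat r(1)] r(2)
    by (intro tendsto_intros) (auto simp: o_def)
  then have lim0: "(\<lambda>k. inverse (real (Suc (r k))) + cmod (\<gamma> - g (r k)) * ((nu q + 1) / a)) \<longlonglongrightarrow> 0"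
    by simp
  have "\<exists>n. nu (smult (1 / \<gamma>) q - f n) < e" if "e > 0" for e
  proof -
    have "e * cmod \<gamma> > 0" using that \<gamma>(1) a_pos by (intro mult_pos_pos) linarith+
    from order_tendstoD(2)[OF lim0 this] obtain k where
      "inverse (real (Suc (r k))) + cmod (\<gamma> - g (r k)) * ((nu q + 1) / a) < e * cmod \<gamma>"
      by (meson eventually_sequentially le_refl)
    with bound[of "r k"] have *: "nu (q - smult \<gamma> (f (m (r k)))) < e * cmod \<gamma>" by linarith
    have "\<gamma> \<noteq> 0" using \<gamma>(1) a_pos by auto
    then have "smult (1 / \<gamma>) q - f (m (r k)) = smult (1 / \<gamma>) (q - smult \<gamma> (f (m (r k))))"
      by (simp add: smult_diff_right)
    with * \<open>\<gamma> \<noteq> 0\<close> show ?thesis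
      by (intro exI[of _ "m (r k)"]) (simp add: hom norm_divide field_simps)
  qed
  with \<gamma> that show thesis by blast
qed

text \<open>Logarithms make the nonzero scalars additive. The resulting set is invariant under
  translation by \<open>2 pi \<i>\<close>.\<close>

definition log_scalars :: "complex poly \<Rightarrow> complex set"
  where "log_scalars p = {z. smult (exp z) p \<in> orbit_closure}"

text \<open>The annulus yields a scalar \<open>1 / \<gamma>\<close> with modulus between
  \<open>1 / b\<close> and \<open>1 / a\<close>, and its principal logarithm is bounded
  independently of \<open>p\<close>. This uniformity makes \<open>log_return\<close> syndetic and
  the phase continuous.\<close>

lemma log_scalars_bounded:
  obtains R where "\<And>p. \<exists>z\<in>log_scalars p. cmod z \<le> R"
proof
  fix p
  obtain \<gamma> where \<gamma>: "a \<le> cmod \<gamma>" "cmod \<gamma> \<le> b"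
    "\<And>e. 0 < e \<Longrightarrow> \<exists>n. nu (smult (1 / \<gamma>) p - monom 1 n) < e"
  proof (rule annulus_limit[of p "monom 1"])
    show "\<exists>\<gamma>\<in>\<Gamma> - {0}. \<exists>n. nu (p - smult \<gamma> (monom 1 n)) < e" if "0 < e" for e
      using approx_nonzero[OF that] by (simp add: smult_monom)
  qed (rule that)
  have nz: "\<gamma> \<noteq> 0" using \<gamma>(1) a_pos by auto
  then have "- Ln \<gamma> \<in> log_scalars p"
    using \<gamma>(3) by (simp add: log_scalars_def orbit_closure_def exp_minus inverse_eq_divide)
  moreover have "cmod (- Ln \<gamma>) \<le> (\<bar>ln a\<bar> + \<bar>ln b\<bar>) + pi"
  proof -
    have "ln a \<le> ln (cmod \<gamma>)" "ln (cmod \<gamma>) \<le> ln b"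
      using \<gamma>(1,2) a_pos b_pos nz by auto
    then have "\<bar>Re (Ln \<gamma>)\<bar> \<le> \<bar>ln a\<bar> + \<bar>ln b\<bar>" using nz by simp
    moreover have "\<bar>Im (Ln \<gamma>)\<bar> \<le> pi"
      using mpi_less_Im_Ln[OF nz] Im_Ln_le_pi[OF nz] by linarith
    ultimately show ?thesis using cmod_le[of "Ln \<gamma>"] by (simp add: norm_minus_cancel)
  qed
  ultimately show "\<exists>z\<in>log_scalars p. cmod z \<le> (\<bar>ln a\<bar> + \<bar>ln b\<bar>) + pi" by blast
qed

lemma log_scalars_nonempty: "\<exists>z. z \<in> log_scalars p"
proof -
  obtain R where "\<And>p. \<exists>z\<in>log_scalars p. cmod z \<le> R"
    using log_scalars_bounded by blast
  then show ?thesis by blast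
qed

lemma closed_log_scalars: "closed (log_scalars p)"
  unfolding closed_sequential_limits
proof (intro allI impI, elim conjE)
  fix z l assume z: "\<forall>n. z n \<in> log_scalars p" "z \<longlonglongrightarrow> l"
  have "(\<lambda>n. cmod (exp l - exp (z n)) * nu p) \<longlonglongrightarrow> cmod (exp l - exp l) * nu p"
    using z(2) by (intro tendsto_intros)
  then have "(\<lambda>n. nu (smult (exp l) p - smult (exp (z n)) p)) \<longlonglongrightarrow> 0"
    by (simp add: hom flip: smult_diff_left)
  moreover have "smult (exp (z n)) p \<in> orbit_closure" for n
    using z(1) by (simp add: log_scalars_def)
  ultimately have "smult (exp l) p \<in> orbit_closure"
    by (rule orbit_closure_limit[of "\<lambda>n. smult (exp (z n)) p", rotated])
  then show "l \<in> log_scalars p"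
    by (simp add: log_scalars_def)
qed

text \<open>Since \<open>1\<close> stands for \<open>x\<close>, this is the closed subgroup
  \<open>L\<close>.\<close>

abbreviation "log_return \<equiv> log_scalars 1"

lemma log_return_iff: "z \<in> log_return \<longleftrightarrow> [:exp z:] \<in> orbit_closure"
  by (simp add: log_scalars_def one_pCons)

lemma log_return_add: "z \<in> log_return \<Longrightarrow> w \<in> log_scalars p \<Longrightarrow> z + w \<in> log_scalars p"
  using orbit_closure_smult[of "exp z" "smult (exp w) p"]
  by (simp add: log_return_iff log_scalars_def exp_add)

lemma one_mem_orbit_closure: "1 \<in> orbit_closure"
  unfolding orbit_closure_def by (auto intro!: exI[of _ 0])

text \<open>For the constant polynomial \<open>exp w\<close>, the uniform bound says that
  \<open>w\<close> is within \<open>R\<close> of \<open>log_return\<close>. A closed semigroup with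
  bounded gaps is a group.\<close>

lemma log_return_uminus:
  assumes "z \<in> log_return"
  shows "- z \<in> log_return"
proof -
  obtain R where R: "\<And>p. \<exists>z\<in>log_scalars p. cmod z \<le> R"
    using log_scalars_bounded by blast
  have "\<exists>k\<in>log_return. cmod (w - k) \<le> R" for w
  proof -
    obtain k where "k \<in> log_scalars [:exp w:]" "cmod k \<le> R" using R by blast
    then have "w + k \<in> log_return" "cmod (w - (w + k)) \<le> R"
      by (simp_all add: log_return_iff log_scalars_def exp_add mult.commute)
    then show ?thesis by blast
  qed
  then show ?thesis
    using closed_log_scalars log_return_add assms
    by (intro syndetic_closed_semigroup_uminus[of log_return R z]) auto
qed

lemma log_return_diff: "z \<in> log_return \<Longrightarrow> w \<in> log_return \<Longrightarrow> z - w \<in> log_return"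
  using log_return_add log_return_uminus by fastforce

text \<open>Since \<open>p\<close> has dense range, the orbit of \<open>p\<close> approximates some
  \<open>1 / \<gamma>\<close>. Translation by \<open>c = - Ln \<gamma>\<close> therefore moves all
  logarithms of \<open>p\<close> into the group \<open>log_return\<close>.\<close>

lemma log_scalars_diff:
  assumes p: "p \<noteq> 0" and z: "z \<in> log_scalars p" and w: "w \<in> log_scalars p"
  shows "z - w \<in> log_return"
proof -
  obtain \<gamma> where \<gamma>: "a \<le> cmod \<gamma>"
    "\<And>e. 0 < e \<Longrightarrow> \<exists>n. nu (smult (1 / \<gamma>) 1 - monom 1 n * p) < e"
  proof (rule annulus_limit[of 1 "\<lambda>n. monom 1 n * p"])
    fix e :: real assume e: "e > 0"
    \<comment> \<open>An approximate inverse \<open>s\<close> of \<open>p\<close> is itself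
      approximated by a scaled monomial, which is then multiplied by \<open>p\<close>.\<close>
    obtain s where s: "nu (1 - p * s) < e / 2"
      using dense_range[OF p] e half_gt_zero by blast
    obtain C where C: "C > 0" "\<And>q. nu (p * q) \<le> C * nu q"
      using nu_mult_bounded by blast
    obtain \<gamma> n where g: "\<gamma> \<in> \<Gamma> - {0}" "nu (s - monom \<gamma> n) < e / 2 / C"
      using approx_nonzero[of "e / 2 / C" s] C(1) e by auto
    have "nu (p * (s - monom \<gamma> n)) < e / 2"
      using C(2)[of "s - monom \<gamma> n"] g(2) C(1) by (simp add: field_simps)
    moreover have "smult \<gamma> (monom 1 n * p) = p * monom \<gamma> n"
      by (metis mult.commute mult_smult_left smult_monom mult.right_neutral)
    ultimately have "nu (1 - smult \<gamma> (monom 1 n * p)) < e"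
      using nu_diff_triangle[of 1 "p * monom \<gamma> n" "p * s"] s by (simp add: algebra_simps)
    then show "\<exists>\<gamma>\<in>\<Gamma> - {0}. \<exists>n. nu (1 - smult \<gamma> (monom 1 n * p)) < e"
      using g by blast
  qed (use that in blast)
  define c where "c = - Ln \<gamma>"
  have "\<gamma> \<noteq> 0" using \<gamma>(1) a_pos by auto
  then have c: "exp c = 1 / \<gamma>" by (simp add: c_def exp_minus inverse_eq_divide)
  have "y + c \<in> log_return" if y: "y \<in> log_scalars p" for y
    unfolding log_return_iff
  proof (rule orbit_closure_closed)
    fix e :: real assume "e > 0"
    then have "0 < e / cmod (exp y)" by simp
    then obtain n where n: "nu (smult (1 / \<gamma>) 1 - monom 1 n * p) < e / cmod (exp y)"
      using \<gamma>(2) by blast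
    have "[:exp (y + c):] - monom 1 n * smult (exp y) p =
        smult (exp y) (smult (1 / \<gamma>) 1 - monom 1 n * p)"
      using c by (simp add: exp_add smult_diff_right one_pCons)
    then have "nu ([:exp (y + c):] - monom 1 n * smult (exp y) p) < e"
      using n by (simp add: hom field_simps del: norm_exp_eq_Re)
    then show "\<exists>q\<in>orbit_closure. nu ([:exp (y + c):] - q) < e"
      using y orbit_closure_mult_monom unfolding log_scalars_def by blast
  qed
  then have "(z + c) - (w + c) \<in> log_return"
    using z w log_return_diff by blast
  then show ?thesis by simp
qed

lemma log_return_UNIV_imp_dense:
  assumes "log_return = UNIV"
  shows "p \<in> orbit_closure"
proof -
  obtain z where "z \<in> log_scalars p"
    using log_scalars_nonempty by blast
  then have "- z + z \<in> log_scalars p"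
    using assms by (intro log_return_add) auto
  then show ?thesis by (simp add: log_scalars_def)
qed

text \<open>Every polynomial is a multiple of \<open>1\<close>, so \<open>nu\<close> vanishes
  identically.\<close>

lemma nu_1_eq_0_imp_dense:
  assumes "nu 1 = 0"
  shows "p \<in> orbit_closure"
proof -
  have "nu q = 0" for q
  proof -
    obtain C where "\<And>p. nu (q * p) \<le> C * nu p"
      using nu_mult_bounded by blast
    from this[of 1] show ?thesis using assms nu_nonneg[of q] by simp
  qed
  then show ?thesis by (simp add: orbit_closure_def)
qed

end

section \<open>Lifting the phase\<close>

context scaled_orbit_seminorm
begin

context
  fixes \<phi> :: "complex \<Rightarrow> real"
  assumes \<phi>_linear: "bounded_linear \<phi>" and \<phi>_int: "\<And>z. z \<in> log_return \<Longrightarrow> \<phi> z \<in> \<int>"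
begin

section \<open>The phase of nonzero polynomials and its continuity\<close>

interpretation \<phi>: bounded_linear \<phi> by (rule \<phi>_linear)

definition phase :: "complex poly \<Rightarrow> complex"
  where "phase p = cis (2 * pi * \<phi> (SOME z. z \<in> log_scalars p))"

text \<open>Two logarithms of \<open>p\<close> differ by an element of \<open>log_return\<close>, so
  the choice made in \<open>phase\<close> does not matter.\<close>

lemma phase_eq:
  assumes "p \<noteq> 0" "z \<in> log_scalars p"
  shows "phase p = cis (2 * pi * \<phi> z)"
proof -
  define w where "w = (SOME z. z \<in> log_scalars p)"
  have "w \<in> log_scalars p" unfolding w_def using assms(2) by (rule someI)
  then have "\<phi> w - \<phi> z \<in> \<int>"
    using \<phi>_int[OF log_scalars_diff[OF assms(1) _ assms(2)]] by (simp add: \<phi>.diff)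
  then have "cis (2 * pi * (\<phi> w - \<phi> z)) = 1" by (rule cis_multiple_2pi)
  moreover have "cis (2 * pi * \<phi> w) = cis (2 * pi * \<phi> z) * cis (2 * pi * (\<phi> w - \<phi> z))"
    by (simp add: cis_mult algebra_simps)
  ultimately show ?thesis by (simp add: phase_def w_def)
qed

lemma norm_phase [simp]: "cmod (phase p) = 1"
  by (simp add: phase_def)

lemma phase_smult_exp:
  assumes "p \<noteq> 0"
  shows "phase (smult (exp c) p) = phase p * cis (- (2 * pi * \<phi> c))"
proof -
  obtain z where z: "z \<in> log_scalars p" using log_scalars_nonempty by blast
  then have "z - c \<in> log_scalars (smult (exp c) p)"
    by (simp add: log_scalars_def exp_diff)
  then show ?thesis
    using phase_eq[OF assms z] phase_eq[of "smult (exp c) p" "z - c"] assms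
    by (simp add: \<phi>.diff cis_mult algebra_simps)
qed

text \<open>The closure is invariant under the shift, so a logarithm of \<open>p\<close> is also one
  of its shift.\<close>

lemma phase_shift:
  assumes "p \<noteq> 0"
  shows "phase (pCons 0 p) = phase p"
proof -
  obtain z where z: "z \<in> log_scalars p" using log_scalars_nonempty by blast
  then have "z \<in> log_scalars (pCons 0 p)"
    using orbit_closure_mult_monom[of "smult (exp z) p" 1]
    by (simp add: log_scalars_def monom_Suc mult_pCons_left)
  then show ?thesis
    using phase_eq[OF assms z] phase_eq[of "pCons 0 p" z] assms by simp
qed

text \<open>If \<open>q n\<close> tends to \<open>p\<close>, then uniformly bounded logarithms of
  the \<open>q n\<close> accumulate at a logarithm of \<open>p\<close>, and along that subsequence
  the phases converge to the phase of \<open>p\<close>.\<close>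

lemma phase_continuous:
  assumes p: "p \<noteq> 0" and e: "0 < e"
  shows "\<exists>d>0. \<forall>q. q \<noteq> 0 \<longrightarrow> nu (q - p) < d \<longrightarrow> cmod (phase q - phase p) < e"
proof (rule ccontr)
  assume neg: "\<not> ?thesis"
  have "\<exists>q. q \<noteq> 0 \<and> nu (q - p) < inverse (real (Suc n)) \<and> e \<le> cmod (phase q - phase p)" for n
    using neg by (metis inverse_positive_iff_positive not_le of_nat_0_less_iff zero_less_Suc)
  then obtain q where q: "\<And>n. q n \<noteq> 0" "\<And>n. nu (q n - p) < inverse (real (Suc n))"
      "\<And>n. e \<le> cmod (phase (q n) - phase p)"
    by metis
  obtain R where R: "\<And>p. \<exists>z\<in>log_scalars p. cmod z \<le> R"
    using log_scalars_bounded by blast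
  then have "\<forall>n. \<exists>z. z \<in> log_scalars (q n) \<and> cmod z \<le> R" by blast
  then obtain z where z: "\<And>n. z n \<in> log_scalars (q n)" "\<And>n. cmod (z n) \<le> R"
    by metis
  then have "bounded (range z)" by (auto simp: bounded_iff)
  then obtain r w where r: "strict_mono r" "(z \<circ> r) \<longlonglongrightarrow> w"
    using bounded_imp_convergent_subsequence by blast
  have q0: "(\<lambda>n. nu (p - q n)) \<longlonglongrightarrow> 0"
    by (rule tendsto_sandwich[OF _ _ tendsto_const LIMSEQ_inverse_real_of_nat])
       (use q(2) in \<open>auto intro!: always_eventually less_imp_le simp del: of_nat_Suc simp: nu_diff_commute\<close>)
  have "smult (exp w) p \<in> orbit_closure"
  proof (rule orbit_closure_limit)
    show "smult (exp (z (r n))) (q (r n)) \<in> orbit_closure" for n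
      using z(1) by (simp add: log_scalars_def)
    \<comment> \<open>Both summands come from comparison with the intermediate vector
      \<open>smult (exp (z (r n))) p\<close>.\<close>
    let ?g = "\<lambda>n. cmod (exp w - exp (z (r n))) * nu p + cmod (exp (z (r n))) * nu (p - q (r n))"
    have "?g \<longlonglongrightarrow> cmod (exp w - exp w) * nu p + cmod (exp w) * 0"
      using r(2) LIMSEQ_subseq_LIMSEQ[OF q0 r(1)] by (intro tendsto_intros) (auto simp: o_def)
    then have g0: "?g \<longlonglongrightarrow> 0" by simp
    have "nu (smult (exp w) p - smult (exp (z (r n))) (q (r n))) \<le> ?g n" for n
      using nu_diff_triangle[of "smult (exp w) p" "smult (exp (z (r n))) (q (r n))" "smult (exp (z (r n))) p"]
      by (simp only: hom flip: smult_diff_left smult_diff_right)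
    then have "\<forall>\<^sub>F n in sequentially.
        norm (nu (smult (exp w) p - smult (exp (z (r n))) (q (r n)))) \<le> ?g n"
      by simp
    from Lim_null_comparison[OF this g0]
    show "(\<lambda>n. nu (smult (exp w) p - smult (exp (z (r n))) (q (r n)))) \<longlonglongrightarrow> 0" .
  qed
  then have w: "w \<in> log_scalars p" by (simp add: log_scalars_def)
  have "(\<lambda>n. cis (2 * pi * \<phi> (z (r n)))) \<longlonglongrightarrow> cis (2 * pi * \<phi> w)"
    using r(2) unfolding cis_conv_exp by (intro tendsto_intros \<phi>.tendsto) (simp add: o_def)
  then have "(\<lambda>n. phase (q (r n))) \<longlonglongrightarrow> phase p"
    using phase_eq[OF q(1) z(1)] phase_eq[OF p w] by simp
  then have "\<forall>\<^sub>F n in sequentially. dist (phase (q (r n))) (phase p) < e"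
    using e by (rule tendstoD)
  then obtain n where "cmod (phase (q (r n)) - phase p) < e"
    by (auto simp: eventually_sequentially dist_norm)
  then show False using q(3)[of "r n"] by simp
qed

text \<open>Three polynomials with varying coefficients cover the triangle in
  \<open>phase_lift_triangle\<close> and, with a zero term, the segment in
  \<open>phase_lift_local\<close>.\<close>

lemma phase_comp_continuous:
  fixes \<alpha> \<beta> \<gamma> :: "'t::metric_space \<Rightarrow> complex"
  assumes \<alpha>: "continuous_on S \<alpha>" and \<beta>: "continuous_on S \<beta>" and \<gamma>: "continuous_on S \<gamma>"
    and nz: "\<And>z. z \<in> S \<Longrightarrow> smult (\<alpha> z) p + smult (\<beta> z) q + smult (\<gamma> z) r \<noteq> 0"
  shows "continuous_on S (\<lambda>z. phase (smult (\<alpha> z) p + smult (\<beta> z) q + smult (\<gamma> z) r))"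
  unfolding continuous_on_def
proof (intro ballI tendstoI)
  fix z e assume z: "z \<in> S" and e: "0 < (e :: real)"
  let ?f = "\<lambda>z. smult (\<alpha> z) p + smult (\<beta> z) q + smult (\<gamma> z) r"
  obtain d where d: "d > 0" "\<And>q. q \<noteq> 0 \<Longrightarrow> nu (q - ?f z) < d \<Longrightarrow> cmod (phase q - phase (?f z)) < e"
    using phase_continuous[OF nz[OF z] e] by blast
  have le: "nu (?f y - ?f z) \<le> cmod (\<alpha> y - \<alpha> z) * nu p + cmod (\<beta> y - \<beta> z) * nu q + cmod (\<gamma> y - \<gamma> z) * nu r" for y
  proof -
    have "?f y - ?f z = smult (\<alpha> y - \<alpha> z) p + smult (\<beta> y - \<beta> z) q + smult (\<gamma> y - \<gamma> z) r"
      by (simp add: smult_diff_left algebra_simps)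
    then show ?thesis
      using triangle[of "smult (\<alpha> y - \<alpha> z) p + smult (\<beta> y - \<beta> z) q" "smult (\<gamma> y - \<gamma> z) r"]
        triangle[of "smult (\<alpha> y - \<alpha> z) p" "smult (\<beta> y - \<beta> z) q"] by (simp add: hom)
  qed
  have lim: "((\<lambda>y. cmod (\<alpha> y - \<alpha> z) * nu p + cmod (\<beta> y - \<beta> z) * nu q + cmod (\<gamma> y - \<gamma> z) * nu r)
      \<longlongrightarrow> cmod (\<alpha> z - \<alpha> z) * nu p + cmod (\<beta> z - \<beta> z) * nu q + cmod (\<gamma> z - \<gamma> z) * nu r) (at z within S)"
    using \<alpha> \<beta> \<gamma> z unfolding continuous_on_def by (intro tendsto_intros) auto
  then have "\<forall>\<^sub>F y in at z within S.
      cmod (\<alpha> y - \<alpha> z) * nu p + cmod (\<beta> y - \<beta> z) * nu q + cmod (\<gamma> y - \<gamma> z) * nu r < d"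
    using d(1) by (intro order_tendstoD(2)[OF lim]) simp
  moreover have "\<forall>\<^sub>F y in at z within S. y \<in> S"
    by (simp add: eventually_at_filter)
  ultimately show "\<forall>\<^sub>F y in at z within S. dist (phase (?f y)) (phase (?f z)) < e"
  proof eventually_elim
    case (elim y)
    then show ?case
      using d(2)[OF nz[of y]] le[of y] by (simp add: dist_norm)
  qed
qed

text \<open>Here \<open>d\<close> is the variation of the argument along the segment from
  \<open>p\<close> to \<open>q\<close>. A relation is used because lifts are obtained only for
  segments that avoid 0.\<close>

definition phase_lift :: "complex poly \<Rightarrow> complex poly \<Rightarrow> real \<Rightarrow> bool"
  where "phase_lift p q d \<longleftrightarrow> (\<exists>\<psi>. continuous_on {0..1} \<psi> \<and>
    (\<forall>t\<in>{0..1}. phase (smult (of_real (1 - t)) p + smult (of_real t) q) = cis (\<psi> t)) \<and>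
    \<psi> 1 - \<psi> 0 = d)"

lemma phase_liftI:
  assumes "continuous_on {0..1} \<psi>"
    "\<And>t. 0 \<le> t \<Longrightarrow> t \<le> 1 \<Longrightarrow> phase (smult (of_real (1 - t)) p + smult (of_real t) q) = cis (\<psi> t)"
    "\<psi> 1 - \<psi> 0 = d"
  shows "phase_lift p q d"
  using assms unfolding phase_lift_def by (intro exI[of _ \<psi>]) auto

text \<open>Two lifts differ by a continuous function with values in the discrete set of multiples
  of \<open>2 * pi\<close>, hence by a constant.\<close>

lemma phase_lift_unique:
  assumes "phase_lift p q d" "phase_lift p q d'"
  shows "d = d'"
proof -
  obtain \<psi> where \<psi>: "continuous_on {0..1} \<psi>" "\<psi> 1 - \<psi> 0 = d"
    "\<And>t. t \<in> {0..1} \<Longrightarrow> phase (smult (of_real (1 - t)) p + smult (of_real t) q) = cis (\<psi> t)"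
    using assms(1) unfolding phase_lift_def by blast
  obtain \<psi>' where \<psi>': "continuous_on {0..1} \<psi>'" "\<psi>' 1 - \<psi>' 0 = d'"
    "\<And>t. t \<in> {0..1} \<Longrightarrow> phase (smult (of_real (1 - t)) p + smult (of_real t) q) = cis (\<psi>' t)"
    using assms(2) unfolding phase_lift_def by blast
  have int: "\<exists>n. \<psi> t - \<psi>' t = 2 * pi * of_int n" if "t \<in> {0..1}" for t
  proof -
    have "cis (\<psi> t) = cis (\<psi>' t)" using \<psi>(3) \<psi>'(3) that by metis
    then have "exp (\<i> * of_real (\<psi> t)) = exp (\<i> * of_real (\<psi>' t))" by (simp add: cis_conv_exp)
    then obtain n :: int where
      "\<i> * of_real (\<psi> t) = \<i> * of_real (\<psi>' t) + (of_int (2 * n) * pi) * \<i>"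
      using exp_eq by blast
    from arg_cong[OF this, of Im] show ?thesis by (intro exI[of _ n]) simp
  qed
  have "(\<lambda>t. \<psi> t - \<psi>' t) constant_on {0..1}"
  proof (rule continuous_discrete_range_constant)
    show "connected {0..1::real}" by simp
    show "continuous_on {0..1} (\<lambda>t. \<psi> t - \<psi>' t)"
      using \<psi>(1) \<psi>'(1) by (intro continuous_intros)
    fix t :: real assume t: "t \<in> {0..1}"
    show "\<exists>e>0. \<forall>y. y \<in> {0..1} \<and> \<psi> y - \<psi>' y \<noteq> \<psi> t - \<psi>' t \<longrightarrow> e \<le> norm ((\<psi> y - \<psi>' y) - (\<psi> t - \<psi>' t))"
    proof (intro exI[of _ "2 * pi"] conjI allI impI; (elim conjE)?)
      fix y assume y: "y \<in> {0..1}" and ne: "\<psi> y - \<psi>' y \<noteq> \<psi> t - \<psi>' t"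
      obtain m n where mn: "\<psi> t - \<psi>' t = 2 * pi * of_int m" "\<psi> y - \<psi>' y = 2 * pi * of_int n"
        using int t y by blast
      with ne have "1 \<le> \<bar>n - m\<bar>" by auto
      then have "1 \<le> \<bar>real_of_int (n - m)\<bar>" by linarith
      then have "2 * pi * 1 \<le> 2 * pi * \<bar>of_int (n - m)\<bar>"
        by (intro mult_left_mono) auto
      then show "2 * pi \<le> norm ((\<psi> y - \<psi>' y) - (\<psi> t - \<psi>' t))"
        unfolding mn by (simp add: abs_mult flip: right_diff_distrib)
    qed simp
  qed
  then obtain k where "\<And>t. t \<in> {0..1} \<Longrightarrow> \<psi> t - \<psi>' t = k" unfolding constant_on_def by blast
  from this[of 0] this[of 1] show ?thesis using \<psi>(2) \<psi>'(2) by simp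
qed

text \<open>A triangle is contractible, so the phase has a continuous logarithm \<open>G\<close> on
  all of it. The increments of \<open>Im G\<close> along the edges then add up.\<close>

lemma phase_lift_triangle:
  assumes nz: "\<And>\<alpha> \<beta> \<gamma> :: real. 0 \<le> \<alpha> \<Longrightarrow> 0 \<le> \<beta> \<Longrightarrow> 0 \<le> \<gamma> \<Longrightarrow> \<alpha> + \<beta> + \<gamma> = 1 \<Longrightarrow>
    smult (of_real \<alpha>) p + smult (of_real \<beta>) q + smult (of_real \<gamma>) r \<noteq> 0"
  obtains d1 d2 where "phase_lift p q d1" "phase_lift q r d2" "phase_lift p r (d1 + d2)"
proof -
  \<comment> \<open>The triangle is parametrised by the plane triangle with vertices 0, 1 and
    \<open>\<i>\<close>, which correspond to \<open>p\<close>, \<open>q\<close> and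
    \<open>r\<close>.\<close>
  define D where "D = {z. 0 \<le> Re z \<and> 0 \<le> Im z \<and> Re z + Im z \<le> 1}"
  define f where "f z = smult (of_real (1 - Re z - Im z)) p + smult (of_real (Re z)) q
    + smult (of_real (Im z)) r" for z
  have "convex D"
    unfolding D_def
  proof (rule convexI, clarsimp)
    fix x y u v assume *: "0 \<le> Re x" "0 \<le> Im x" "0 \<le> Re y" "0 \<le> Im y" "0 \<le> (u::real)" "0 \<le> v"
      "u + v = 1" "Re x + Im x \<le> 1" "Re y + Im y \<le> 1"
    have "u * (Re x + Im x) + v * (Re y + Im y) \<le> u * 1 + v * 1"
      using * by (intro add_mono mult_left_mono) auto
    then show "u * Re x + v * Re y + (u * Im x + v * Im y) \<le> 1"
      using * by (simp add: algebra_simps)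
  qed
  moreover have "continuous_on D (\<lambda>z. phase (f z))"
    unfolding f_def
    by (intro phase_comp_continuous continuous_intros nz) (auto simp: D_def)
  moreover have "phase (f z) \<noteq> 0" for z
    by (simp add: phase_def)
  ultimately obtain G where G: "continuous_on D G" "\<And>z. z \<in> D \<Longrightarrow> phase (f z) = exp (G z)"
    using continuous_logarithm_on_contractible[of D] convex_imp_contractible by metis
  have phase_f: "phase (f z) = cis (Im (G z))" if "z \<in> D" for z
  proof -
    have "Re (G z) = 0" using norm_phase[of "f z"] G(2)[OF that] by simp
    then have "G z = \<i> * of_real (Im (G z))" by (simp add: complex_eq_iff)
    then show ?thesis using G(2)[OF that] by (metis cis_conv_exp)
  qed
  have edge: "phase_lift u v (Im (G (c 1)) - Im (G (c 0)))"
    if cont: "continuous_on {0..1} c" and mem: "\<And>t. 0 \<le> t \<Longrightarrow> t \<le> 1 \<Longrightarrow> c t \<in> D"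
      and fc: "\<And>t. f (c t) = smult (of_real (1 - t)) u + smult (of_real t) v" for u v and c :: "real \<Rightarrow> complex"
  proof (rule phase_liftI[OF _ _ refl])
    show "continuous_on {0..1} (\<lambda>t. Im (G (c t)))"
      using mem by (intro continuous_intros continuous_on_compose2[OF G(1) cont]) auto
    show "phase (smult (of_real (1 - t)) u + smult (of_real t) v) = cis (Im (G (c t)))"
      if "0 \<le> t" "t \<le> 1" for t
      using phase_f[OF mem[OF that]] fc[of t] by simp
  qed
  show thesis
  proof (rule that)
    show "phase_lift p q (Im (G 1) - Im (G 0))"
      using edge[of complex_of_real p q] by (simp add: D_def f_def continuous_intros)
    show "phase_lift q r (Im (G \<i>) - Im (G 1))"
      using edge[of "\<lambda>t. of_real (1 - t) + \<i> * of_real t" q r]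
      by (simp add: D_def f_def continuous_intros)
    show "phase_lift p r ((Im (G 1) - Im (G 0)) + (Im (G \<i>) - Im (G 1)))"
      using edge[of "\<lambda>t. \<i> * of_real t" p r] by (simp add: D_def f_def continuous_intros)
  qed
qed

lemma phase_lift_shift:
  assumes "phase_lift p q d"
    and "\<And>t. 0 \<le> t \<Longrightarrow> t \<le> 1 \<Longrightarrow> smult (of_real (1 - t)) p + smult (of_real t) q \<noteq> 0"
  shows "phase_lift (pCons 0 p) (pCons 0 q) d"
proof -
  have "smult (of_real (1 - t)) (pCons 0 p) + smult (of_real t) (pCons 0 q)
      = pCons 0 (smult (of_real (1 - t)) p + smult (of_real t) q)" for t
    by simp
  then show ?thesis
    using assms phase_shift unfolding phase_lift_def by (metis atLeastAtMost_iff)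
qed

text \<open>The slit plane is star-shaped with respect to 1.\<close>

lemma segment_avoids_nonpos:
  fixes c :: complex
  assumes c: "c \<notin> \<real>\<^sub>\<le>\<^sub>0" and t: "0 \<le> t" "t \<le> 1"
  shows "of_real (1 - t) + of_real t * c \<notin> \<real>\<^sub>\<le>\<^sub>0"
proof
  assume "of_real (1 - t) + of_real t * c \<in> \<real>\<^sub>\<le>\<^sub>0"
  then have *: "1 - t + t * Re c \<le> 0" "t * Im c = 0"
    by (auto simp: complex_nonpos_Reals_iff)
  then have "t > 0" using t by (cases "t = 0") auto
  with * have "Im c = 0" "t * Re c \<le> 0" using t by auto
  then have "c \<in> \<real>\<^sub>\<le>\<^sub>0"
    using \<open>t > 0\<close> by (simp add: complex_nonpos_Reals_iff mult_le_0_iff)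
  with c show False by blast
qed

text \<open>The scalar factor runs from 1 to \<open>c\<close> inside the slit plane, where
  \<open>Ln\<close> is continuous and gives the lift explicitly.\<close>

lemma phase_lift_smult:
  assumes p: "p \<noteq> 0" and c: "c \<notin> \<real>\<^sub>\<le>\<^sub>0"
  shows "phase_lift p (smult c p) (- (2 * pi * \<phi> (Ln c)))"
proof -
  obtain z where z: "z \<in> log_scalars p" using log_scalars_nonempty by blast
  let ?s = "\<lambda>t. of_real (1 - t) + of_real t * c"
  have s: "?s t \<notin> \<real>\<^sub>\<le>\<^sub>0" if "0 \<le> t" "t \<le> 1" for t
    using segment_avoids_nonpos[OF c that] .
  show ?thesis
  proof (rule phase_liftI)
    show "continuous_on {0..1} (\<lambda>t. 2 * pi * \<phi> z - 2 * pi * \<phi> (Ln (?s t)))"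
      using s by (intro continuous_intros \<phi>.continuous_on) auto
    fix t :: real assume t: "0 \<le> t" "t \<le> 1"
    then have "?s t \<noteq> 0" using s[OF t] by auto
    then have "smult (of_real (1 - t)) p + smult (of_real t) (smult c p) = smult (exp (Ln (?s t))) p"
      by (simp add: smult_add_left)
    then show "phase (smult (of_real (1 - t)) p + smult (of_real t) (smult c p))
        = cis (2 * pi * \<phi> z - 2 * pi * \<phi> (Ln (?s t)))"
      using phase_smult_exp[OF p, of "Ln (?s t)"] phase_eq[OF p z] by (simp add: cis_mult)
  qed (simp add: \<phi>.zero)
qed

text \<open>Linear independence over the complex numbers, which keeps the segment from
  \<open>p\<close> to \<open>q\<close> away from 0.\<close>

definition indep :: "complex poly \<Rightarrow> complex poly \<Rightarrow> bool"
  where "indep p q \<longleftrightarrow> (\<forall>s t. smult s p + smult t q = 0 \<longrightarrow> s = 0 \<and> t = 0)"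

lemma indep_smult: "indep p q \<Longrightarrow> c \<noteq> 0 \<Longrightarrow> indep p (smult c q)"
  unfolding indep_def by fastforce

lemma indep_nonzero:
  assumes "indep p q"
  shows "p \<noteq> 0 \<and> q \<noteq> 0"
  using assms[unfolded indep_def, rule_format, of 1 0] assms[unfolded indep_def, rule_format, of 0 1]
  by auto

lemma indep_segment:
  assumes "indep p q"
  shows "smult (of_real (1 - t)) p + smult (of_real t) q \<noteq> 0"
proof
  assume "smult (of_real (1 - t)) p + smult (of_real t) q = 0"
  then have "complex_of_real (1 - t) = 0 \<and> complex_of_real t = 0"
    using assms unfolding indep_def by blast
  then show False by auto
qed

text \<open>The triangle with vertices \<open>p\<close>, \<open>q\<close>, \<open>smult c q\<close>
  is used; its edge from \<open>q\<close> to \<open>smult c q\<close> is given by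
  \<open>phase_lift_smult\<close>.\<close>

lemma phase_lift_rotate:
  assumes pq: "indep p q" and c: "c \<notin> \<real>\<^sub>\<le>\<^sub>0" and d: "phase_lift p q d"
  shows "phase_lift p (smult c q) (d - 2 * pi * \<phi> (Ln c))"
proof -
  obtain d1 d2 where *: "phase_lift p q d1" "phase_lift q (smult c q) d2"
    "phase_lift p (smult c q) (d1 + d2)"
  proof (rule phase_lift_triangle[of p q "smult c q"])
    fix \<alpha> \<beta> \<gamma> :: real assume h: "0 \<le> \<alpha>" "0 \<le> \<beta>" "0 \<le> \<gamma>" "\<alpha> + \<beta> + \<gamma> = 1"
    \<comment> \<open>Independence forces \<open>\<alpha> = 0\<close>; the coefficient of
      \<open>q\<close> then lies on the segment from 1 to \<open>c\<close> and cannot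
      vanish.\<close>
    show "smult (of_real \<alpha>) p + smult (of_real \<beta>) q + smult (of_real \<gamma>) (smult c q) \<noteq> 0"
    proof
      assume "smult (of_real \<alpha>) p + smult (of_real \<beta>) q + smult (of_real \<gamma>) (smult c q) = 0"
      then have "smult (of_real \<alpha>) p + smult (of_real \<beta> + of_real \<gamma> * c) q = 0"
        by (simp add: smult_add_left add.assoc)
      then have "complex_of_real \<alpha> = 0" "of_real \<beta> + of_real \<gamma> * c = 0"
        using pq unfolding indep_def by blast+
      then have "1 - \<gamma> = \<beta>" "of_real \<beta> + of_real \<gamma> * c = 0"
        using h(4) by simp_all
      then have "of_real (1 - \<gamma>) + of_real \<gamma> * c = 0"
        by simp
      moreover have "of_real (1 - \<gamma>) + of_real \<gamma> * c \<notin> \<real>\<^sub>\<le>\<^sub>0"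
        using segment_avoids_nonpos[OF c] h by simp
      ultimately show False by simp
    qed
  qed (rule that)
  have "d1 = d" using phase_lift_unique * d by blast
  moreover have "d2 = - (2 * pi * \<phi> (Ln c))"
    using phase_lift_unique *(2) phase_lift_smult[OF _ c] indep_nonzero[OF pq] by blast
  ultimately show ?thesis using *(3) by simp
qed

text \<open>A degenerate triangle already provides the lift along its edge.\<close>

lemma phase_lift_exists:
  assumes "indep p q"
  shows "\<exists>d. phase_lift p q d"
proof -
  obtain d1 d2 where "phase_lift p q d1" "phase_lift q q d2" "phase_lift p q (d1 + d2)"
  proof (rule phase_lift_triangle[of p q q])
    fix \<alpha> \<beta> \<gamma> :: real assume h: "0 \<le> \<alpha>" "0 \<le> \<beta>" "0 \<le> \<gamma>" "\<alpha> + \<beta> + \<gamma> = 1"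
    show "smult (of_real \<alpha>) p + smult (of_real \<beta>) q + smult (of_real \<gamma>) q \<noteq> 0"
    proof
      assume "smult (of_real \<alpha>) p + smult (of_real \<beta>) q + smult (of_real \<gamma>) q = 0"
      then have "smult (of_real \<alpha>) p + smult (of_real (\<beta> + \<gamma>)) q = 0"
        by (simp add: smult_add_left add.assoc)
      then have "complex_of_real \<alpha> = 0" "complex_of_real (\<beta> + \<gamma>) = 0"
        using assms unfolding indep_def by blast+
      then show False using h by (simp only: of_real_eq_0_iff)
    qed
  qed (rule that)
  then show ?thesis by blast
qed

lemma indep_monom:
  assumes "m \<noteq> n"
  shows "indep (monom 1 m) (monom 1 n)"
  unfolding indep_def
proof (intro allI impI)
  fix s t :: complex assume "smult s (monom 1 m) + smult t (monom 1 n) = 0"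
  then have "coeff (smult s (monom 1 m) + smult t (monom 1 n)) k = 0" for k by simp
  from this[of m] this[of n] show "s = 0 \<and> t = 0" using assms by simp
qed

text \<open>Four quarter turns restore \<open>q\<close>, so uniqueness of the lift makes the
  accumulated change vanish.\<close>

lemma \<phi>_imaginary: "\<phi> \<i> = 0"
proof -
  have i: "\<i> \<notin> \<real>\<^sub>\<le>\<^sub>0" by (simp add: complex_nonpos_Reals_iff)
  define q :: "complex poly" where "q = monom 1 1"
  have ind: "indep 1 q" using indep_monom[of 0 1] by (simp add: q_def)
  obtain d where d: "phase_lift 1 q d" using phase_lift_exists[OF ind] by blast
  let ?e = "2 * pi * \<phi> (Ln \<i>)"
  have step: "phase_lift 1 (smult (\<i> * c) q) (x - ?e)" if "phase_lift 1 (smult c q) x" "c \<noteq> 0" for c x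
    using phase_lift_rotate[OF indep_smult[OF ind that(2)] i that(1)] by simp
  have "phase_lift 1 (smult 1 q) d" using d by simp
  then have "phase_lift 1 (smult (\<i> * 1) q) (d - ?e)" by (rule step) simp
  then have "phase_lift 1 (smult (\<i> * (\<i> * 1)) q) (d - ?e - ?e)" by (rule step) simp
  then have "phase_lift 1 (smult (\<i> * (\<i> * (\<i> * 1))) q) (d - ?e - ?e - ?e)" by (rule step) simp
  then have "phase_lift 1 (smult (\<i> * (\<i> * (\<i> * (\<i> * 1)))) q) (d - ?e - ?e - ?e - ?e)" by (rule step) simp
  then have "phase_lift 1 q (d - ?e - ?e - ?e - ?e)" by simp
  then have "d - ?e - ?e - ?e - ?e = d" using phase_lift_unique d by blast
  then have "\<phi> (Ln \<i>) = 0" by simp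
  moreover have "Ln \<i> = (pi / 2) *\<^sub>R \<i>" by (simp add: scaleR_conv_of_real)
  ultimately have "(pi / 2) * \<phi> \<i> = 0" by (metis \<phi>.scaleR real_scaleR_def)
  then show ?thesis by simp
qed

lemma \<phi>_eq: "\<phi> z = \<phi> 1 * Re z"
proof -
  have "z = Re z *\<^sub>R 1 + Im z *\<^sub>R \<i>" by (simp add: complex_eq_iff)
  then have "\<phi> z = Re z * \<phi> 1 + Im z * \<phi> \<i>"
    by (metis \<phi>.add \<phi>.scaleR real_scaleR_def)
  then show ?thesis by (simp add: \<phi>_imaginary)
qed

text \<open>A negative real \<open>c\<close> is not covered by \<open>phase_lift_rotate\<close>. Two
  rotations by the principal square root of \<open>c\<close>, which lies off the slit, handle all
  cases.\<close>

lemma phase_lift_dilate: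
  assumes pq: "indep p q" and c: "c \<noteq> 0" and d: "phase_lift p q d"
  shows "phase_lift p (smult c q) (d - 2 * pi * \<phi> 1 * ln (cmod c))"
proof -
  define w where "w = csqrt c"
  have ww: "w * w = c" using power2_csqrt[of c] by (simp add: w_def power2_eq_square)
  then have "w \<noteq> 0" using c by auto
  have w: "w \<notin> \<real>\<^sub>\<le>\<^sub>0"
  proof
    assume "w \<in> \<real>\<^sub>\<le>\<^sub>0"
    then have "Re w \<le> 0" "Im w = 0" by (auto simp: complex_nonpos_Reals_iff)
    moreover have "0 < Re w \<or> Re w = 0 \<and> 0 \<le> Im w" unfolding w_def by (rule csqrt_principal)
    ultimately have "w = 0" by (simp add: complex_eq_iff)
    then show False using \<open>w \<noteq> 0\<close> by simp
  qed
  have Lnw: "\<phi> (Ln w) = \<phi> 1 * ln (cmod w)" using \<phi>_eq[of "Ln w"] \<open>w \<noteq> 0\<close> by simp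
  have "phase_lift p (smult w (smult w q)) (d - 2 * pi * \<phi> (Ln w) - 2 * pi * \<phi> (Ln w))"
    using phase_lift_rotate[OF indep_smult[OF pq \<open>w \<noteq> 0\<close>] w] phase_lift_rotate[OF pq w d] by blast
  moreover have "ln (cmod c) = 2 * ln (cmod w)"
    using \<open>w \<noteq> 0\<close> by (simp add: norm_mult ln_mult flip: ww)
  ultimately show ?thesis by (simp add: ww Lnw algebra_simps)
qed

text \<open>By shift invariance all segments between consecutive monomials have the same lift, and
  triangles with vertex \<open>1\<close> add these up.\<close>

lemma phase_lift_monom:
  assumes d: "phase_lift 1 (monom 1 1) d"
  shows "phase_lift 1 (monom 1 (Suc n)) (of_nat (Suc n) * d)"
proof (induction n)
  case 0
  then show ?case using d by simp
next
  case (Suc n)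
  have step: "phase_lift (monom 1 k) (monom 1 (Suc k)) d" for k
  proof (induction k)
    case 0
    then show ?case using d by (simp add: monom_0 one_pCons)
  next
    case (Suc k)
    have "phase_lift (pCons 0 (monom 1 k)) (pCons 0 (monom 1 (Suc k))) d"
    proof (rule phase_lift_shift[OF Suc])
      fix t :: real
      have "indep (monom 1 k) (monom 1 (Suc k))" by (rule indep_monom) simp
      then show "smult (complex_of_real (1 - t)) (monom 1 k) + smult (of_real t) (monom 1 (Suc k)) \<noteq> 0"
        by (rule indep_segment)
    qed
    then show ?case by (simp add: monom_Suc)
  qed
  obtain d1 d2 where *: "phase_lift 1 (monom 1 (Suc n)) d1"
    "phase_lift (monom 1 (Suc n)) (monom 1 (Suc (Suc n))) d2"
    "phase_lift 1 (monom 1 (Suc (Suc n))) (d1 + d2)"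
  proof (rule phase_lift_triangle[of 1 "monom 1 (Suc n)" "monom 1 (Suc (Suc n))"])
    fix \<alpha> \<beta> \<gamma> :: real assume h: "\<alpha> + \<beta> + \<gamma> = 1"
    let ?p = "smult (of_real \<alpha>) 1 + smult (of_real \<beta>) (monom 1 (Suc n)) + smult (of_real \<gamma>) (monom 1 (Suc (Suc n)))
      :: complex poly"
    show "?p \<noteq> 0"
    proof
      assume "?p = 0"
      then have "coeff ?p k = 0" for k by simp
      from this[of 0] this[of "Suc n"] this[of "Suc (Suc n)"] show False using h by simp
    qed
  qed (rule that)
  have "d1 = of_nat (Suc n) * d" "d2 = d"
    using phase_lift_unique * Suc step by blast+
  then show ?case using *(3) by (simp add: algebra_simps)
qed

text \<open>Near \<open>1\<close> the phase stays within distance 1 of \<open>phase 1\<close>, so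
  the principal argument of their quotient is a lift with values between \<open>- pi / 2\<close> and
  \<open>pi / 2\<close>.\<close>

lemma phase_lift_local:
  obtains r where "r > 0"
    "\<And>q. nu (q - 1) < r \<Longrightarrow> indep 1 q \<Longrightarrow> \<exists>d. phase_lift 1 q d \<and> \<bar>d\<bar> \<le> pi"
proof -
  obtain r where r: "r > 0" "\<And>q. q \<noteq> 0 \<Longrightarrow> nu (q - 1) < r \<Longrightarrow> cmod (phase q - phase 1) < 1"
    using phase_continuous[of 1 1] by auto
  obtain z where z: "z \<in> log_scalars 1" using log_scalars_nonempty by blast
  have "\<exists>d. phase_lift 1 q d \<and> \<bar>d\<bar> \<le> pi" if q: "nu (q - 1) < r" and ind: "indep 1 q" for q
  proof -
    define u where "u t = smult (of_real (1 - t)) 1 + smult (of_real t) q" for t :: real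
    have nz: "u t \<noteq> 0" for t
      unfolding u_def by (rule indep_segment[OF ind])
    have phase1: "cnj (phase 1) * phase 1 = 1"
      by (metis complex_norm_square mult.commute norm_phase of_real_1 power_one)
    have near: "cmod (cnj (phase 1) * phase (u t) - 1) < 1" if t: "0 \<le> t" "t \<le> 1" for t
    proof -
      have "u t - 1 = smult (of_real t) (q - 1)"
        by (simp add: u_def smult_diff_left smult_diff_right one_pCons)
      then have "nu (u t - 1) \<le> 1 * nu (q - 1)"
        using t by (simp only: hom) (intro mult_right_mono, auto)
      then have "cmod (phase (u t) - phase 1) < 1" using r(2) nz q by auto
      moreover have "cnj (phase 1) * phase (u t) - 1 = cnj (phase 1) * (phase (u t) - phase 1)"
        using phase1 by (simp add: algebra_simps)
      ultimately show ?thesis by (simp add: norm_mult)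
    qed
    have Re_pos: "Re (cnj (phase 1) * phase (u t)) > 0" if "0 \<le> t" "t \<le> 1" for t
      using near[OF that] abs_Re_le_cmod[of "cnj (phase 1) * phase (u t) - 1"] by simp
    define \<psi> where "\<psi> t = 2 * pi * \<phi> z + Im (Ln (cnj (phase 1) * phase (u t)))" for t
    have "phase_lift 1 q (\<psi> 1 - \<psi> 0)"
    proof (rule phase_liftI[OF _ _ refl])
      have "continuous_on {0..1} (\<lambda>t. phase (smult (of_real (1 - t)) 1 + smult (of_real t) q + smult 0 0))"
        using nz unfolding u_def by (intro phase_comp_continuous continuous_intros) simp_all
      then have "continuous_on {0..1} (\<lambda>t. phase (u t))" by (simp add: u_def)
      then show "continuous_on {0..1} \<psi>"
        unfolding \<psi>_def using Re_pos
        by (intro continuous_intros) (auto simp: complex_nonpos_Reals_iff not_le)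
    next
      fix t :: real assume t: "0 \<le> t" "t \<le> 1"
      let ?v = "cnj (phase 1) * phase (u t)"
      have v: "cmod ?v = 1" by (simp add: norm_mult)
      then have "?v \<noteq> 0" by auto
      then have "Re (Ln ?v) = 0" using v by simp
      then have "Ln ?v = \<i> * of_real (Im (Ln ?v))" by (simp add: complex_eq_iff)
      then have "?v = cis (Im (Ln ?v))" using \<open>?v \<noteq> 0\<close> by (metis cis_conv_exp exp_Ln)
      moreover have "phase (u t) = phase 1 * ?v"
        using phase1 by (simp add: mult.assoc mult.commute mult.left_commute)
      ultimately have "phase (u t) = cis (2 * pi * \<phi> z) * cis (Im (Ln ?v))"
        using phase_eq[OF _ z] by (metis one_neq_zero)
      then show "phase (smult (of_real (1 - t)) 1 + smult (of_real t) q) = cis (\<psi> t)"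
        unfolding u_def[symmetric] \<psi>_def by (simp add: cis_mult)
    qed
    moreover have "\<bar>\<psi> 1 - \<psi> 0\<bar> \<le> pi"
      using Re_Ln_pos_lt_imp[OF Re_pos[of 0]] Re_Ln_pos_lt_imp[OF Re_pos[of 1]] by (simp add: \<psi>_def)
    ultimately show ?thesis by blast
  qed
  with r(1) that show thesis by blast
qed

lemma \<phi>_eq_0:
  assumes nu1: "nu 1 > 0"
  shows "\<phi> z = 0"
proof (rule ccontr)
  assume "\<phi> z \<noteq> 0"
  define \<kappa> where "\<kappa> = 2 * pi * \<phi> 1"
  have "\<kappa> \<noteq> 0" using \<open>\<phi> z \<noteq> 0\<close> \<phi>_eq[of z] by (auto simp: \<kappa>_def)
  have ind1: "indep 1 (monom 1 (Suc n))" for n using indep_monom[of 0 "Suc n"] by simp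
  obtain \<delta> where \<delta>: "phase_lift 1 (monom 1 1) \<delta>"
    using phase_lift_exists[OF ind1[of 0]] by auto
  obtain r where r: "r > 0" "\<And>q. nu (q - 1) < r \<Longrightarrow> indep 1 q \<Longrightarrow> \<exists>d. phase_lift 1 q d \<and> \<bar>d\<bar> \<le> pi"
    using phase_lift_local by blast
  define B where "B = \<bar>ln a\<bar> + \<bar>ln b\<bar>"
  have lnB: "\<bar>ln (cmod \<gamma>)\<bar> \<le> B" if "\<gamma> \<in> \<Gamma> - {0}" for \<gamma>
  proof -
    have "ln a \<le> ln (cmod \<gamma>)" "ln (cmod \<gamma>) \<le> ln b"
      using annulus[OF that] a_pos that by auto
    then show ?thesis by (simp add: B_def)
  qed
  \<comment> \<open>A scaled monomial close to \<open>exp x\<close> becomes, after division by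
    \<open>exp x\<close>, some \<open>smult c (monom 1 n)\<close> close to \<open>1\<close>. Its
    lift from \<open>1\<close> is computed from \<open>\<delta>\<close> and
    \<open>ln (cmod c)\<close>, and bounded by \<open>pi\<close> locally. The precision
    \<open>r\<close> serves the local bound, and \<open>nu 1 / 2\<close> excludes
    \<open>n = 0\<close>.\<close>
  have key: "\<exists>n. \<bar>of_nat (Suc n) * \<delta> + \<kappa> * x\<bar> \<le> pi + \<bar>\<kappa>\<bar> * B" if x: "\<bar>x\<bar> > B + 1" for x
  proof -
    let ?e = "complex_of_real (exp x)"
    have "exp x * min r (nu 1 / 2) > 0" using r(1) nu1 by simp
    then obtain \<gamma> n where \<gamma>: "\<gamma> \<in> \<Gamma> - {0}" "nu ([:?e:] - monom \<gamma> n) < exp x * min r (nu 1 / 2)"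
      using approx_nonzero by blast
    define c where "c = \<gamma> / ?e"
    have c: "c \<noteq> 0" "ln (cmod c) = ln (cmod \<gamma>) - x"
      using \<gamma>(1) by (auto simp: c_def norm_divide ln_div)
    have "[:?e:] - monom \<gamma> n = smult ?e (1 - smult c (monom 1 n))"
      by (simp add: c_def smult_diff_right smult_monom one_pCons)
    then have "exp x * nu (smult c (monom 1 n) - 1) < exp x * min r (nu 1 / 2)"
      using \<gamma>(2) nu_diff_commute[of 1] by (simp add: hom)
    then have near: "nu (smult c (monom 1 n) - 1) < min r (nu 1 / 2)" by simp
    \<comment> \<open>For \<open>n = 0\<close> the scalar \<open>c\<close> would be within
      \<open>1 / 2\<close> of 1, whereas the size of \<open>x\<close> keeps
      \<open>ln (cmod c)\<close> at distance more than 1 from 0.\<close>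
    have "n \<noteq> 0"
    proof
      assume "n = 0"
      then have "cmod (c - 1) * nu 1 < (1 / 2) * nu 1"
        using near hom[of "c - 1" 1] by (simp add: smult_diff_left one_pCons)
      then have "cmod (c - 1) < 1 / 2" by (rule mult_right_less_imp_less) simp
      then have "\<bar>cmod c - 1\<bar> < 1 / 2" using norm_triangle_ineq3[of c 1] by simp
      then have "1 / 2 < cmod c" "cmod c < 3 / 2" by linarith+
      have "exp (1::real) \<ge> 2" using exp_ge_add_one_self[of 1] by simp
      then have "exp (- 1 :: real) \<le> 1 / 2" by (simp add: exp_minus field_simps)
      then have "exp (- 1) < cmod c" "cmod c < exp 1"
        using \<open>1 / 2 < cmod c\<close> \<open>cmod c < 3 / 2\<close> \<open>exp 1 \<ge> 2\<close> by linarith+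
      then have "- 1 < ln (cmod c)" "ln (cmod c) < 1"
        using c(1) by (metis exp_less_cancel_iff exp_ln zero_less_norm_iff)+
      then have "\<bar>ln (cmod c)\<bar> < 1" by linarith
      then show False using x lnB[OF \<gamma>(1)] c(2) by linarith
    qed
    then obtain m where m: "n = Suc m" by (cases n) auto
    have "phase_lift 1 (smult c (monom 1 n)) (of_nat (Suc m) * \<delta> - \<kappa> * ln (cmod c))"
      unfolding m \<kappa>_def using phase_lift_dilate[OF ind1 c(1) phase_lift_monom[OF \<delta>]] by simp
    moreover have "\<exists>d. phase_lift 1 (smult c (monom 1 n)) d \<and> \<bar>d\<bar> \<le> pi"
      using near ind1 c(1) m by (intro r(2) indep_smult) auto
    ultimately have "\<bar>of_nat (Suc m) * \<delta> - \<kappa> * ln (cmod c)\<bar> \<le> pi"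
      using phase_lift_unique by blast
    then have "\<bar>of_nat (Suc m) * \<delta> + \<kappa> * x - \<kappa> * ln (cmod \<gamma>)\<bar> \<le> pi"
      by (simp add: c(2) algebra_simps)
    moreover have "\<bar>\<kappa> * ln (cmod \<gamma>)\<bar> \<le> \<bar>\<kappa>\<bar> * B"
      unfolding abs_mult using lnB[OF \<gamma>(1)] by (intro mult_left_mono) auto
    ultimately show ?thesis by (intro exI[of _ m]) linarith
  qed
  define M where "M = B + 2 + (pi + \<bar>\<kappa>\<bar> * B) / \<bar>\<kappa>\<bar>"
  have "B \<ge> 0" by (simp add: B_def)
  have M: "M > B + 1" "\<bar>\<kappa>\<bar> * M > pi + \<bar>\<kappa>\<bar> * B"
  proof -
    have "(pi + \<bar>\<kappa>\<bar> * B) / \<bar>\<kappa>\<bar> \<ge> 0" using \<open>B \<ge> 0\<close> by (intro divide_nonneg_nonneg add_nonneg_nonneg) auto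
    then show "M > B + 1" unfolding M_def by linarith
    have "\<bar>\<kappa>\<bar> * M = \<bar>\<kappa>\<bar> * (B + 2) + (pi + \<bar>\<kappa>\<bar> * B)"
      using \<open>\<kappa> \<noteq> 0\<close> by (simp add: M_def distrib_left)
    moreover have "\<bar>\<kappa>\<bar> * (B + 2) > 0" using \<open>\<kappa> \<noteq> 0\<close> \<open>B \<ge> 0\<close> by simp
    ultimately show "\<bar>\<kappa>\<bar> * M > pi + \<bar>\<kappa>\<bar> * B" by linarith
  qed
  \<comment> \<open>The sign is chosen so that the two summands in \<open>key\<close> never cancel,
    whatever \<open>n\<close> is; then \<open>\<bar>\<kappa>\<bar> * M\<close> is already too
    large.\<close>
  define x where "x = (if \<delta> * \<kappa> \<ge> 0 then M else - M)"
  have "M > 0" using M \<open>B \<ge> 0\<close> by linarith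
  have "\<bar>x\<bar> > B + 1" using M \<open>M > 0\<close> by (auto simp: x_def)
  then obtain n where n: "\<bar>of_nat (Suc n) * \<delta> + \<kappa> * x\<bar> \<le> pi + \<bar>\<kappa>\<bar> * B"
    using key by blast
  have "0 \<le> (of_nat (Suc n) * \<delta>) * (\<kappa> * x)"
  proof -
    have "0 \<le> (\<delta> * \<kappa>) * x" unfolding x_def using \<open>M > 0\<close> by (simp add: mult_nonneg_nonneg mult_nonpos_nonneg)
    then have "0 \<le> of_nat (Suc n) * ((\<delta> * \<kappa>) * x)" by (rule mult_nonneg_nonneg[OF of_nat_0_le_iff])
    then show ?thesis by (simp only: mult_ac)
  qed
  moreover have "\<bar>v\<bar> \<le> \<bar>u + v\<bar>" if "0 \<le> u * v" for u v :: real
    using that by (auto simp: zero_le_mult_iff)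
  ultimately have "\<bar>of_nat (Suc n) * \<delta> + \<kappa> * x\<bar> \<ge> \<bar>\<kappa> * x\<bar>" by blast
  moreover have "\<bar>\<kappa> * x\<bar> = \<bar>\<kappa>\<bar> * M" using \<open>M > 0\<close> by (simp add: x_def abs_mult)
  ultimately show False using n M by linarith
qed

end

theorem orbit_dense: "p \<in> orbit_closure"
proof (cases "nu 1 = 0 \<or> log_return = UNIV")
  case True
  then show ?thesis using nu_1_eq_0_imp_dense log_return_UNIV_imp_dense by blast
next
  case False
  have zero: "0 \<in> log_return" using one_mem_orbit_closure by (simp add: log_scalars_def one_pCons)
  \<comment> \<open>The period of the exponential is the imaginary element required by
    \<open>complex_subgroup_functional\<close>.\<close>
  have "\<i> * of_real (2 * pi) \<in> log_return"
    using one_mem_orbit_closure by (simp add: log_scalars_def one_pCons mult.commute)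
  then obtain \<phi> :: "complex \<Rightarrow> real" where "bounded_linear \<phi>" "\<exists>z. \<phi> z \<noteq> 0" "\<forall>z\<in>log_return. \<phi> z \<in> \<int>"
    using complex_subgroup_functional[OF zero log_return_diff closed_log_scalars, of "2 * pi"] False
    by auto
  moreover have "nu 1 > 0" using False nu_nonneg[of 1] by linarith
  ultimately show ?thesis using \<phi>_eq_0 by blast
qed

end

section \<open>Sufficiency\<close>

lemma carrier_complex_field [simp]: "a \<in> carrier complex_field"
  by (simp add: ring_of_type_algebra_def)

context complex_normed_space
begin

section \<open>Arithmetic and density in a complex normed space\<close>

lemma smult_r_distr_complex:
  "x \<in> carrier V \<Longrightarrow> y \<in> carrier V \<Longrightarrow> c \<odot>\<^bsub>V\<^esub> (x \<oplus>\<^bsub>V\<^esub> y) = c \<odot>\<^bsub>V\<^esub> x \<oplus>\<^bsub>V\<^esub> c \<odot>\<^bsub>V\<^esub> y"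
  by (rule smult_r_distr) simp_all

lemma smult_assoc_complex: "x \<in> carrier V \<Longrightarrow> (a * b) \<odot>\<^bsub>V\<^esub> x = a \<odot>\<^bsub>V\<^esub> (b \<odot>\<^bsub>V\<^esub> x)"
  using smult_assoc1[of a b x] by (simp add: ring_of_type_algebra_def)

lemma norm_diff_triangle:
  assumes "x \<in> carrier V" "y \<in> carrier V" "z \<in> carrier V"
  shows "N (x \<ominus>\<^bsub>V\<^esub> z) \<le> N (x \<ominus>\<^bsub>V\<^esub> y) + N (y \<ominus>\<^bsub>V\<^esub> z)"
  using Metric_space.triangle[OF Metric_space_norm_dist assms] assms by (simp add: norm_dist_def)

lemma smult_diff_complex:
  assumes "x \<in> carrier V" "y \<in> carrier V"
  shows "c \<odot>\<^bsub>V\<^esub> (x \<ominus>\<^bsub>V\<^esub> y) = c \<odot>\<^bsub>V\<^esub> x \<ominus>\<^bsub>V\<^esub> c \<odot>\<^bsub>V\<^esub> y"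
proof -
  have "c \<odot>\<^bsub>V\<^esub> (x \<ominus>\<^bsub>V\<^esub> y) \<oplus>\<^bsub>V\<^esub> c \<odot>\<^bsub>V\<^esub> y = c \<odot>\<^bsub>V\<^esub> (x \<ominus>\<^bsub>V\<^esub> y \<oplus>\<^bsub>V\<^esub> y)"
    using assms by (simp add: smult_r_distr_complex)
  also have "x \<ominus>\<^bsub>V\<^esub> y \<oplus>\<^bsub>V\<^esub> y = x"
    using assms by (simp add: M.minus_eq M.a_assoc M.l_neg)
  finally have "c \<odot>\<^bsub>V\<^esub> x = c \<odot>\<^bsub>V\<^esub> (x \<ominus>\<^bsub>V\<^esub> y) \<oplus>\<^bsub>V\<^esub> c \<odot>\<^bsub>V\<^esub> y" ..
  then show ?thesis
    using assms smult_closed_complex by (simp add: M.minus_eq M.a_assoc M.r_neg)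
qed

lemma norm_closure_eq_carrier_iff:
  assumes "S \<subseteq> carrier V"
  shows "norm_closure V N S = carrier V \<longleftrightarrow>
    (\<forall>y\<in>carrier V. \<forall>e>0. \<exists>s\<in>S. N (y \<ominus>\<^bsub>V\<^esub> s) < e)"
proof -
  interpret Metric_space "carrier V" "norm_dist V N" by (rule Metric_space_norm_dist)
  have cl: "norm_closure V N S = {y \<in> carrier V. \<forall>e>0. \<exists>s\<in>S. s \<in> mball y e}"
    by (simp add: norm_closure_def metric_closure_of)
  have "s \<in> mball y e \<longleftrightarrow> N (y \<ominus>\<^bsub>V\<^esub> s) < e" if "y \<in> carrier V" "s \<in> S" for y s e
    using that assms by (auto simp: norm_dist_def)
  then have "y \<in> norm_closure V N S \<longleftrightarrow> (\<forall>e>0. \<exists>s\<in>S. N (y \<ominus>\<^bsub>V\<^esub> s) < e)" if "y \<in> carrier V" for y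
    using that unfolding cl by blast
  moreover have "norm_closure V N S \<subseteq> carrier V"
    unfolding cl by blast
  ultimately show ?thesis by blast
qed

end

locale complex_normed_operator = complex_normed_space +
  fixes T x
  assumes T: "bounded_operator V N T" and x: "x \<in> carrier V"
begin

lemma T_closed [simp]: "v \<in> carrier V \<Longrightarrow> T v \<in> carrier V"
  using T by (auto simp: bounded_operator_def)

lemma T_add: "v \<in> carrier V \<Longrightarrow> w \<in> carrier V \<Longrightarrow> T (v \<oplus>\<^bsub>V\<^esub> w) = T v \<oplus>\<^bsub>V\<^esub> T w"
  using T by (auto simp: bounded_operator_def)

lemma T_smult: "v \<in> carrier V \<Longrightarrow> T (c \<odot>\<^bsub>V\<^esub> v) = c \<odot>\<^bsub>V\<^esub> T v"
  using T by (auto simp: bounded_operator_def)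

lemma T_zero: "T \<zero>\<^bsub>V\<^esub> = \<zero>\<^bsub>V\<^esub>"
  using T_smult[of "\<zero>\<^bsub>V\<^esub>" 0] smult_zero_complex by simp

lemma T_pow_closed [simp]: "v \<in> carrier V \<Longrightarrow> (T ^^ n) v \<in> carrier V"
  by (induction n) auto

lemma scaled_orbit_subset: "scaled_orbit V \<Gamma> x T \<subseteq> carrier V"
  using x smult_closed_complex by (auto simp: scaled_orbit_def)

lemma scaled_orbit_dense_iff:
  "norm_closure V N (scaled_orbit V \<Gamma> x T) = carrier V \<longleftrightarrow>
    (\<forall>y\<in>carrier V. \<forall>e>0. \<exists>\<gamma>\<in>\<Gamma>. \<exists>n. N (y \<ominus>\<^bsub>V\<^esub> \<gamma> \<odot>\<^bsub>V\<^esub> (T ^^ n) x) < e)"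
proof -
  have "(\<exists>s\<in>scaled_orbit V \<Gamma> x T. P s) \<longleftrightarrow> (\<exists>\<gamma>\<in>\<Gamma>. \<exists>n. P (\<gamma> \<odot>\<^bsub>V\<^esub> (T ^^ n) x))" for P
    unfolding scaled_orbit_def by blast
  then show ?thesis
    by (simp only: norm_closure_eq_carrier_iff[OF scaled_orbit_subset])
qed

lemma hypercyclic_vector_iff:
  "hypercyclic_vector V N T x \<longleftrightarrow>
    (\<forall>y\<in>carrier V. \<forall>e>0. \<exists>n. N (y \<ominus>\<^bsub>V\<^esub> (T ^^ n) x) < e)"
proof -
  have "{(T ^^ n) x |n. True} \<subseteq> carrier V"
    using x by auto
  moreover have "(\<exists>s\<in>{(T ^^ n) x |n. True}. P s) \<longleftrightarrow> (\<exists>n. P ((T ^^ n) x))" for P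
    by blast
  ultimately show ?thesis
    by (simp only: hypercyclic_vector_def norm_closure_eq_carrier_iff)
qed

text \<open>This is \<open>p(T) x\<close>, evaluated by Horner's scheme.\<close>

definition poly_orbit :: "complex poly \<Rightarrow> 'a"
  where "poly_orbit p = fold_coeffs (\<lambda>a v. a \<odot>\<^bsub>V\<^esub> x \<oplus>\<^bsub>V\<^esub> T v) p \<zero>\<^bsub>V\<^esub>"

lemma poly_orbit_0 [simp]: "poly_orbit 0 = \<zero>\<^bsub>V\<^esub>"
  by (simp add: poly_orbit_def)

lemma poly_orbit_pCons: "poly_orbit (pCons a p) = a \<odot>\<^bsub>V\<^esub> x \<oplus>\<^bsub>V\<^esub> T (poly_orbit p)"
proof (cases "a = 0 \<and> p = 0")
  case True
  then show ?thesis using x by (simp add: smult_zero_complex T_zero)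
next
  case False
  then show ?thesis by (auto simp: poly_orbit_def)
qed

lemma poly_orbit_closed [simp]: "poly_orbit p \<in> carrier V"
  by (induction p) (use x in \<open>auto simp: poly_orbit_pCons smult_closed_complex\<close>)

lemma poly_orbit_add: "poly_orbit (p + q) = poly_orbit p \<oplus>\<^bsub>V\<^esub> poly_orbit q"
proof (induction p arbitrary: q)
  case (pCons a p)
  obtain b r where q: "q = pCons b r" by (rule pCons_cases)
  have "poly_orbit (pCons a p + q) = (a \<odot>\<^bsub>V\<^esub> x \<oplus>\<^bsub>V\<^esub> b \<odot>\<^bsub>V\<^esub> x) \<oplus>\<^bsub>V\<^esub> (T (poly_orbit p) \<oplus>\<^bsub>V\<^esub> T (poly_orbit r))"
    using x by (simp add: q poly_orbit_pCons pCons.IH T_add smult_add_complex)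
  then show ?case
    using x by (simp add: q poly_orbit_pCons smult_closed_complex M.a_ac)
qed simp

lemma poly_orbit_smult: "poly_orbit (smult c p) = c \<odot>\<^bsub>V\<^esub> poly_orbit p"
proof (induction p)
  case 0
  have "N (c \<odot>\<^bsub>V\<^esub> \<zero>\<^bsub>V\<^esub>) = 0"
    by (simp add: norm_smult norm_zero)
  then show ?case using norm_eq_zero[OF smult_closed_complex[OF M.zero_closed]] by simp
next
  case (pCons a p)
  then show ?case
    using x by (simp add: poly_orbit_pCons T_smult smult_r_distr_complex smult_assoc_complex smult_closed_complex)
qed

lemma poly_orbit_diff: "poly_orbit (p - q) = poly_orbit p \<ominus>\<^bsub>V\<^esub> poly_orbit q"
proof -
  have "poly_orbit p = poly_orbit (p - q) \<oplus>\<^bsub>V\<^esub> poly_orbit q"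
    using poly_orbit_add[of "p - q" q] by simp
  then show ?thesis by (simp add: M.minus_eq M.a_assoc M.r_neg)
qed

lemma poly_orbit_monom: "poly_orbit (Polynomial.monom c n) = c \<odot>\<^bsub>V\<^esub> (T ^^ n) x"
proof (induction n)
  case 0
  then show ?case using x by (simp add: monom_0 poly_orbit_pCons T_zero smult_closed_complex)
next
  case (Suc n)
  then show ?case
    using x by (simp add: monom_Suc poly_orbit_pCons smult_zero_complex T_smult smult_closed_complex)
qed

text \<open>Dilation by the fixed nonzero \<open>\<gamma>\<close> preserves density.\<close>

lemma hypercyclic_imp_scaled_orbit_dense:
  assumes hc: "hypercyclic_vector V N T x" and \<gamma>: "\<gamma> \<in> \<Gamma> - {0}"
  shows "norm_closure V N (scaled_orbit V \<Gamma> x T) = carrier V"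
  unfolding scaled_orbit_dense_iff
proof (intro ballI allI impI)
  fix y e assume y: "y \<in> carrier V" and e: "0 < (e :: real)"
  have "(1 / \<gamma>) \<odot>\<^bsub>V\<^esub> y \<in> carrier V" "0 < e / cmod \<gamma>"
    using \<gamma> e y smult_closed_complex by auto
  then obtain n where n: "N ((1 / \<gamma>) \<odot>\<^bsub>V\<^esub> y \<ominus>\<^bsub>V\<^esub> (T ^^ n) x) < e / cmod \<gamma>"
    using hc unfolding hypercyclic_vector_iff by blast
  have "y = \<gamma> \<odot>\<^bsub>V\<^esub> ((1 / \<gamma>) \<odot>\<^bsub>V\<^esub> y)"
    using \<gamma> y smult_assoc_complex[of y \<gamma> "1 / \<gamma>"] smult_one_complex[of y] by simp
  then have "y \<ominus>\<^bsub>V\<^esub> \<gamma> \<odot>\<^bsub>V\<^esub> (T ^^ n) x = \<gamma> \<odot>\<^bsub>V\<^esub> ((1 / \<gamma>) \<odot>\<^bsub>V\<^esub> y \<ominus>\<^bsub>V\<^esub> (T ^^ n) x)"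
    using x y by (simp add: smult_diff_complex smult_closed_complex)
  then have "N (y \<ominus>\<^bsub>V\<^esub> \<gamma> \<odot>\<^bsub>V\<^esub> (T ^^ n) x) = cmod \<gamma> * N ((1 / \<gamma>) \<odot>\<^bsub>V\<^esub> y \<ominus>\<^bsub>V\<^esub> (T ^^ n) x)"
    using x y by (simp add: norm_smult smult_closed_complex)
  also have "\<dots> < e" using n \<gamma> by (simp add: field_simps)
  finally show "\<exists>\<gamma>\<in>\<Gamma>. \<exists>n. N (y \<ominus>\<^bsub>V\<^esub> \<gamma> \<odot>\<^bsub>V\<^esub> (T ^^ n) x) < e"
    using \<gamma> by blast
qed

text \<open>Any vector is close to some \<open>\<gamma> T^n x\<close>, and this polynomial vector
  lies in the closure of the orbit by \<open>orbit_dense\<close>.\<close>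

lemma scaled_orbit_dense_imp_hypercyclic:
  assumes dense: "norm_closure V N (scaled_orbit V \<Gamma> x T) = carrier V"
    and \<Gamma>: "\<Gamma> - {0} \<noteq> {}" "bounded (\<Gamma> - {0})" "bounded_away_from_0 (\<Gamma> - {0})"
  shows "hypercyclic_vector V N T x"
proof -
  obtain K where K: "\<And>v. v \<in> carrier V \<Longrightarrow> N (T v) \<le> K * N v"
    using T unfolding bounded_operator_def by blast
  obtain a where a: "a > 0" "\<And>\<gamma>. \<gamma> \<in> \<Gamma> - {0} \<Longrightarrow> a \<le> cmod \<gamma>"
    using \<Gamma>(3) unfolding bounded_away_from_0_def by blast
  obtain b where b: "\<And>\<gamma>. \<gamma> \<in> \<Gamma> - {0} \<Longrightarrow> cmod \<gamma> \<le> b"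
    using \<Gamma>(2) unfolding bounded_iff by blast
  interpret S: scaled_orbit_seminorm "\<lambda>p. N (poly_orbit p)" K a b \<Gamma>
  proof
    show "N (poly_orbit (p + q)) \<le> N (poly_orbit p) + N (poly_orbit q)" for p q
      by (simp add: poly_orbit_add norm_triangle)
    show "N (poly_orbit (smult c p)) = cmod c * N (poly_orbit p)" for c p
      by (simp add: poly_orbit_smult norm_smult)
    show "N (poly_orbit (pCons 0 p)) \<le> K * N (poly_orbit p)" for p
      using x K by (simp add: poly_orbit_pCons smult_zero_complex)
    show "\<exists>\<gamma>\<in>\<Gamma>. \<exists>n. N (poly_orbit (p - Polynomial.monom \<gamma> n)) < e" if "0 < e" for e p
      using dense that unfolding scaled_orbit_dense_iff
      by (simp add: poly_orbit_diff poly_orbit_monom)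
  qed (use a b \<Gamma> in auto)
  show ?thesis
    unfolding hypercyclic_vector_iff
  proof (intro ballI allI impI)
    fix y e assume y: "y \<in> carrier V" and e: "0 < (e :: real)"
    obtain \<gamma> n where \<gamma>: "N (y \<ominus>\<^bsub>V\<^esub> poly_orbit (Polynomial.monom \<gamma> n)) < e / 2"
      using dense y e unfolding scaled_orbit_dense_iff poly_orbit_monom by (meson half_gt_zero)
    obtain m where m: "N (poly_orbit (Polynomial.monom \<gamma> n - Polynomial.monom 1 m)) < e / 2"
      using S.orbit_dense[of "Polynomial.monom \<gamma> n"] half_gt_zero[OF e]
      unfolding S.orbit_closure_def mem_Collect_eq by blast
    have "(T ^^ m) x = poly_orbit (Polynomial.monom 1 m)"
      using x by (simp add: poly_orbit_monom smult_one_complex)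
    then have "N (y \<ominus>\<^bsub>V\<^esub> (T ^^ m) x) < e"
      using norm_diff_triangle[OF y, of "poly_orbit (Polynomial.monom \<gamma> n)" "poly_orbit (Polynomial.monom 1 m)"] \<gamma> m
      by (simp add: poly_orbit_diff)
    then show "\<exists>n. N (y \<ominus>\<^bsub>V\<^esub> (T ^^ n) x) < e" by blast
  qed
qed

end

proposition bounded_annulus_imp_hypercyclic_scalar_set:
  assumes "\<Gamma> - {0} \<noteq> {}" "bounded (\<Gamma> - {0})" "bounded_away_from_0 (\<Gamma> - {0})"
  shows "hypercyclic_scalar_set TYPE('a) \<Gamma>"
  unfolding hypercyclic_scalar_set_def
proof (intro allI impI)
  fix V :: "(complex, 'a) module" and N T x
  assume "complex_banach_space V N" "bounded_operator V N T" "x \<in> carrier V"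
  then interpret complex_normed_operator V N T x
    by (simp add: complex_banach_space_def complex_normed_operator_def complex_normed_operator_axioms_def)
  show "norm_closure V N (scaled_orbit V \<Gamma> x T) = carrier V \<longleftrightarrow> hypercyclic_vector V N T x"
    using scaled_orbit_dense_imp_hypercyclic[OF _ assms] hypercyclic_imp_scaled_orbit_dense assms(1)
    by blast
qed

section \<open>The space of null sequences\<close>

type_synonym cseq = "int \<Rightarrow>\<^sub>C complex"

text \<open>One construction for scalar multiplication (constant weight, \<open>k = 0\<close>) and
  for all weighted shifts. A bound on \<open>m\<close> ensures that the function lies in
  \<open>bcontfun\<close>.\<close>

definition weight_map :: "(int \<Rightarrow> complex) \<Rightarrow> int \<Rightarrow> cseq \<Rightarrow> cseq"
  where "weight_map m k f = Bcontfun (\<lambda>i. m i * apply_bcontfun f (i + k))"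

lemma apply_weight_map:
  assumes "\<And>i. cmod (m i) \<le> B"
  shows "apply_bcontfun (weight_map m k f) i = m i * apply_bcontfun f (i + k)"
proof -
  have "cmod (m i * apply_bcontfun f (i + k)) \<le> B * norm f" for i
    unfolding norm_mult using assms norm_bounded order_trans[OF norm_ge_zero assms]
    by (intro mult_mono) auto
  then have "(\<lambda>i. m i * apply_bcontfun f (i + k)) \<in> bcontfun"
    by (intro bcontfun_normI) auto
  then show ?thesis by (simp add: weight_map_def Bcontfun_inverse)
qed

definition scaleC :: "complex \<Rightarrow> cseq \<Rightarrow> cseq"
  where "scaleC c = weight_map (\<lambda>_. c) 0"

lemma apply_scaleC [simp]: "apply_bcontfun (scaleC c f) i = c * apply_bcontfun f i"
  unfolding scaleC_def by (subst apply_weight_map[of _ "cmod c"]) auto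

lemma scaleC_distrib:
  "scaleC c (f + g) = scaleC c f + scaleC c g" "scaleC (a + b) f = scaleC a f + scaleC b f"
  "scaleC c (f - g) = scaleC c f - scaleC c g" "scaleC (a * b) f = scaleC a (scaleC b f)" "scaleC 1 f = f"
  by (auto intro!: bcontfun_eqI simp: algebra_simps)

lemma norm_scaleC [simp]: "norm (scaleC c f) = cmod c * norm f"
proof (rule antisym)
  have le: "norm (scaleC c f) \<le> cmod c * norm f" for c f
    by (rule norm_bound) (simp add: norm_mult mult_left_mono norm_bounded)
  show "norm (scaleC c f) \<le> cmod c * norm f" by (rule le)
  show "cmod c * norm f \<le> norm (scaleC c f)"
  proof (cases "c = 0")
    case False
    then have "f = scaleC (1 / c) (scaleC c f)"
      by (auto intro!: bcontfun_eqI)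
    then have "norm f \<le> cmod (1 / c) * norm (scaleC c f)" using le by metis
    then show ?thesis using False by (simp add: norm_divide field_simps)
  qed simp
qed

text \<open>Convergence to 0 at both ends of the integers, phrased by finite superlevel
  sets.\<close>

definition c0 :: "cseq set"
  where "c0 = {f. \<forall>e>0. finite {i. e \<le> cmod (apply_bcontfun f i)}}"

lemma c0_finite: "f \<in> c0 \<Longrightarrow> 0 < e \<Longrightarrow> finite {i. e \<le> cmod (apply_bcontfun f i)}"
  by (simp add: c0_def)

text \<open>The library proves \<open>bcontfun\<close> complete only over a metric domain, and \<open>int\<close> carries no metric.\<close>

lemma Cauchy_cseq_convergent:
  fixes F :: "nat \<Rightarrow> cseq"
  assumes "Cauchy F"
  shows "convergent F"
proof -
  obtain l where l: "uniform_limit UNIV F l sequentially"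
    using assms uniformly_convergent_eq_cauchy[of "\<lambda>_. True" F]
    unfolding Cauchy_def uniform_limit_sequentially_iff by (metis dist_fun_lt_imp_dist_val_lt)
  obtain l' where "F \<longlonglongrightarrow> l'"
    using uniform_limit_bcontfunE[OF l sequentially_bot] by metis
  then show ?thesis by (rule convergentI)
qed

lemma c0_add:
  assumes "f \<in> c0" "g \<in> c0"
  shows "f + g \<in> c0"
  unfolding c0_def
proof (intro CollectI allI impI)
  fix e :: real assume e: "e > 0"
  have "{i. e \<le> cmod (apply_bcontfun (f + g) i)} \<subseteq>
      {i. e / 2 \<le> cmod (apply_bcontfun f i)} \<union> {i. e / 2 \<le> cmod (apply_bcontfun g i)}"
  proof
    fix i assume "i \<in> {i. e \<le> cmod (apply_bcontfun (f + g) i)}"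
    then have "e \<le> cmod (apply_bcontfun f i) + cmod (apply_bcontfun g i)"
      using norm_triangle_ineq[of "apply_bcontfun f i" "apply_bcontfun g i"] by simp
    then show "i \<in> {i. e / 2 \<le> cmod (apply_bcontfun f i)} \<union> {i. e / 2 \<le> cmod (apply_bcontfun g i)}"
      by (simp, linarith)
  qed
  moreover have "finite \<dots>"
    using c0_finite[OF assms(1) half_gt_zero[OF e]] c0_finite[OF assms(2) half_gt_zero[OF e]] by blast
  ultimately show "finite {i. e \<le> cmod (apply_bcontfun (f + g) i)}" by (rule finite_subset)
qed

lemma c0_weight_map:
  assumes m: "\<And>i. cmod (m i) \<le> B" and f: "f \<in> c0"
  shows "weight_map m k f \<in> c0"
  unfolding c0_def
proof (intro CollectI allI impI)
  fix e :: real assume e: "e > 0"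
  have "B \<ge> 0" using m[of 0] norm_ge_zero order_trans by blast
  \<comment> \<open>\<open>B + 1\<close> replaces \<open>B\<close> because \<open>B\<close> may be
    0.\<close>
  have "finite ((\<lambda>i. i - k) ` {i. e / (B + 1) \<le> cmod (apply_bcontfun f i)})"
    using f e \<open>B \<ge> 0\<close> by (simp add: c0_def)
  moreover have "{i. e \<le> cmod (apply_bcontfun (weight_map m k f) i)} \<subseteq>
      (\<lambda>i. i - k) ` {i. e / (B + 1) \<le> cmod (apply_bcontfun f i)}"
  proof
    fix i assume "i \<in> {i. e \<le> cmod (apply_bcontfun (weight_map m k f) i)}"
    then have "e \<le> cmod (m i) * cmod (apply_bcontfun f (i + k))"
      by (simp add: apply_weight_map[OF m] norm_mult)
    also have "\<dots> \<le> (B + 1) * cmod (apply_bcontfun f (i + k))"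
      using m[of i] by (intro mult_right_mono) auto
    finally have "e / (B + 1) \<le> cmod (apply_bcontfun f (i + k))"
      using \<open>B \<ge> 0\<close> by (simp add: field_simps)
    then show "i \<in> (\<lambda>i. i - k) ` {i. e / (B + 1) \<le> cmod (apply_bcontfun f i)}"
      by (intro image_eqI[of _ _ "i + k"]) auto
  qed
  ultimately show "finite {i. e \<le> cmod (apply_bcontfun (weight_map m k f) i)}"
    by (rule rev_finite_subset)
qed

lemma c0_scaleC: "f \<in> c0 \<Longrightarrow> scaleC c f \<in> c0"
  unfolding scaleC_def by (rule c0_weight_map[of _ "cmod c"]) auto

lemma c0_zero: "0 \<in> c0"
  by (auto simp: c0_def)

lemma c0_diff:
  assumes "f \<in> c0" "g \<in> c0"
  shows "f - g \<in> c0"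
proof -
  have "f - g = f + scaleC (- 1) g" by (auto intro!: bcontfun_eqI)
  then show ?thesis using assms c0_add c0_scaleC by metis
qed

lemma closed_c0: "closed c0"
  unfolding closed_sequential_limits
proof (intro allI impI, elim conjE)
  fix F l assume F: "\<forall>n. F n \<in> c0" "F \<longlonglongrightarrow> l"
  show "l \<in> c0"
    unfolding c0_def
  proof (intro CollectI allI impI)
    fix e :: real assume e: "e > 0"
    then obtain n where n: "dist (F n) l < e / 2"
      using F(2) by (meson half_gt_zero metric_LIMSEQ_D order_refl)
    have "{i. e \<le> cmod (apply_bcontfun l i)} \<subseteq> {i. e / 2 \<le> cmod (apply_bcontfun (F n) i)}"
    proof
      fix i assume "i \<in> {i. e \<le> cmod (apply_bcontfun l i)}"
      moreover have "cmod (apply_bcontfun (F n) i - apply_bcontfun l i) < e / 2"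
        using dist_bounded[of "F n" i l] n by (simp add: dist_norm)
      ultimately show "i \<in> {i. e / 2 \<le> cmod (apply_bcontfun (F n) i)}"
        using norm_triangle_ineq2[of "apply_bcontfun l i" "apply_bcontfun (F n) i"]
        by (simp add: norm_minus_commute)
    qed
    moreover have "finite {i. e / 2 \<le> cmod (apply_bcontfun (F n) i)}"
      using F(1) c0_finite[OF _ half_gt_zero[OF e]] by blast
    ultimately show "finite {i. e \<le> cmod (apply_bcontfun l i)}" by (rule finite_subset)
  qed
qed

section \<open>Finitely supported sequences, separability and dimension\<close>

definition unit_seq :: "int \<Rightarrow> complex \<Rightarrow> cseq"
  where "unit_seq j c = Bcontfun (\<lambda>i. if i = j then c else 0)"

lemma apply_unit_seq [simp]: "apply_bcontfun (unit_seq j c) i = (if i = j then c else 0)"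
proof -
  have "(\<lambda>i. if i = j then c else 0) \<in> bcontfun"
    by (rule bcontfun_normI[of _ "cmod c"]) auto
  then show ?thesis by (simp add: unit_seq_def Bcontfun_inverse)
qed

lemma unit_seq_c0: "unit_seq j c \<in> c0"
proof -
  have "{i. e \<le> cmod (apply_bcontfun (unit_seq j c) i)} \<subseteq> {j}" if "0 < e" for e
    using that by (auto split: if_splits)
  then show ?thesis
    unfolding c0_def using finite_subset by blast
qed

text \<open>Lists give countability when the entries come from a countable set, and allow
  induction.\<close>

definition fin_seq :: "(int \<times> complex) list \<Rightarrow> cseq"
  where "fin_seq xs = sum_list (map (\<lambda>(j, c). unit_seq j c) xs)"

lemma fin_seq_Cons: "fin_seq ((j, c) # xs) = unit_seq j c + fin_seq xs"
  by (simp add: fin_seq_def)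

lemma fin_seq_c0: "fin_seq xs \<in> c0"
  by (induction xs) (auto simp: fin_seq_Cons c0_add unit_seq_c0 fin_seq_def[of "[]"] c0_zero)

lemma apply_fin_seq:
  assumes "distinct js"
  shows "apply_bcontfun (fin_seq (map (\<lambda>j. (j, d j)) js)) i = (if i \<in> set js then d i else 0)"
  using assms by (induction js) (auto simp: fin_seq_Cons fin_seq_def[of "[]"])

text \<open>The finitely many coordinates of modulus at least \<open>e / 2\<close> are rounded into
  a countable dense set \<open>D\<close>; the others are replaced by 0.\<close>

lemma c0_separable:
  obtains y :: "nat \<Rightarrow> cseq" where "\<And>n. \<exists>xs. y n = fin_seq xs"
    "\<And>f e. f \<in> c0 \<Longrightarrow> 0 < e \<Longrightarrow> \<exists>n. norm (f - y n) < e"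
proof -
  obtain D :: "complex set" where D: "countable D" "\<And>U. open U \<Longrightarrow> U \<noteq> {} \<Longrightarrow> \<exists>d\<in>D. d \<in> U"
    using countable_dense_setE by blast
  define Y where "Y = fin_seq ` lists (UNIV \<times> D)"
  have "countable Y"
    unfolding Y_def using D(1) by (intro countable_image countable_lists) simp
  have "Y \<noteq> {}" unfolding Y_def by auto
  have dense: "\<exists>g\<in>Y. norm (f - g) < e" if f: "f \<in> c0" and e: "0 < e" for f e
  proof -
    define F where "F = {i. e / 2 \<le> cmod (apply_bcontfun f i)}"
    have "finite F" unfolding F_def using c0_finite[OF f half_gt_zero[OF e]] .
    then obtain js where js: "set js = F" "distinct js" using finite_distinct_list by blast
    have "\<forall>z. \<exists>d\<in>D. d \<in> ball z (e / 2)" using e by (intro allI D(2)) auto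
    then obtain r where r: "\<And>z. r z \<in> D" "\<And>z. r z \<in> ball z (e / 2)" by metis
    define g where "g = fin_seq (map (\<lambda>j. (j, r (apply_bcontfun f j))) js)"
    have "g \<in> Y" unfolding g_def Y_def using r(1) by (intro imageI) auto
    moreover have "norm (f - g) \<le> e / 2"
    proof (rule norm_bound)
      fix i
      show "cmod (apply_bcontfun (f - g) i) \<le> e / 2"
        using r(2)[of "apply_bcontfun f i"] js F_def
        by (auto simp: g_def apply_fin_seq dist_norm)
    qed
    ultimately show ?thesis using e by force
  qed
  show thesis
  proof (rule that[of "from_nat_into Y"])
    show "\<exists>xs. from_nat_into Y n = fin_seq xs" for n
      using from_nat_into[OF \<open>Y \<noteq> {}\<close>, of n] by (auto simp: Y_def)
    show "\<exists>n. norm (f - from_nat_into Y n) < e" if "f \<in> c0" "0 < e" for f e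
      using dense[OF that] from_nat_into_surj[OF \<open>countable Y\<close>] by metis
  qed
qed

text \<open>The span is real. The unit sequences are independent, since coordinate \<open>j\<close>
  vanishes on all of them but the one at \<open>j\<close>.\<close>

lemma c0_not_finite_span:
  assumes "finite S"
  shows "\<not> c0 \<subseteq> span S"
proof
  assume *: "c0 \<subseteq> span S"
  let ?U = "range (\<lambda>j. unit_seq j 1)"
  have inj: "inj (\<lambda>j. unit_seq j 1)"
  proof (rule injI)
    fix i j assume "unit_seq i 1 = unit_seq j 1"
    then have "apply_bcontfun (unit_seq i 1) i = apply_bcontfun (unit_seq j 1) i" by simp
    then show "i = j" by (simp split: if_splits)
  qed
  have "independent ?U"
    unfolding dependent_def
  proof clarify
    fix j assume "unit_seq j 1 \<in> span (?U - {unit_seq j 1})"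
    moreover have "span (?U - {unit_seq j 1}) \<subseteq> {f. apply_bcontfun f j = 0}"
      by (rule span_minimal) (auto simp: subspace_def)
    ultimately show False by auto
  qed
  moreover have "?U \<subseteq> span S" using * unit_seq_c0 by auto
  ultimately have "finite ?U" using independent_span_bound[OF assms] by blast
  then show False using inj infinite_UNIV_int finite_imageD by blast
qed

section \<open>Weighted shifts\<close>

lemma power_int_le_2_power:
  fixes a :: real
  assumes "1 / 2 \<le> a" "a \<le> 2"
  shows "a powi n \<le> 2 ^ nat \<bar>n\<bar>"
proof (cases "0 \<le> n")
  case True
  then show ?thesis using assms by (simp add: power_int_def power_mono)
next
  case False
  have "inverse a \<le> 2" using assms by (simp add: field_simps)
  then have "inverse a ^ nat (- n) \<le> 2 ^ nat (- n)" using assms by (intro power_mono) auto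
  then show ?thesis using False by (simp add: power_int_def)
qed

locale weighted_shift =
  fixes \<alpha> \<beta> :: real
  assumes \<alpha>: "1 \<le> \<alpha>" "\<alpha> \<le> 2" and \<beta>: "1 / 2 \<le> \<beta>" "\<beta> \<le> 1"
begin

text \<open>As \<open>\<beta> \<le> 1 \<le> \<alpha>\<close>, this is \<open>\<alpha> powi k\<close>
  for \<open>k \<ge> 0\<close> and \<open>\<beta> powi k\<close> for \<open>k \<le> 0\<close>. The
  maximum gives both lower bounds at once.\<close>

definition u :: "int \<Rightarrow> real"
  where "u k = max (\<alpha> powi k) (\<beta> powi k)"

lemma u_pos [simp]: "0 < u k"
  using \<alpha> by (simp add: u_def less_max_iff_disj)

lemma u_nonzero [simp]: "u k \<noteq> 0"
  using u_pos[of k] by linarith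

lemma u_add_le: "u (i + n) \<le> 2 ^ nat \<bar>n\<bar> * u i"
proof -
  have "a powi (i + n) \<le> 2 ^ nat \<bar>n\<bar> * a powi i" if "1 / 2 \<le> a" "a \<le> 2" for a :: real
    using mult_right_mono[OF power_int_le_2_power[OF that], of "a powi i" n] that
    by (simp add: power_int_add mult.commute)
  then have "\<alpha> powi (i + n) \<le> 2 ^ nat \<bar>n\<bar> * \<alpha> powi i" "\<beta> powi (i + n) \<le> 2 ^ nat \<bar>n\<bar> * \<beta> powi i"
    using \<alpha> \<beta> by auto
  moreover have "2 ^ nat \<bar>n\<bar> * \<alpha> powi i \<le> 2 ^ nat \<bar>n\<bar> * u i" "2 ^ nat \<bar>n\<bar> * \<beta> powi i \<le> 2 ^ nat \<bar>n\<bar> * u i"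
    by (auto simp: u_def)
  ultimately show ?thesis unfolding u_def[of "i + n"] by linarith
qed

lemma u_ratio_le: "cmod (of_real (u (i + n) / u i)) \<le> 2 ^ nat \<bar>n\<bar>"
  using u_add_le[of i n] less_imp_le[OF u_pos]
  by (simp add: norm_divide field_simps del: of_real_divide)

text \<open>The weights are quotients of \<open>u\<close>, so their products telescope: this is the
  \<open>n\<close>-th power of \<open>W 1\<close> for every integer \<open>n\<close>, inverses
  included.\<close>

definition W :: "int \<Rightarrow> cseq \<Rightarrow> cseq"
  where "W n = weight_map (\<lambda>i. of_real (u (i + n) / u i)) n"

lemma apply_W: "apply_bcontfun (W n f) i = of_real (u (i + n) / u i) * apply_bcontfun f (i + n)"
  unfolding W_def by (rule apply_weight_map[OF u_ratio_le])

lemma W_c0: "f \<in> c0 \<Longrightarrow> W n f \<in> c0"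
  unfolding W_def by (rule c0_weight_map[OF u_ratio_le])

lemma norm_W_le: "norm (W n f) \<le> 2 ^ nat \<bar>n\<bar> * norm f"
  by (rule norm_bound)
     (unfold apply_W norm_mult, intro mult_mono u_ratio_le norm_bounded, auto)

lemma W_linear:
  "W n (f + g) = W n f + W n g" "W n (f - g) = W n f - W n g" "W n (scaleC c f) = scaleC c (W n f)"
  by (auto intro!: bcontfun_eqI simp: apply_W distrib_left right_diff_distrib mult.left_commute
      simp del: of_real_divide)

lemma W_zero [simp]: "W n 0 = 0"
  by (auto intro!: bcontfun_eqI simp: apply_W)

lemma W_W: "W n (W m f) = W (n + m) f"
  by (auto intro!: bcontfun_eqI simp: apply_W add.assoc)

lemma W_0 [simp]: "W 0 f = f"
  by (auto intro!: bcontfun_eqI simp: apply_W)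

lemma tendsto_W:
  assumes "F \<longlonglongrightarrow> l"
  shows "(\<lambda>k. W n (F k)) \<longlonglongrightarrow> W n l"
proof -
  have "(\<lambda>k. W n (F k) - W n l) \<longlonglongrightarrow> 0"
  proof (rule Lim_null_comparison)
    show "\<forall>\<^sub>F k in sequentially. norm (W n (F k) - W n l) \<le> 2 ^ nat \<bar>n\<bar> * norm (F k - l)"
      using norm_W_le by (simp flip: W_linear)
    have "(\<lambda>k. 2 ^ nat \<bar>n\<bar> * norm (F k - l)) \<longlonglongrightarrow> 2 ^ nat \<bar>n\<bar> * norm (l - l)"
      using assms by (intro tendsto_intros)
    then show "(\<lambda>k. 2 ^ nat \<bar>n\<bar> * norm (F k - l)) \<longlonglongrightarrow> 0" by simp
  qed
  then show ?thesis by (simp add: LIM_zero_iff)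
qed

text \<open>For \<open>\<alpha> = 1\<close> the function \<open>u\<close> is nonincreasing, so all
  weights of \<open>W 1\<close> are at most 1.\<close>

lemma norm_W1_le:
  assumes "\<alpha> = 1"
  shows "norm (W 1 f) \<le> norm f"
proof (rule norm_bound)
  fix i
  have "\<beta> powi (i + 1) \<le> \<beta> powi i"
    using \<beta> by (simp add: power_int_add mult_left_le)
  then have "u (i + 1) \<le> u i" unfolding u_def unfolding assms by auto
  then have "u (i + 1) / u i * cmod (apply_bcontfun f (i + 1)) \<le> 1 * norm f"
    by (intro mult_mono norm_bounded) auto
  then show "cmod (apply_bcontfun (W 1 f) i) \<le> norm f"
    using less_imp_le[OF u_pos] by (simp add: apply_W norm_mult norm_divide)
qed

text \<open>For \<open>\<beta> = 1\<close> the function \<open>u\<close> is nondecreasing, so all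
  weights of \<open>W 1\<close> are at least 1. Coordinate \<open>i\<close> reappears at
  \<open>i - 1\<close>.\<close>

lemma norm_W1_ge:
  assumes "\<beta> = 1"
  shows "norm f \<le> norm (W 1 f)"
proof (rule norm_bound)
  fix i
  have "\<alpha> powi (i - 1) * 1 \<le> \<alpha> powi (i - 1) * \<alpha>"
    using \<alpha> by (intro mult_left_mono) auto
  then have "\<alpha> powi (i - 1) \<le> \<alpha> powi i"
    using \<alpha> by (simp add: power_int_diff)
  then have "u (i - 1) \<le> u i" unfolding u_def unfolding assms by auto
  then have "1 * cmod (apply_bcontfun f i) \<le> u i / u (i - 1) * cmod (apply_bcontfun f i)"
    by (intro mult_right_mono) auto
  also have "\<dots> = cmod (apply_bcontfun (W 1 f) (i - 1))"
    using less_imp_le[OF u_pos] by (simp add: apply_W norm_mult norm_divide)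
  also have "\<dots> \<le> norm (W 1 f)" by (rule norm_bounded)
  finally show "cmod (apply_bcontfun f i) \<le> norm (W 1 f)" by simp
qed

text \<open>Finitely supported sequences have this property, and the operations of the recursion in
  \<open>dense_scaled_orbit\<close> preserve it, so it serves as an invariant of the partial
  sums.\<close>

definition decaying :: "cseq \<Rightarrow> bool"
  where "decaying f \<longleftrightarrow> (\<exists>C\<ge>0. \<forall>n. norm (W (int n) f) \<le> C * \<beta> ^ n \<and> norm (W (- int n) f) \<le> C / \<alpha> ^ n)"

lemma decaying_add:
  assumes "decaying f" "decaying g"
  shows "decaying (f + g)"
proof -
  obtain C where C: "C \<ge> 0" "\<And>n. norm (W (int n) f) \<le> C * \<beta> ^ n" "\<And>n. norm (W (- int n) f) \<le> C / \<alpha> ^ n"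
    using assms(1) unfolding decaying_def by blast
  obtain D where D: "D \<ge> 0" "\<And>n. norm (W (int n) g) \<le> D * \<beta> ^ n" "\<And>n. norm (W (- int n) g) \<le> D / \<alpha> ^ n"
    using assms(2) unfolding decaying_def by blast
  have "norm (W (int n) (f + g)) \<le> (C + D) * \<beta> ^ n" for n
    using norm_triangle_ineq[of "W (int n) f" "W (int n) g"] C(2)[of n] D(2)[of n]
    by (simp add: W_linear distrib_right)
  moreover have "norm (W (- int n) (f + g)) \<le> (C + D) / \<alpha> ^ n" for n
    using norm_triangle_ineq[of "W (- int n) f" "W (- int n) g"] C(3)[of n] D(3)[of n]
    by (simp add: W_linear add_divide_distrib)
  ultimately show ?thesis
    unfolding decaying_def using C(1) D(1) by (intro exI[of _ "C + D"]) auto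
qed

lemma decaying_scaleC_W:
  assumes "decaying f"
  shows "decaying (scaleC c (W m f))"
proof -
  obtain C where C: "C \<ge> 0" "\<And>n. norm (W (int n) f) \<le> C * \<beta> ^ n" "\<And>n. norm (W (- int n) f) \<le> C / \<alpha> ^ n"
    using assms unfolding decaying_def by blast
  let ?B = "cmod c * 2 ^ nat \<bar>m\<bar>"
  have comm: "norm (W k (scaleC c (W m f))) \<le> ?B * norm (W k f)" for k
  proof -
    have "W k (scaleC c (W m f)) = scaleC c (W m (W k f))"
      by (simp add: W_linear W_W add.commute)
    then show ?thesis
      using norm_W_le[of m "W k f"] by (simp add: mult.assoc mult_left_mono)
  qed
  have B: "0 \<le> ?B" by simp
  have "norm (W (int n) (scaleC c (W m f))) \<le> (?B * C) * \<beta> ^ n" for n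
    using order_trans[OF comm mult_left_mono[OF C(2) B]] by (simp add: mult.assoc)
  moreover have "norm (W (- int n) (scaleC c (W m f))) \<le> (?B * C) / \<alpha> ^ n" for n
    using order_trans[OF comm mult_left_mono[OF C(3) B]] by simp
  ultimately show ?thesis
    unfolding decaying_def using C(1) B by (intro exI[of _ "?B * C"]) auto
qed

text \<open>\<open>W n\<close> moves the entry from \<open>j\<close> to \<open>j - n\<close> with
  factor \<open>u j / u (j - n)\<close>, and \<open>u\<close> dominates the powers of both
  \<open>\<alpha>\<close> and \<open>\<beta>\<close>.\<close>

lemma decaying_unit_seq: "decaying (unit_seq j c)"
proof -
  define C where "C = cmod c * u j / \<beta> powi j + cmod c * u j / \<alpha> powi j"
  have pos: "0 < \<alpha> powi k" "0 < \<beta> powi k" for k using \<alpha> \<beta> by auto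
  have C: "cmod c * u j / \<beta> powi j \<le> C" "cmod c * u j / \<alpha> powi j \<le> C" "0 \<le> C"
    unfolding C_def using pos less_imp_le[OF u_pos] by (auto simp: less_imp_le)
  have W_unit: "norm (W n (unit_seq j c)) \<le> cmod c * u j / u (j - n)" for n
  proof (rule norm_bound)
    fix i
    show "cmod (apply_bcontfun (W n (unit_seq j c)) i) \<le> cmod c * u j / u (j - n)"
      using less_imp_le[OF u_pos] by (auto simp: apply_W norm_mult norm_divide mult.commute)
  qed
  have "norm (W (int n) (unit_seq j c)) \<le> C * \<beta> ^ n" for n
  proof -
    have "\<beta> powi j / \<beta> ^ n \<le> u (j - int n)"
      using \<beta> by (simp add: u_def power_int_diff)
    then have "cmod c * u j / u (j - int n) \<le> cmod c * u j / (\<beta> powi j / \<beta> ^ n)"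
      using \<beta> pos less_imp_le[OF u_pos] by (intro divide_left_mono mult_nonneg_nonneg mult_pos_pos) auto
    also have "\<dots> = cmod c * u j / \<beta> powi j * \<beta> ^ n" by simp
    also have "\<dots> \<le> C * \<beta> ^ n" using C(1) \<beta> by (intro mult_right_mono) auto
    finally show ?thesis using W_unit[of "int n"] by linarith
  qed
  moreover have "norm (W (- int n) (unit_seq j c)) \<le> C / \<alpha> ^ n" for n
  proof -
    have "\<alpha> powi j * \<alpha> ^ n \<le> u (j + int n)"
      using \<alpha> by (simp add: u_def power_int_add)
    then have "cmod c * u j / u (j + int n) \<le> cmod c * u j / (\<alpha> powi j * \<alpha> ^ n)"
      using \<alpha> pos less_imp_le[OF u_pos] by (intro divide_left_mono mult_nonneg_nonneg mult_pos_pos) auto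
    also have "\<dots> = cmod c * u j / \<alpha> powi j / \<alpha> ^ n" by simp
    also have "\<dots> \<le> C / \<alpha> ^ n" using C(2) \<alpha> by (intro divide_right_mono) auto
    finally show ?thesis using W_unit[of "- int n"] by simp
  qed
  ultimately show ?thesis unfolding decaying_def using C(3) by blast
qed

lemma decaying_zero: "decaying 0"
  unfolding decaying_def by (auto intro!: exI[of _ 0])

lemma decaying_fin_seq: "decaying (fin_seq xs)"
  by (induction xs) (auto simp: fin_seq_Cons fin_seq_def[of "[]"] decaying_zero intro!: decaying_add decaying_unit_seq)

text \<open>The vector is \<open>x = (\<Sum>j. \<gamma>\<^sub>j\<^sup>-\<^sup>1 W\<^sup>-\<^sup>n\<^sup>j y\<^sub>j)\<close> with each \<open>y\<^sub>j\<close> repeated infinitely often. Stage \<open>j\<close> of the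
  recursion carries the partial sum and a bound \<open>M\<close> for the norms of all earlier \<open>\<gamma>\<^sub>i W\<^sup>n\<^sup>i\<close>.\<close>

proposition dense_scaled_orbit:
  assumes H: "\<And>C e :: real. 0 < C \<Longrightarrow> 0 < e \<Longrightarrow>
    \<exists>\<gamma>\<in>\<Gamma>. \<exists>n. \<gamma> \<noteq> 0 \<and> cmod \<gamma> * (C * \<beta> ^ n) < e \<and> C / \<alpha> ^ n / cmod \<gamma> < e"
  shows "\<exists>x\<in>c0. \<forall>f\<in>c0. \<forall>e>0. \<exists>\<gamma>\<in>\<Gamma>. \<exists>n. norm (f - scaleC \<gamma> (W (int n) x)) < e"
proof -
  obtain y0 :: "nat \<Rightarrow> cseq" where y0: "\<And>n. \<exists>xs. y0 n = fin_seq xs"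
    "\<And>f e. f \<in> c0 \<Longrightarrow> 0 < e \<Longrightarrow> \<exists>n. norm (f - y0 n) < e"
    using c0_separable by blast
  define y where "y j = y0 (fst (prod_decode j))" for j
  have y: "decaying (y j)" "y j \<in> c0" for j
    using y0(1)[of "fst (prod_decode j)"] decaying_fin_seq fin_seq_c0 by (auto simp: y_def)
  \<comment> \<open>The first estimate keeps the terms already chosen from disturbing the
    approximation of \<open>y j\<close>; the second keeps the new term from disturbing the earlier
    stages.\<close>
  have "\<forall>j x M. \<exists>\<gamma> n. decaying x \<longrightarrow> 1 \<le> M \<longrightarrow> \<gamma> \<in> \<Gamma> \<and> \<gamma> \<noteq> 0 \<and>
      norm (scaleC \<gamma> (W (int n) x)) < (1 / 2) ^ j \<and>
      M * norm (scaleC (1 / \<gamma>) (W (- int n) (y j))) < (1 / 2) ^ j"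
  proof (intro allI)
    fix j x and M :: real
    show "\<exists>\<gamma> n. decaying x \<longrightarrow> 1 \<le> M \<longrightarrow> \<gamma> \<in> \<Gamma> \<and> \<gamma> \<noteq> 0 \<and>
      norm (scaleC \<gamma> (W (int n) x)) < (1 / 2) ^ j \<and>
      M * norm (scaleC (1 / \<gamma>) (W (- int n) (y j))) < (1 / 2) ^ j"
    proof (cases "decaying x \<and> 1 \<le> M")
      case True
      obtain C1 where C1: "C1 \<ge> 0" "\<And>n. norm (W (int n) x) \<le> C1 * \<beta> ^ n"
        using True unfolding decaying_def by blast
      obtain C2 where C2: "C2 \<ge> 0" "\<And>n. norm (W (- int n) (y j)) \<le> C2 / \<alpha> ^ n"
        using y(1)[of j] unfolding decaying_def by blast
      \<comment> \<open>One constant for both estimates; the summand 1 makes it positive.\<close>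
      define C where "C = C1 + M * C2 + 1"
      have "M * C2 \<ge> 0" using True C2(1) by simp
      then have C: "0 < C" "C1 \<le> C" "M * C2 \<le> C" using C1(1) by (auto simp: C_def)
      obtain \<gamma> n where \<gamma>: "\<gamma> \<in> \<Gamma>" "\<gamma> \<noteq> 0" "cmod \<gamma> * (C * \<beta> ^ n) < (1 / 2) ^ j"
          "C / \<alpha> ^ n / cmod \<gamma> < (1 / 2) ^ j"
        using H[OF C(1), of "(1 / 2) ^ j"] by auto
      have "norm (scaleC \<gamma> (W (int n) x)) \<le> cmod \<gamma> * (C * \<beta> ^ n)"
      proof -
        have "C1 * \<beta> ^ n \<le> C * \<beta> ^ n" using C(2) \<beta> by (intro mult_right_mono) auto
        then show ?thesis using C1(2)[of n] by (simp add: mult_left_mono)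
      qed
      moreover have "M * norm (scaleC (1 / \<gamma>) (W (- int n) (y j))) \<le> C / \<alpha> ^ n / cmod \<gamma>"
      proof -
        have "M * norm (W (- int n) (y j)) \<le> M * (C2 / \<alpha> ^ n)"
          using C2(2)[of n] True by (intro mult_left_mono) auto
        also have "\<dots> \<le> C / \<alpha> ^ n" using C(3) \<alpha> by (simp add: divide_right_mono)
        finally have "M * norm (W (- int n) (y j)) / cmod \<gamma> \<le> C / \<alpha> ^ n / cmod \<gamma>"
          by (rule divide_right_mono) simp
        then show ?thesis by (simp add: norm_divide)
      qed
      ultimately have "norm (scaleC \<gamma> (W (int n) x)) < (1 / 2) ^ j"
          "M * norm (scaleC (1 / \<gamma>) (W (- int n) (y j))) < (1 / 2) ^ j"
        using \<gamma>(3,4) by linarith+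
      then show ?thesis using \<gamma>(1,2) by blast
    qed blast
  qed
  then obtain G K where GK: "\<And>j x M. decaying x \<Longrightarrow> 1 \<le> M \<Longrightarrow> G j x M \<in> \<Gamma> \<and> G j x M \<noteq> 0 \<and>
      norm (scaleC (G j x M) (W (int (K j x M)) x)) < (1 / 2) ^ j \<and>
      M * norm (scaleC (1 / G j x M) (W (- int (K j x M)) (y j))) < (1 / 2) ^ j"
    by metis
  define step where "step j s = (fst s + scaleC (1 / G j (fst s) (snd s)) (W (- int (K j (fst s) (snd s))) (y j)),
      snd s + cmod (G j (fst s) (snd s)) * 2 ^ K j (fst s) (snd s))" for j and s :: "cseq \<times> real"
  define st where "st = rec_nat (0, 1) step"
  define x where "x j = fst (st j)" for j
  define M where "M j = snd (st j)" for j
  define g where "g j = G j (x j) (M j)" for j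
  define k where "k j = K j (x j) (M j)" for j
  define d where "d j = scaleC (1 / g j) (W (- int (k j)) (y j))" for j
  have st_0: "x 0 = 0" "M 0 = 1" by (simp_all add: x_def M_def st_def)
  have x_Suc: "x (Suc j) = x j + d j" and M_Suc: "M (Suc j) = M j + cmod (g j) * 2 ^ k j" for j
    by (simp_all add: x_def M_def st_def step_def d_def g_def k_def)
  have inv: "decaying (x j) \<and> 1 \<le> M j" for j
  proof (induction j)
    case 0
    then show ?case by (simp add: st_0 decaying_zero)
  next
    case (Suc j)
    have "0 \<le> cmod (g j) * 2 ^ k j" by simp
    then have "1 \<le> M (Suc j)" using Suc unfolding M_Suc by linarith
    moreover have "decaying (x (Suc j))"
      using Suc y(1) unfolding x_Suc d_def by (intro decaying_add decaying_scaleC_W) auto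
    ultimately show ?case by blast
  qed
  have g: "g j \<in> \<Gamma>" "g j \<noteq> 0" "norm (scaleC (g j) (W (int (k j)) (x j))) < (1 / 2) ^ j"
      "M j * norm (d j) < (1 / 2) ^ j" for j
    using GK[of "x j" "M j" j] inv by (auto simp: g_def k_def d_def)
  have M_mono: "cmod (g j) * 2 ^ k j \<le> M i" if "j < i" for i j
    using that
  proof (induction i)
    case (Suc i)
    have "0 \<le> cmod (g i) * 2 ^ k i" by simp
    moreover have "1 \<le> M i" using inv by blast
    moreover have "j = i \<or> cmod (g j) * 2 ^ k j \<le> M i" using Suc less_SucE by blast
    ultimately show ?case unfolding M_Suc by (elim disjE) (hypsubst, linarith+)
  qed simp
  have norm_d: "norm (d j) \<le> (1 / 2) ^ j" for j
    using mult_right_mono[of 1 "M j" "norm (d j)"] inv[of j] g(4)[of j] by simp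
  have "Cauchy x"
    unfolding Cauchy_altdef2
  proof (intro allI impI)
    fix e :: real assume "e > 0"
    then obtain m where m: "(1 / 2) ^ m < e / 2"
      using real_arch_pow_inv[of "e / 2" "1 / 2"] by auto
    \<comment> \<open>The exact form of the geometric sum lets the induction close.\<close>
    have "norm (x (m + i) - x m) \<le> 2 * (1 / 2) ^ m - 2 * (1 / 2) ^ (m + i)" for i
    proof (induction i)
      case (Suc i)
      have "x (m + Suc i) - x m = (x (m + i) - x m) + d (m + i)" by (simp add: x_Suc)
      then have "norm (x (m + Suc i) - x m) \<le> norm (x (m + i) - x m) + norm (d (m + i))"
        by (metis norm_triangle_ineq)
      also have "\<dots> \<le> (2 * (1 / 2) ^ m - 2 * (1 / 2) ^ (m + i)) + (1 / 2) ^ (m + i)"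
        using Suc norm_d by (intro add_mono) auto
      finally show ?case by simp
    qed simp
    then have le: "norm (x (m + i) - x m) \<le> 2 * (1 / 2) ^ m" for i
      by (rule order_trans) simp
    have "norm (x (m + i) - x m) < e" for i
      using m le[of i] by linarith
    then show "\<exists>n. \<forall>k\<ge>n. dist (x k) (x n) < e"
      unfolding dist_norm by (metis le_iff_add)
  qed
  then obtain l where lim: "x \<longlonglongrightarrow> l"
    using Cauchy_cseq_convergent unfolding convergent_def by blast
  have x_c0: "x j \<in> c0" for j
    by (induction j) (auto simp: st_0 x_Suc d_def c0_zero intro!: c0_add c0_scaleC W_c0 y)
  have "l \<in> c0"
    using closed_sequentially[OF closed_c0 x_c0 lim] .
  moreover have close: "norm (y j - scaleC (g j) (W (int (k j)) (l))) \<le> 2 * (1 / 2) ^ j" for j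
  proof -
    let ?A = "\<lambda>f. scaleC (g j) (W (int (k j)) f)"
    \<comment> \<open>The operator of stage \<open>j\<close> maps the \<open>j\<close>-th increment
      exactly to \<open>y j\<close>.\<close>
    have A_d: "?A (d j) = y j"
      unfolding d_def using g(2)[of j] by (simp add: W_linear W_W flip: scaleC_distrib(4)) (simp add: scaleC_distrib)
    have norm_A: "norm (?A f) \<le> (cmod (g j) * 2 ^ k j) * norm f" for f
      using norm_W_le[of "int (k j)" f] by (simp add: mult.assoc mult_left_mono)
    have small: "norm (?A (d i)) \<le> (1 / 2) ^ i" if "j < i" for i
      using norm_A[of "d i"] mult_right_mono[OF M_mono[OF that], of "norm (d i)"] g(4)[of i] by simp
    \<comment> \<open>The first \<open>(1 / 2) ^ j\<close> accounts for the increments before stage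
      \<open>j\<close>, the bracket for the geometric sum of the later ones.\<close>
    have tail: "norm (?A (x (Suc j + m)) - y j) \<le> (1 / 2) ^ j + ((1 / 2) ^ j - (1 / 2) ^ (j + m))" for m
    proof (induction m)
      case 0
      have "?A (x (Suc j)) - y j = ?A (x j)"
        using A_d by (simp add: x_Suc W_linear scaleC_distrib)
      then show ?case using g(3)[of j] by simp
    next
      case (Suc m)
      have "?A (x (Suc j + Suc m)) - y j = (?A (x (Suc j + m)) - y j) + ?A (d (Suc j + m))"
        by (simp add: x_Suc W_linear scaleC_distrib)
      then have "norm (?A (x (Suc j + Suc m)) - y j) \<le> norm (?A (x (Suc j + m)) - y j) + norm (?A (d (Suc j + m)))"
        by (metis norm_triangle_ineq)
      also have "\<dots> \<le> ((1 / 2) ^ j + ((1 / 2) ^ j - (1 / 2) ^ (j + m))) + (1 / 2) ^ (Suc j + m)"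
        using Suc small[of "Suc j + m"] by (intro add_mono) auto
      finally show ?case by simp
    qed
    have "(\<lambda>m. x (Suc j + m)) \<longlonglongrightarrow> l"
      using LIMSEQ_ignore_initial_segment[OF lim, of "Suc j"] by (simp add: add.commute)
    from tendsto_W[OF this, of "int (k j)"]
    have "(\<lambda>m. W (int (k j)) (x (Suc j + m)) - W (int (k j)) (l)) \<longlonglongrightarrow> 0"
      by (simp add: LIM_zero)
    then have "(\<lambda>m. cmod (g j) * norm (W (int (k j)) (x (Suc j + m)) - W (int (k j)) (l))) \<longlonglongrightarrow> 0"
      by (intro tendsto_mult_right_zero tendsto_norm_zero)
    then have "(\<lambda>m. norm (?A (x (Suc j + m)) - ?A (l))) \<longlonglongrightarrow> 0"
      by (simp flip: scaleC_distrib(3))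
    then have "(\<lambda>m. ?A (x (Suc j + m))) \<longlonglongrightarrow> ?A (l)"
      by (metis LIM_zero_cancel tendsto_norm_zero_iff)
    then have "(\<lambda>m. norm (?A (x (Suc j + m)) - y j)) \<longlonglongrightarrow> norm (?A (l) - y j)"
      by (intro tendsto_intros)
    moreover have "norm (?A (x (Suc j + m)) - y j) \<le> 2 * (1 / 2) ^ j" for m
      using tail[of m] by (simp add: order_trans)
    ultimately have "norm (?A (l) - y j) \<le> 2 * (1 / 2) ^ j"
      by (intro LIMSEQ_le_const2) auto
    then show ?thesis by (simp add: norm_minus_commute)
  qed
  moreover have "\<exists>\<gamma>\<in>\<Gamma>. \<exists>n. norm (f - scaleC \<gamma> (W (int n) (l))) < e" if f: "f \<in> c0" and e: "0 < e" for f e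
  proof -
    obtain m where m: "norm (f - y0 m) < e / 2" using y0(2)[OF f half_gt_zero[OF e]] by blast
    obtain N where N: "(1 / 2) ^ N < e / 4"
      using real_arch_pow_inv[of "e / 4" "1 / 2"] e by auto
    \<comment> \<open>This stage treats \<open>y0 m\<close> and is at least \<open>N\<close>, so its
      error is small.\<close>
    define j where "j = prod_encode (m, N)"
    have jN: "(1 / 2 :: real) ^ j \<le> (1 / 2) ^ N"
      unfolding j_def by (intro power_decreasing le_prod_encode_2) auto
    have "y j = y0 m" by (simp add: y_def j_def)
    then have close_m: "norm (y0 m - scaleC (g j) (W (int (k j)) l)) \<le> 2 * (1 / 2) ^ j"
      using close[of j] by metis
    have "norm (y0 m - scaleC (g j) (W (int (k j)) (l))) < e / 2"
      using close_m jN N by linarith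
    then have "norm (f - scaleC (g j) (W (int (k j)) (l))) < e"
      using norm_triangle_ineq[of "f - y0 m" "y0 m - scaleC (g j) (W (int (k j)) (l))"] m by simp
    then show ?thesis using g(1) by blast
  qed
  ultimately show ?thesis by blast
qed

end

section \<open>Necessity\<close>

text \<open>A sequence is determined by the rational cuts of the real and imaginary parts of its
  entries, hence by a subset of a countable set; such subsets inject into the reals.\<close>

lemma inj_cseq_complex: "\<exists>f :: cseq \<Rightarrow> complex. inj f"
proof -
  define cut :: "cseq \<Rightarrow> (int \<times> bool \<times> rat) set"
    where "cut f = {(i, b, q). (if b then Re (apply_bcontfun f i) else Im (apply_bcontfun f i)) < of_rat q}" for f
  have real_eq: "r = s" if "\<And>q. r < real_of_rat q \<longleftrightarrow> s < real_of_rat q" for r s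
  proof (rule ccontr)
    assume "r \<noteq> s"
    then obtain q where "r < of_rat q \<and> of_rat q < s \<or> s < of_rat q \<and> of_rat q < r"
      by (metis linorder_neqE_linordered_idom of_rat_dense)
    then show False using that[of q] by linarith
  qed
  have inj_cut: "inj cut"
  proof (rule injI, rule bcontfun_eqI)
    fix f g i assume eq: "cut f = cut g"
    have "Re (apply_bcontfun f i) < of_rat q \<longleftrightarrow> Re (apply_bcontfun g i) < of_rat q"
         "Im (apply_bcontfun f i) < of_rat q \<longleftrightarrow> Im (apply_bcontfun g i) < of_rat q" for q
      using arg_cong[OF eq, of "\<lambda>C. (i, True, q) \<in> C"] arg_cong[OF eq, of "\<lambda>C. (i, False, q) \<in> C"]
      by (simp_all add: cut_def)
    then show "apply_bcontfun f i = apply_bcontfun g i"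
      by (intro complex_eqI real_eq)
  qed
  obtain b :: "nat set \<Rightarrow> real" where b: "bij b"
    using nat_sets_eqpoll_reals unfolding eqpoll_def by blast
  have "inj (\<lambda>f. complex_of_real (b (to_nat ` cut f)))"
    using inj_cut b by (auto intro!: injI simp: inj_eq bij_is_inj inj_image_eq_iff[OF inj_to_nat] dest: injD)
  then show ?thesis by blast
qed

text \<open>\<open>hypercyclic_scalar_set\<close> sees only spaces with carrier inside
  \<open>'a\<close>, so \<open>c0\<close> is transported there along an injection.\<close>

locale cseq_embedding =
  fixes g :: "cseq \<Rightarrow> 'a"
  assumes inj_g: "inj g"
begin

abbreviation h :: "'a \<Rightarrow> cseq"
  where "h \<equiv> inv_into UNIV g"

lemma h_g [simp]: "h (g f) = f"
  by (rule inv_into_f_f[OF inj_g UNIV_I])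

definition V0 :: "(complex, 'a) module"
  where "V0 = \<lparr>carrier = g ` c0, mult = (\<lambda>x y. g 0), one = g 0, zero = g 0,
    add = (\<lambda>x y. g (h x + h y)), Module.module.smult = (\<lambda>c x. g (scaleC c (h x)))\<rparr>"

lemma V0_simps [simp]:
  "carrier V0 = g ` c0" "\<zero>\<^bsub>V0\<^esub> = g 0" "x \<oplus>\<^bsub>V0\<^esub> y = g (h x + h y)" "c \<odot>\<^bsub>V0\<^esub> x = g (scaleC c (h x))"
  by (simp_all add: V0_def)

definition N0 :: "'a \<Rightarrow> real"
  where "N0 x = norm (h x)"

lemma abelian_group_V0: "abelian_group V0"
proof (rule abelian_groupI)
  fix x assume "x \<in> carrier V0"
  then obtain f where f: "f \<in> c0" "x = g f" by auto
  have "0 - f \<in> c0" using f(1) c0_zero c0_diff by blast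
  then show "\<exists>y\<in>carrier V0. y \<oplus>\<^bsub>V0\<^esub> x = \<zero>\<^bsub>V0\<^esub>"
    using f by (intro bexI[of _ "g (0 - f)"]) auto
qed (auto simp: c0_add c0_zero add_ac)

lemma module_V0: "Module.module complex_field V0"
proof (rule moduleI)
  show "cring complex_field" by (rule cring_from_type_algebra)
qed (auto simp: abelian_group_V0 ring_of_type_algebra_def c0_scaleC scaleC_distrib)

interpretation V0: abelian_group V0 by (rule abelian_group_V0)

lemma normed_space_V0: "complex_normed_space V0 N0"
  by (intro complex_normed_space.intro module_V0 complex_normed_space_axioms.intro)
     (auto simp: N0_def inj_eq[OF inj_g] norm_triangle_ineq)

text \<open>Subtraction in \<open>V0\<close> rests on the abstract additive inverse, so it is
  identified by adding \<open>y\<close> back.\<close>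

lemma h_minus:
  assumes "x \<in> carrier V0" "y \<in> carrier V0"
  shows "h (x \<ominus>\<^bsub>V0\<^esub> y) = h x - h y"
proof -
  have "x \<ominus>\<^bsub>V0\<^esub> y \<oplus>\<^bsub>V0\<^esub> y = x"
    using assms by (simp only: V0.minus_eq V0.a_assoc V0.a_inv_closed V0.l_neg V0.r_zero)
  then have "h (x \<ominus>\<^bsub>V0\<^esub> y \<oplus>\<^bsub>V0\<^esub> y) = h x" by (rule arg_cong)
  then show ?thesis by (simp add: eq_diff_eq)
qed

lemma norm_dist_V0: "p \<in> c0 \<Longrightarrow> q \<in> c0 \<Longrightarrow> norm_dist V0 N0 (g p) (g q) = norm (p - q)"
  using h_minus[of "g p" "g q"] by (auto simp: norm_dist_def N0_def)

lemma banach_space_V0: "complex_banach_space V0 N0"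
proof (intro complex_banach_space.intro complex_banach_space_axioms.intro normed_space_V0)
  interpret M: Metric_space "carrier V0" "norm_dist V0 N0"
    by (rule complex_normed_space.Metric_space_norm_dist[OF normed_space_V0])
  show "M.mcomplete"
    unfolding M.mcomplete_def
  proof (intro allI impI)
    fix \<sigma> assume \<sigma>: "M.MCauchy \<sigma>"
    have "\<forall>n. \<exists>f. f \<in> c0 \<and> \<sigma> n = g f"
      using \<sigma> unfolding M.MCauchy_def unfolding V0_simps by blast
    then obtain p where p: "\<And>n. p n \<in> c0" "\<And>n. \<sigma> n = g (p n)" by metis
    have dist: "norm_dist V0 N0 (\<sigma> m) (\<sigma> n) = norm (p m - p n)" for m n
      by (simp add: p norm_dist_V0)
    have "Cauchy p"
      unfolding Cauchy_iff
    proof (intro allI impI)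
      fix e :: real assume "0 < e"
      then have "\<exists>K. \<forall>m n. K \<le> m \<longrightarrow> K \<le> n \<longrightarrow> norm_dist V0 N0 (\<sigma> m) (\<sigma> n) < e"
        using \<sigma> unfolding M.MCauchy_def by blast
      then show "\<exists>K. \<forall>m\<ge>K. \<forall>n\<ge>K. norm (p m - p n) < e"
        unfolding dist by blast
    qed
    then obtain l where l: "p \<longlonglongrightarrow> l" using Cauchy_cseq_convergent convergent_def by blast
    have "l \<in> c0" using closed_sequentially[OF closed_c0 p(1) l] .
    moreover have "\<forall>\<^sub>F n in sequentially. \<sigma> n \<in> carrier V0 \<and> norm_dist V0 N0 (\<sigma> n) (g l) < e" if "0 < e" for e
      using tendstoD[OF l that] p \<open>l \<in> c0\<close> by (simp add: norm_dist_V0 dist_norm)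
    ultimately show "\<exists>x. limitin M.mtopology \<sigma> x sequentially"
      unfolding M.limitin_metric by (intro exI[of _ "g l"]) auto
  qed
qed

lemma h_finsum:
  assumes "finite B" "F \<in> B \<rightarrow> carrier V0"
  shows "h (finsum V0 F B) = (\<Sum>b\<in>B. h (F b))"
  using assms
proof (induction B rule: finite_induct)
  case (insert b B)
  then have "F b \<in> carrier V0" "F \<in> B \<rightarrow> carrier V0" by auto
  then have "finsum V0 F (insert b B) = F b \<oplus>\<^bsub>V0\<^esub> finsum V0 F B"
    using insert by (intro V0.finsum_insert) auto
  then show ?case using insert by simp
qed simp

text \<open>A complex combination of \<open>B\<close> is a real combination of \<open>B\<close> and
  its multiples by \<open>\<i>\<close>.\<close>

lemma infinite_dimensional_V0: "infinite_dimensional V0"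
  unfolding infinite_dimensional_def
proof (rule notI, elim exE conjE)
  fix B assume B: "finite B" "B \<subseteq> carrier V0"
    "\<forall>x\<in>carrier V0. \<exists>c. x = (\<Oplus>\<^bsub>V0\<^esub>b\<in>B. c b \<odot>\<^bsub>V0\<^esub> b)"
  let ?S = "h ` B \<union> (\<lambda>b. scaleC \<i> (h b)) ` B"
  have "f \<in> span ?S" if "f \<in> c0" for f
  proof -
    have "g f \<in> carrier V0" using that by simp
    then obtain c where c: "g f = (\<Oplus>\<^bsub>V0\<^esub>b\<in>B. c b \<odot>\<^bsub>V0\<^esub> b)"
      using B(3) by blast
    have "(\<lambda>b. c b \<odot>\<^bsub>V0\<^esub> b) \<in> B \<rightarrow> carrier V0"
      using B(2) by (force simp: c0_scaleC)
    from h_finsum[OF B(1) this] have "f = (\<Sum>b\<in>B. scaleC (c b) (h b))"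
      using arg_cong[OF c, of h] by simp
    also have "\<dots> = (\<Sum>b\<in>B. Re (c b) *\<^sub>R h b + Im (c b) *\<^sub>R scaleC \<i> (h b))"
    proof (rule sum.cong[OF refl], rule bcontfun_eqI)
      fix b i
      have "c b = of_real (Re (c b)) + of_real (Im (c b)) * \<i>"
        by (simp add: complex_eq_iff)
      then have "c b * apply_bcontfun (h b) i
          = (of_real (Re (c b)) + of_real (Im (c b)) * \<i>) * apply_bcontfun (h b) i"
        by (rule arg_cong)
      then show "apply_bcontfun (scaleC (c b) (h b)) i
          = apply_bcontfun (Re (c b) *\<^sub>R h b + Im (c b) *\<^sub>R scaleC \<i> (h b)) i"
        by (simp add: scaleR_conv_of_real distrib_right mult.assoc)
    qed
    also have "\<dots> \<in> span ?S"
      by (intro span_sum span_add span_scale span_base) auto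
    finally show ?thesis .
  qed
  then show False using c0_not_finite_span[of ?S] B(1) by auto
qed

end

locale embedded_shift = cseq_embedding + weighted_shift
begin

definition T0 :: "'a \<Rightarrow> 'a"
  where "T0 x = g (W 1 (h x))"

lemma bounded_operator_T0: "bounded_operator V0 N0 T0"
  unfolding bounded_operator_def
proof (intro conjI)
  show "\<exists>K. \<forall>x\<in>carrier V0. N0 (T0 x) \<le> K * N0 x"
    using norm_W_le[of 1] by (intro exI[of _ 2]) (simp add: N0_def T0_def)
qed (auto simp: T0_def W_c0 W_linear)

lemma T0_pow: "(T0 ^^ n) (g f) = g (W (int n) f)"
  by (induction n) (auto simp: T0_def W_W add.commute)

lemma
  assumes f: "f \<in> c0"
  shows scaled_orbit_T0_dense_iff: "norm_closure V0 N0 (scaled_orbit V0 \<Gamma> (g f) T0) = carrier V0 \<longleftrightarrow>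
      (\<forall>p\<in>c0. \<forall>e>0. \<exists>\<gamma>\<in>\<Gamma>. \<exists>n. norm (p - scaleC \<gamma> (W (int n) f)) < e)" (is ?A)
    and hypercyclic_T0_iff: "hypercyclic_vector V0 N0 T0 (g f) \<longleftrightarrow>
      (\<forall>p\<in>c0. \<forall>e>0. \<exists>n. norm (p - W (int n) f) < e)" (is ?B)
proof -
  interpret complex_normed_operator V0 N0 T0 "g f"
    using normed_space_V0 bounded_operator_T0 f
    by (simp add: complex_normed_operator_def complex_normed_operator_axioms_def)
  have "N0 (g p \<ominus>\<^bsub>V0\<^esub> \<gamma> \<odot>\<^bsub>V0\<^esub> (T0 ^^ n) (g f)) = norm (p - scaleC \<gamma> (W (int n) f))" if "p \<in> c0" for p \<gamma> n
    using that f h_minus[of "g p" "g (scaleC \<gamma> (W (int n) f))"] by (simp add: N0_def T0_pow c0_scaleC W_c0)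
  then show ?A unfolding scaled_orbit_dense_iff by simp
  have "N0 (g p \<ominus>\<^bsub>V0\<^esub> (T0 ^^ n) (g f)) = norm (p - W (int n) f)" if "p \<in> c0" for p n
    using that f h_minus[of "g p" "g (W (int n) f)"] by (simp add: N0_def T0_pow W_c0)
  then show ?B unfolding hypercyclic_vector_iff by simp
qed

lemma hypercyclic_scalar_setD:
  assumes "hypercyclic_scalar_set TYPE('a) \<Gamma>" "f \<in> c0"
  shows "(\<forall>p\<in>c0. \<forall>e>0. \<exists>\<gamma>\<in>\<Gamma>. \<exists>n. norm (p - scaleC \<gamma> (W (int n) f)) < e) \<longleftrightarrow>
    (\<forall>p\<in>c0. \<forall>e>0. \<exists>n. norm (p - W (int n) f) < e)"
proof -
  have "g f \<in> carrier V0" using assms(2) by simp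
  then have "norm_closure V0 N0 (scaled_orbit V0 \<Gamma> (g f) T0) = carrier V0 \<longleftrightarrow>
      hypercyclic_vector V0 N0 T0 (g f)"
    using assms(1) banach_space_V0 infinite_dimensional_V0 bounded_operator_T0
    unfolding hypercyclic_scalar_set_def by blast
  then show ?thesis
    by (simp only: scaled_orbit_T0_dense_iff[OF assms(2)] hypercyclic_T0_iff[OF assms(2)])
qed

end

section \<open>Three shifts that exclude the remaining sets \<open>\<Gamma>\<close>\<close>

lemma half_less_one: "1 / 2 < (1 :: real)"
  by simp

lemma norm_unit_seq: "norm (unit_seq 0 c) \<ge> cmod c"
  using norm_bounded[of "unit_seq 0 c" 0] by simp

context cseq_embedding
begin

text \<open>With weights 2 and \<open>1 / 2\<close> some \<open>x\<close> is hypercyclic, by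
  \<open>dense_scaled_orbit\<close> for the scalar set \<open>{1}\<close>, whereas the scalar 0
  yields only the zero vector.\<close>

lemma hypercyclic_scalar_set_nonzero:
  assumes hc: "hypercyclic_scalar_set TYPE('a) \<Gamma>"
  shows "\<Gamma> - {0} \<noteq> {}"
proof
  assume \<Gamma>: "\<Gamma> - {0} = {}"
  interpret embedded_shift g 2 "1 / 2" by unfold_locales auto
  have "\<exists>x\<in>c0. \<forall>f\<in>c0. \<forall>e>0. \<exists>\<gamma>\<in>{1}. \<exists>n. norm (f - scaleC \<gamma> (W (int n) x)) < e"
  proof (rule dense_scaled_orbit)
    fix C e :: real assume "0 < C" "0 < e"
    then obtain n where "(1 / 2) ^ n < e / C"
      using real_arch_pow_inv[of "e / C" "1 / 2"] by auto
    then have "C * (1 / 2) ^ n < e" using \<open>0 < C\<close> by (simp add: field_simps)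
    then show "\<exists>\<gamma>\<in>{1}. \<exists>n. \<gamma> \<noteq> 0 \<and> cmod \<gamma> * (C * (1 / 2) ^ n) < e \<and> C / 2 ^ n / cmod \<gamma> < e"
      by (auto simp: power_one_over field_simps intro!: exI[of _ n])
  qed
  then obtain x where x: "x \<in> c0" "\<And>f e. f \<in> c0 \<Longrightarrow> 0 < e \<Longrightarrow> \<exists>n. norm (f - W (int n) x) < e"
    by (auto simp: scaleC_distrib)
  then obtain \<gamma> n where "\<gamma> \<in> \<Gamma>" "norm (unit_seq 0 1 - scaleC \<gamma> (W (int n) x)) < 1"
    using hypercyclic_scalar_setD[OF hc x(1)] unit_seq_c0[of 0 1] by (meson zero_less_one)
  moreover from this have "\<gamma> = 0" using \<Gamma> by blast
  moreover have "scaleC 0 (W (int n) x) = 0" by (auto intro!: bcontfun_eqI)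
  ultimately show False using norm_unit_seq[of 1] by simp
qed

text \<open>With weights 1 and \<open>1 / 2\<close>, a large \<open>\<gamma>\<close> and then a
  large \<open>n\<close> make both quantities of \<open>dense_scaled_orbit\<close> small. The shift
  is a contraction, so its orbits are bounded and not dense.\<close>

lemma hypercyclic_scalar_set_bounded:
  assumes hc: "hypercyclic_scalar_set TYPE('a) \<Gamma>"
  shows "bounded (\<Gamma> - {0})"
proof (rule ccontr)
  assume unb: "\<not> bounded (\<Gamma> - {0})"
  interpret embedded_shift g 1 "1 / 2" by unfold_locales auto
  have "\<exists>x\<in>c0. \<forall>f\<in>c0. \<forall>e>0. \<exists>\<gamma>\<in>\<Gamma>. \<exists>n. norm (f - scaleC \<gamma> (W (int n) x)) < e"
  proof (rule dense_scaled_orbit)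
    fix C e :: real assume Ce: "0 < C" "0 < e"
    obtain \<gamma> where \<gamma>: "\<gamma> \<in> \<Gamma>" "\<gamma> \<noteq> 0" "C / e < cmod \<gamma>"
      using unb unfolding bounded_iff by (auto simp: not_le)
    have "0 < e / (cmod \<gamma> * C)" using Ce \<gamma> by simp
    then obtain n where "(1 / 2) ^ n < e / (cmod \<gamma> * C)"
      using real_arch_pow_inv[OF _ half_less_one] by blast
    then have "cmod \<gamma> * (C * (1 / 2) ^ n) < e" using Ce \<gamma> by (simp add: field_simps)
    moreover have "C / cmod \<gamma> < e" using \<gamma> Ce by (simp add: field_simps)
    ultimately show "\<exists>\<gamma>\<in>\<Gamma>. \<exists>n. \<gamma> \<noteq> 0 \<and> cmod \<gamma> * (C * (1 / 2) ^ n) < e \<and> C / 1 ^ n / cmod \<gamma> < e"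
      using \<gamma> by auto
  qed
  then obtain x where x: "x \<in> c0" "\<forall>p\<in>c0. \<forall>e>0. \<exists>n. norm (p - W (int n) x) < e"
    using hypercyclic_scalar_setD[OF hc] by blast
  have orb: "norm (W (int n) x) \<le> norm x" for n
  proof (induction n)
    case (Suc n)
    have "W (int (Suc n)) x = W 1 (W (int n) x)" by (simp add: W_W)
    then show ?case using norm_W1_le[of "W (int n) x"] Suc by simp
  qed simp
  let ?p = "unit_seq 0 (of_real (norm x + 1))"
  obtain n where "norm (?p - W (int n) x) < 1"
    using x(2) unit_seq_c0 zero_less_one by blast
  moreover have "norm x + 1 \<le> norm ?p"
    using norm_unit_seq[of "of_real (norm x + 1)"] norm_ge_zero[of x] by (simp del: of_real_add)
  ultimately show False
    using orb[of n] norm_triangle_ineq2[of ?p "W (int n) x"] by linarith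
qed

text \<open>With weights 2 and 1, a small \<open>\<gamma>\<close> and then a large \<open>n\<close>
  make both quantities small. The shift never decreases norms, so orbits of nonzero vectors stay
  away from 0.\<close>

lemma hypercyclic_scalar_set_bounded_away:
  assumes hc: "hypercyclic_scalar_set TYPE('a) \<Gamma>"
  shows "bounded_away_from_0 (\<Gamma> - {0})"
proof (rule ccontr)
  assume away: "\<not> bounded_away_from_0 (\<Gamma> - {0})"
  interpret embedded_shift g 2 1 by unfold_locales auto
  have "\<exists>x\<in>c0. \<forall>f\<in>c0. \<forall>e>0. \<exists>\<gamma>\<in>\<Gamma>. \<exists>n. norm (f - scaleC \<gamma> (W (int n) x)) < e"
  proof (rule dense_scaled_orbit)
    fix C e :: real assume Ce: "0 < C" "0 < e"
    then have "0 < e / C" by simp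
    then have "\<exists>\<gamma>\<in>\<Gamma> - {0}. \<not> e / C \<le> cmod \<gamma>"
      using away unfolding bounded_away_from_0_def by blast
    then obtain \<gamma> where \<gamma>: "\<gamma> \<in> \<Gamma>" "\<gamma> \<noteq> 0" "cmod \<gamma> < e / C"
      unfolding not_le by blast
    have "0 < e * cmod \<gamma> / C" using Ce \<gamma> by simp
    then obtain n where "(1 / 2) ^ n < e * cmod \<gamma> / C"
      using real_arch_pow_inv[OF _ half_less_one] by blast
    then have "C * (1 / 2) ^ n < e * cmod \<gamma>" using Ce(1)
      by (simp only: pos_less_divide_eq mult.commute)
    then have "C / 2 ^ n / cmod \<gamma> < e" using \<gamma> by (simp add: power_one_over pos_divide_less_eq mult_ac)
    moreover have "cmod \<gamma> * C < e" using \<gamma> Ce by (simp add: field_simps)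
    ultimately show "\<exists>\<gamma>\<in>\<Gamma>. \<exists>n. \<gamma> \<noteq> 0 \<and> cmod \<gamma> * (C * 1 ^ n) < e \<and> C / 2 ^ n / cmod \<gamma> < e"
      using \<gamma> by auto
  qed
  then obtain x where x: "x \<in> c0" "\<forall>p\<in>c0. \<forall>e>0. \<exists>n. norm (p - W (int n) x) < e"
    using hypercyclic_scalar_setD[OF hc] by blast
  have orb: "norm x \<le> norm (W (int n) x)" for n
  proof (induction n)
    case (Suc n)
    have "W (int (Suc n)) x = W 1 (W (int n) x)" by (simp add: W_W)
    then show ?case using norm_W1_ge[of "W (int n) x"] Suc by simp
  qed simp
  show False
  proof (cases "x = 0")
    case True
    obtain n where "norm (unit_seq 0 1 - W (int n) x) < 1"
      using x(2) unit_seq_c0 zero_less_one by blast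
    then show False using True norm_unit_seq[of 1] by simp
  next
    case False
    then have "0 < norm x" by simp
    then obtain n where "norm (0 - W (int n) x) < norm x"
      using x(2) c0_zero by blast
    then show False using orb[of n] by simp
  qed
qed

end

theorem theoremA:
  fixes \<Gamma> :: "complex set"
  assumes "\<Gamma> \<noteq> {}"
    and "\<exists>f :: complex \<Rightarrow> 'a. inj f"
  shows "hypercyclic_scalar_set TYPE('a) \<Gamma> \<longleftrightarrow>
    \<Gamma> - {0} \<noteq> {} \<and> bounded (\<Gamma> - {0}) \<and> bounded_away_from_0 (\<Gamma> - {0})"
proof -
  \<comment> \<open>An embedding of the complex numbers into \<open>'a\<close> extends to one of the
    whole sequence space, as the latter injects into the complex numbers.\<close>
  obtain f1 :: "complex \<Rightarrow> 'a" and f2 :: "cseq \<Rightarrow> complex" where "inj f1" "inj f2"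
    using assms(2) inj_cseq_complex by blast
  then interpret cseq_embedding "f1 \<circ> f2"
    by (intro cseq_embedding.intro inj_compose)
  show ?thesis
    using hypercyclic_scalar_set_nonzero hypercyclic_scalar_set_bounded
      hypercyclic_scalar_set_bounded_away bounded_annulus_imp_hypercyclic_scalar_set by blast
qed

end
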